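(* For any open non-Archimedean quasi-Polish groupoid $G$, there exist a countable single-sorted relational first-order language $\mathcal L$, an $\mathcal L_{\omega_1\omega}$-sentence $\varphi$, and a Borel equivalence of groupoids $G\to\mathbb S_\infty\ltimes\mathrm{Mod}_{\mathbb N}(\mathcal L,\varphi)$.
   Context: Let $\mathbb S=\{0,1\}$ with open sets $\emptyset,\{1\},\{0,1\}$. A set is $\mathbf\Pi^0_2$ if it is of the form $\bigcap_{i\in\mathbb N}(F_i\cup U_i)$ with $F_i$ closed, $U_i$ open. A space is quasi-Polish if it is homeomorphic to a $\mathbf\Pi^0_2$ subspace of $\mathbb S^{\mathbb N}$; such spaces are standard Borel. A groupoid $G$ is a small category with all morphisms invertible; $G$ also denotes its set of morphisms and $G^0\subseteq G$ its set of objects (identified with unit morphisms). A topological groupoid has topologies on $G^0,G$ making source $\sigma$, target, unit, multiplication and inverse continuous; it is open if $\sigma:G\to G^0$ is an open map, quasi-Polish if $G^0,G$ are quasi-Polish, and non-Archimedean if every $x\in G^0$ has a neighborhood basis in $G$ consisting of open subgroupoids (open subsets closed under inverse and multiplication). A quasi-Polish groupoid is regarded as a standard Borel groupoid (standard Borel spaces of objects and morphisms, Borel structure maps). A Borel functor is a functor Borel on objects and morphisms. A Borel equivalence $F:G\to H$ is a Borel functor for which there are a Borel functor $F':H\to G$ and natural isomorphisms $F\circ F'\cong1_H$, $F'\circ F\cong1_G$ that are Borel as maps from objects to morphisms. For a countable single-sorted relational $\mathcal L$, $\mathrm{Mod}_{\mathbb N}(\mathcal L)=\prod_{R\in\mathcal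 L}2^{\mathbb N^{n_R}}$ ($n_R$ the arity of $R$) is the Polish space of $\mathcal L$-structures on $\mathbb N$; $\mathbb S_\infty$, the Polish group of bijections of $\mathbb N$, acts on it by pushforward. $\mathcal L_{\omega_1\omega}$ is first-order logic with countable conjunctions and disjunctions; $\mathrm{Mod}_{\mathbb N}(\mathcal L,\varphi)$ is the invariant Borel set of models of $\varphi$ in $\mathrm{Mod}_{\mathbb N}(\mathcal L)$. The action groupoid $\mathbb S_\infty\ltimes\mathrm{Mod}_{\mathbb N}(\mathcal L,\varphi)$ has objects $\mathrm{Mod}_{\mathbb N}(\mathcal L,\varphi)$ and morphisms $(g,\mathcal M):\mathcal M\to g\cdot\mathcal M$ for $g\in\mathbb S_\infty$. *)

theory Defs
  imports "HOL-Analysis.Analysis"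
begin

section \<open>Quasi-Polish spaces\<close>

definition sierpinski :: "bool topology"
  where "sierpinski = topology (\<lambda>U. U \<in> {{}, {True}, UNIV})"

lemma openin_sierpinski: "openin sierpinski U \<longleftrightarrow> U \<in> {{}, {True}, UNIV}"
proof -
  have chain: "A \<subseteq> B \<or> B \<subseteq> A" if "A \<in> {{}, {True}, UNIV}" "B \<in> {{}, {True}, UNIV}"
    for A B :: "bool set"
    using that by auto
  have "\<Union>\<K> \<in> {{}, {True}, UNIV}" if "\<forall>K\<in>\<K>. K \<in> {{}, {True}, UNIV}" for \<K> :: "bool set set"
  proof (cases "\<exists>K\<in>\<K>. False \<in> K")
    case True
    then have "UNIV \<in> \<K>" using that by fastforce
    then show ?thesis by auto
  next
    case False
    then have "\<Union>\<K> \<subseteq> {True}" by (metis (full_types) UnionE singletonI subsetI)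
    then show ?thesis by blast
  qed
  moreover have "A \<inter> B \<in> {{}, {True}, UNIV}"
    if "A \<in> {{}, {True}, UNIV}" "B \<in> {{}, {True}, UNIV}" for A B :: "bool set"
    using chain[OF that] that by (metis inf.absorb1 inf.absorb2)
  ultimately have "istopology (\<lambda>U :: bool set. U \<in> {{}, {True}, UNIV})"
    unfolding istopology_def by blast
  then show ?thesis
    by (simp add: sierpinski_def topology_inverse')
qed

text \<open>In non-metrizable spaces closed sets need not be countable intersections of open sets,
  hence the unions of closed and open sets.\<close>

definition Pi02_in :: "'a topology \<Rightarrow> 'a set \<Rightarrow> bool"
  where "Pi02_in X A \<longleftrightarrow>
    (\<exists>F U :: nat \<Rightarrow> 'a set. (\<forall>i. closedin X (F i)) \<and> (\<forall>i. openin X (U i)) \<and>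
      A = (\<Inter>i. F i \<union> U i))"

definition quasi_polish :: "'a topology \<Rightarrow> bool"
  where "quasi_polish X \<longleftrightarrow>
    (\<exists>A. Pi02_in (product_topology (\<lambda>_ :: nat. sierpinski) UNIV) A \<and>
      X homeomorphic_space subtopology (product_topology (\<lambda>_. sierpinski) UNIV) A)"

definition borel_of :: "'a topology \<Rightarrow> 'a measure"
  where "borel_of X = sigma (topspace X) {U. openin X U}"


section \<open>Groupoids\<close>

text \<open>Objects and morphisms live in separate types; \<open>ident\<close> realizes the identification of objects
  with unit morphisms. The value \<open>mult G g h\<close> is the composite ``\<open>g\<close> after \<open>h\<close>'' and is meaningful
  only when \<open>source G g = target G h\<close>.\<close>

record ('o, 'm) groupoid =
  Obj :: "'o set"
  Mor :: "'m set"
  source :: "'m \<Rightarrow> 'o"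
  target :: "'m \<Rightarrow> 'o"
  ident :: "'o \<Rightarrow> 'm"
  mult :: "'m \<Rightarrow> 'm \<Rightarrow> 'm"
  invert :: "'m \<Rightarrow> 'm"

definition composable :: "('o, 'm, 'z) groupoid_scheme \<Rightarrow> ('m \<times> 'm) set"
  where "composable G = {(g, h). g \<in> Mor G \<and> h \<in> Mor G \<and> source G g = target G h}"

locale groupoid =
  fixes G :: "('o, 'm, 'z) groupoid_scheme"
  assumes source_closed: "g \<in> Mor G \<Longrightarrow> source G g \<in> Obj G"
    and target_closed: "g \<in> Mor G \<Longrightarrow> target G g \<in> Obj G"
    and ident_closed: "x \<in> Obj G \<Longrightarrow> ident G x \<in> Mor G"
    and source_ident: "x \<in> Obj G \<Longrightarrow> source G (ident G x) = x"
    and target_ident: "x \<in> Obj G \<Longrightarrow> target G (ident G x) = x"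
    and mult_closed: "(g, h) \<in> composable G \<Longrightarrow> mult G g h \<in> Mor G"
    and source_mult: "(g, h) \<in> composable G \<Longrightarrow> source G (mult G g h) = source G h"
    and target_mult: "(g, h) \<in> composable G \<Longrightarrow> target G (mult G g h) = target G g"
    and mult_assoc: "(g, h) \<in> composable G \<Longrightarrow> (h, k) \<in> composable G \<Longrightarrow>
      mult G (mult G g h) k = mult G g (mult G h k)"
    and mult_ident_right: "g \<in> Mor G \<Longrightarrow> mult G g (ident G (source G g)) = g"
    and mult_ident_left: "g \<in> Mor G \<Longrightarrow> mult G (ident G (target G g)) g = g"
    and invert_closed: "g \<in> Mor G \<Longrightarrow> invert G g \<in> Mor G"
    and source_invert: "g \<in> Mor G \<Longrightarrow> source G (invert G g) = target G g"
    and target_invert: "g \<in> Mor G \<Longrightarrow> target G (invert G g) = source G g"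
    and invert_mult: "g \<in> Mor G \<Longrightarrow> mult G (invert G g) g = ident G (source G g)"
    and mult_invert: "g \<in> Mor G \<Longrightarrow> mult G g (invert G g) = ident G (target G g)"


subsection \<open>Topological groupoids\<close>

record ('o, 'm) top_groupoid = "('o, 'm) groupoid" +
  obj_top :: "'o topology"
  mor_top :: "'m topology"

locale topological_groupoid = groupoid G
  for G :: "('o, 'm, 'z) top_groupoid_scheme" +
  assumes topspace_obj: "topspace (obj_top G) = Obj G"
    and topspace_mor: "topspace (mor_top G) = Mor G"
    and continuous_source: "continuous_map (mor_top G) (obj_top G) (source G)"
    and continuous_target: "continuous_map (mor_top G) (obj_top G) (target G)"
    and continuous_ident: "continuous_map (obj_top G) (mor_top G) (ident G)"
    and continuous_mult:
      "continuous_map (subtopology (prod_topology (mor_top G) (mor_top G)) (composable G))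
        (mor_top G) (\<lambda>(g, h). mult G g h)"
    and continuous_invert: "continuous_map (mor_top G) (mor_top G) (invert G)"

definition open_groupoid :: "('o, 'm, 'z) top_groupoid_scheme \<Rightarrow> bool"
  where "open_groupoid G \<longleftrightarrow>
    topological_groupoid G \<and> open_map (mor_top G) (obj_top G) (source G)"

definition quasi_polish_groupoid :: "('o, 'm, 'z) top_groupoid_scheme \<Rightarrow> bool"
  where "quasi_polish_groupoid G \<longleftrightarrow>
    topological_groupoid G \<and> quasi_polish (obj_top G) \<and> quasi_polish (mor_top G)"

definition open_subgroupoid :: "('o, 'm, 'z) top_groupoid_scheme \<Rightarrow> 'm set \<Rightarrow> bool"
  where "open_subgroupoid G U \<longleftrightarrow>
    openin (mor_top G) U \<and>
    (\<forall>g\<in>U. invert G g \<in> U) \<and>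
    (\<forall>g\<in>U. \<forall>h\<in>U. source G g = target G h \<longrightarrow> mult G g h \<in> U)"

definition non_archimedean :: "('o, 'm, 'z) top_groupoid_scheme \<Rightarrow> bool"
  where "non_archimedean G \<longleftrightarrow>
    topological_groupoid G \<and>
    (\<forall>x\<in>Obj G. \<forall>W. openin (mor_top G) W \<and> ident G x \<in> W \<longrightarrow>
      (\<exists>U. open_subgroupoid G U \<and> ident G x \<in> U \<and> U \<subseteq> W))"


subsection \<open>Borel groupoids and Borel equivalences\<close>

text \<open>Only the carriers and \<open>\<sigma>\<close>-algebras of the two measure spaces are used.\<close>

record ('o, 'm) borel_groupoid = "('o, 'm) groupoid" +
  obj_borel :: "'o measure"
  mor_borel :: "'m measure"

definition borel_groupoid_of :: "('o, 'm) top_groupoid \<Rightarrow> ('o, 'm) borel_groupoid"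
  where "borel_groupoid_of G = groupoid.extend (groupoid.truncate G)
    (borel_groupoid.fields (borel_of (obj_top G)) (borel_of (mor_top G)))"

record ('o, 'm, 'p, 'n) gpd_functor =
  on_obj :: "'o \<Rightarrow> 'p"
  on_mor :: "'m \<Rightarrow> 'n"

definition is_functor ::
    "('o, 'm, 'y) groupoid_scheme \<Rightarrow> ('p, 'n, 'z) groupoid_scheme \<Rightarrow> ('o, 'm, 'p, 'n) gpd_functor \<Rightarrow> bool"
  where "is_functor G H F \<longleftrightarrow>
    on_obj F \<in> Obj G \<rightarrow> Obj H \<and>
    on_mor F \<in> Mor G \<rightarrow> Mor H \<and>
    (\<forall>g\<in>Mor G. source H (on_mor F g) = on_obj F (source G g)) \<and>
    (\<forall>g\<in>Mor G. target H (on_mor F g) = on_obj F (target G g)) \<and>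
    (\<forall>x\<in>Obj G. on_mor F (ident G x) = ident H (on_obj F x)) \<and>
    (\<forall>(g, h)\<in>composable G. on_mor F (mult G g h) = mult H (on_mor F g) (on_mor F h))"

definition id_functor :: "('o, 'm, 'o, 'm) gpd_functor"
  where "id_functor = \<lparr>on_obj = (\<lambda>x. x), on_mor = (\<lambda>g. g)\<rparr>"

definition comp_functor ::
    "('p, 'n, 'q, 'k) gpd_functor \<Rightarrow> ('o, 'm, 'p, 'n) gpd_functor \<Rightarrow> ('o, 'm, 'q, 'k) gpd_functor"
  where "comp_functor E F = \<lparr>on_obj = on_obj E \<circ> on_obj F, on_mor = on_mor E \<circ> on_mor F\<rparr>"

text \<open>Naturality alone makes \<open>\<eta>\<close> a natural isomorphism, because every component is a morphism of the
  groupoid \<open>H\<close> and hence invertible.\<close>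

definition is_natural_iso ::
    "('o, 'm, 'y) groupoid_scheme \<Rightarrow> ('p, 'n, 'z) groupoid_scheme \<Rightarrow>
      ('o, 'm, 'p, 'n) gpd_functor \<Rightarrow> ('o, 'm, 'p, 'n) gpd_functor \<Rightarrow> ('o \<Rightarrow> 'n) \<Rightarrow> bool"
  where "is_natural_iso G H E F \<eta> \<longleftrightarrow>
    (\<forall>x\<in>Obj G. \<eta> x \<in> Mor H \<and> source H (\<eta> x) = on_obj E x \<and> target H (\<eta> x) = on_obj F x) \<and>
    (\<forall>g\<in>Mor G. mult H (\<eta> (target G g)) (on_mor E g) = mult H (on_mor F g) (\<eta> (source G g)))"

definition borel_functor ::
    "('o, 'm) borel_groupoid \<Rightarrow> ('p, 'n) borel_groupoid \<Rightarrow> ('o, 'm, 'p, 'n) gpd_functor \<Rightarrow> bool"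
  where "borel_functor G H F \<longleftrightarrow>
    is_functor G H F \<and>
    on_obj F \<in> measurable (obj_borel G) (obj_borel H) \<and>
    on_mor F \<in> measurable (mor_borel G) (mor_borel H)"

definition borel_isomorphic ::
    "('o, 'm) borel_groupoid \<Rightarrow> ('p, 'n) borel_groupoid \<Rightarrow>
      ('o, 'm, 'p, 'n) gpd_functor \<Rightarrow> ('o, 'm, 'p, 'n) gpd_functor \<Rightarrow> bool"
  where "borel_isomorphic G H E F \<longleftrightarrow>
    (\<exists>\<eta>. is_natural_iso G H E F \<eta> \<and> \<eta> \<in> measurable (obj_borel G) (mor_borel H))"

definition borel_equivalence ::
    "('o, 'm) borel_groupoid \<Rightarrow> ('p, 'n) borel_groupoid \<Rightarrow> ('o, 'm, 'p, 'n) gpd_functor \<Rightarrow> bool"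
  where "borel_equivalence G H F \<longleftrightarrow>
    borel_functor G H F \<and>
    (\<exists>F'. borel_functor H G F' \<and>
      borel_isomorphic H H (comp_functor F F') id_functor \<and>
      borel_isomorphic G G (comp_functor F' F) id_functor)"


section \<open>Infinitary logic\<close>

record 'r language =
  symbols :: "'r set"
  arity :: "'r \<Rightarrow> nat"

text \<open>\<open>Conj I \<Phi>\<close> and \<open>Disj I \<Phi>\<close> are the conjunction and disjunction of the countable family
  \<open>(\<Phi> i)\<^sub>i\<^sub>\<in>\<^sub>I\<close>; the values of \<open>\<Phi>\<close> outside \<open>I\<close> are irrelevant. Formulas may have infinitely many free
  variables, but every subformula of a sentence has only finitely many, since each quantifier binds
  a single variable.\<close>

datatype 'r fm =
  Eq nat nat
| Rel 'r "nat list"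
| Neg "'r fm"
| Conj "nat set" "nat \<Rightarrow> 'r fm"
| Disj "nat set" "nat \<Rightarrow> 'r fm"
| Exists nat "'r fm"
| Forall nat "'r fm"

primrec formula :: "'r language \<Rightarrow> 'r fm \<Rightarrow> bool"
  where
    "formula L (Eq x y) \<longleftrightarrow> True"
  | "formula L (Rel R xs) \<longleftrightarrow> R \<in> symbols L \<and> length xs = arity L R"
  | "formula L (Neg \<phi>) \<longleftrightarrow> formula L \<phi>"
  | "formula L (Conj I \<Phi>) \<longleftrightarrow> (\<forall>i\<in>I. formula L (\<Phi> i))"
  | "formula L (Disj I \<Phi>) \<longleftrightarrow> (\<forall>i\<in>I. formula L (\<Phi> i))"
  | "formula L (Exists x \<phi>) \<longleftrightarrow> formula L \<phi>"
  | "formula L (Forall x \<phi>) \<longleftrightarrow> formula L \<phi>"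

primrec free_vars :: "'r fm \<Rightarrow> nat set"
  where
    "free_vars (Eq x y) = {x, y}"
  | "free_vars (Rel R xs) = set xs"
  | "free_vars (Neg \<phi>) = free_vars \<phi>"
  | "free_vars (Conj I \<Phi>) = (\<Union>i\<in>I. free_vars (\<Phi> i))"
  | "free_vars (Disj I \<Phi>) = (\<Union>i\<in>I. free_vars (\<Phi> i))"
  | "free_vars (Exists x \<phi>) = free_vars \<phi> - {x}"
  | "free_vars (Forall x \<phi>) = free_vars \<phi> - {x}"

definition sentence :: "'r language \<Rightarrow> 'r fm \<Rightarrow> bool"
  where "sentence L \<phi> \<longleftrightarrow> formula L \<phi> \<and> free_vars \<phi> = {}"

text \<open>A structure on \<open>\<nat>\<close> assigns to each \<open>n\<close>-ary symbol a subset of \<open>\<nat>\<^sup>n\<close>, given by its indicator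
  function on lists of length \<open>n\<close>.\<close>

primrec sat :: "('r \<Rightarrow> nat list \<Rightarrow> bool) \<Rightarrow> 'r fm \<Rightarrow> (nat \<Rightarrow> nat) \<Rightarrow> bool"
  where
    "sat M (Eq x y) v \<longleftrightarrow> v x = v y"
  | "sat M (Rel R xs) v \<longleftrightarrow> M R (map v xs)"
  | "sat M (Neg \<phi>) v \<longleftrightarrow> \<not> sat M \<phi> v"
  | "sat M (Conj I \<Phi>) v \<longleftrightarrow> (\<forall>i\<in>I. sat M (\<Phi> i) v)"
  | "sat M (Disj I \<Phi>) v \<longleftrightarrow> (\<exists>i\<in>I. sat M (\<Phi> i) v)"
  | "sat M (Exists x \<phi>) v \<longleftrightarrow> (\<exists>a. sat M \<phi> (v(x := a)))"
  | "sat M (Forall x \<phi>) v \<longleftrightarrow> (\<forall>a. sat M \<phi> (v(x := a)))"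

definition Mod_top :: "'r language \<Rightarrow> ('r \<Rightarrow> nat list \<Rightarrow> bool) topology"
  where "Mod_top L = product_topology
    (\<lambda>R. product_topology (\<lambda>_. discrete_topology UNIV) {xs. length xs = arity L R}) (symbols L)"

definition Models :: "'r language \<Rightarrow> 'r fm \<Rightarrow> ('r \<Rightarrow> nat list \<Rightarrow> bool) set"
  where "Models L \<phi> = {M \<in> topspace (Mod_top L). \<forall>v. sat M \<phi> v}"

definition Mod_borel :: "'r language \<Rightarrow> 'r fm \<Rightarrow> ('r \<Rightarrow> nat list \<Rightarrow> bool) measure"
  where "Mod_borel L \<phi> = restrict_space (borel_of (Mod_top L)) (Models L \<phi>)"

definition S_inf_top :: "(nat \<Rightarrow> nat) topology"
  where "S_inf_top = subtopology (product_topology (\<lambda>_. discrete_topology UNIV) UNIV) {g. bij g}"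

definition push ::
    "'r language \<Rightarrow> (nat \<Rightarrow> nat) \<Rightarrow> ('r \<Rightarrow> nat list \<Rightarrow> bool) \<Rightarrow> ('r \<Rightarrow> nat list \<Rightarrow> bool)"
  where "push L g M =
    (\<lambda>R\<in>symbols L. \<lambda>xs\<in>{xs. length xs = arity L R}. M R (map (inv g) xs))"

definition action_groupoid ::
    "'r language \<Rightarrow> 'r fm \<Rightarrow>
      ('r \<Rightarrow> nat list \<Rightarrow> bool, (nat \<Rightarrow> nat) \<times> ('r \<Rightarrow> nat list \<Rightarrow> bool)) borel_groupoid"
  where "action_groupoid L \<phi> =
    \<lparr>Obj = Models L \<phi>,
     Mor = {g. bij g} \<times> Models L \<phi>,
     source = (\<lambda>(g, M). M),
     target = (\<lambda>(g, M). push L g M),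
     ident = (\<lambda>M. (id, M)),
     mult = (\<lambda>(g, N) (h, M). (g \<circ> h, M)),
     invert = (\<lambda>(g, M). (inv g, push L g M)),
     obj_borel = Mod_borel L \<phi>,
     mor_borel = borel_of S_inf_top \<Otimes>\<^sub>M Mod_borel L \<phi>\<rparr>"

end

theory Submission
  imports Defs
begin

text \<open>
  Fix a countable family of open subgroupoids \<open>U\<^sub>j\<close>, each occurring infinitely often, that contains
  a neighbourhood base at every unit, and a countable base \<open>W\<^sub>n\<close> of the space of morphisms. To an
  object \<open>x\<close> belongs the countably infinite set \<open>fib x\<close> of all cosets \<open>g U\<^sub>j\<close> of morphisms with target
  \<open>x\<close>. Morphisms \<open>x \<rightarrow> y\<close> act on these sets by left multiplication and preserve the binary
  relations ``\<open>a\<close> has index \<open>i\<close>, \<open>b\<close> has index \<open>j\<close>, and \<open>a\<^sup>-\<^sup>1 b\<close> meets \<open>W\<^sub>n\<close>''. A Borel enumeration of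
  the sets \<open>fib x\<close> by \<open>\<nat>\<close> turns this into a Borel functor \<open>coding\<close> from the groupoid to structures
  on \<open>\<nat>\<close>, sending \<open>x\<close> to \<open>str x\<close> and \<open>g\<close> to the permutation \<open>perm g\<close>. The claim is that it is a Borel
  equivalence onto the models of a suitable sentence.

  The main tool is a category argument in the form of generic sequences. A sufficiently generic
  descending sequence of cosets in \<open>fib x\<close> converges to a single morphism \<open>g\<close> with target \<open>x\<close>
  (\<open>converges_ex\<close>); this uses that a quasi-Polish space is given by countably many rules, each of
  which yields a dense set of cosets. The source of \<open>g\<close> and the isomorphism \<open>g\<^sup>-\<^sup>1\<close> onto the structure
  of that source can then be read off from the relations between the members of the sequence and
  the other cosets, without knowing \<open>x\<close> (\<open>base_seq_str\<close>, \<open>nbhd_set_str\<close>).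

  This has two consequences. First, the functor is full (\<open>perm_full\<close>): given an isomorphism \<open>\<theta>\<close>
  between two such structures, choose a sequence that is generic on both sides; its limits \<open>g\<close> and \<open>h\<close> have
  the same source, and \<open>h g\<^sup>-\<^sup>1\<close> induces \<open>\<theta>\<close>. It is faithful because cosets separate morphisms. Secondly, for an
  arbitrary structure \<open>M\<close> and an enumeration \<open>e\<close> of it, there is a Borel condition \<open>good M e\<close> which holds for
  generic enumerations of the structures \<open>str x\<close> and which exhibits \<open>M\<close> as isomorphic to some \<open>str x\<close>
  (\<open>good_str\<close>, \<open>match_iso\<close>).

  It remains to replace the condition on an enumeration by a sentence. As in the theorem of
  Lopez-Escobar, every Borel property of enumerated structures is decided along generic
  enumerations by \<open>\<L>\<^bsub>\<omega>\<^sub>1\<omega>\<^esub>\<close>-definable properties of finite initial segments (\<open>forcible_diagram\<close>). The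
  sentence says that some finite sequence forces \<open>good\<close>. In a model of it, least choices produce
  in a Borel way an enumeration that is generic for the countably many definable dense sets involved, hence
  good. This gives an object and an isomorphism, depending on the model in a Borel way, from which the
  inverse functor \<open>decoding\<close> and the two natural isomorphisms are obtained by fullness and
  faithfulness.
\<close>

section \<open>Countable subbases and their Borel structure\<close>

definition subbox :: "'a topology \<Rightarrow> ('i \<Rightarrow> 'a set) \<Rightarrow> 'i set \<Rightarrow> 'a set"
  where "subbox X B u = topspace X \<inter> (\<Inter>n\<in>u. B n)"

definition subbase :: "'a topology \<Rightarrow> ('i \<Rightarrow> 'a set) \<Rightarrow> bool"
  where "subbase X B \<longleftrightarrow> (\<forall>n. openin X (B n)) \<and>
    (\<forall>V x. openin X V \<and> x \<in> V \<longrightarrow> (\<exists>u. finite u \<and> x \<in> subbox X B u \<and> subbox X B u \<subseteq> V))"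

lemma subbaseI:
  assumes "\<And>n. openin X (B n)"
    and "\<And>V x. openin X V \<Longrightarrow> x \<in> V \<Longrightarrow> \<exists>u. finite u \<and> x \<in> subbox X B u \<and> subbox X B u \<subseteq> V"
  shows "subbase X B"
  using assms by (auto simp: subbase_def)

lemma subbase_openin: "subbase X B \<Longrightarrow> openin X (B n)"
  by (auto simp: subbase_def)

lemma subbaseE:
  assumes "subbase X B" "openin X V" "x \<in> V"
  obtains u where "finite u" "x \<in> subbox X B u" "subbox X B u \<subseteq> V"
  using assms unfolding subbase_def by blast

lemma openin_subbox: "subbase X B \<Longrightarrow> finite u \<Longrightarrow> openin X (subbox X B u)"
  unfolding subbox_def by (cases "u = {}") (auto intro!: openin_Int openin_Inter simp: subbase_openin)

lemma subbase_discrete: "subbase (discrete_topology UNIV) (\<lambda>y. {y})"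
proof (rule subbaseI)
  fix V :: "'a set" and x assume "x \<in> V"
  then show "\<exists>u. finite u \<and> x \<in> subbox (discrete_topology UNIV) (\<lambda>y. {y}) u \<and>
      subbox (discrete_topology UNIV) (\<lambda>y. {y}) u \<subseteq> V"
    by (intro exI[of _ "{x}"]) (auto simp: subbox_def)
qed auto

lemma topspace_sierpinski [simp]: "topspace sierpinski = UNIV"
  unfolding topspace_def openin_sierpinski by auto

lemma subbase_sierpinski: "subbase sierpinski (\<lambda>_ :: unit. {True})"
proof (rule subbaseI)
  fix V x assume V: "openin sierpinski V" "x \<in> V"
  then consider "V = {True}" | "V = UNIV" by (auto simp: openin_sierpinski)
  then show "\<exists>u :: unit set. finite u \<and> x \<in> subbox sierpinski (\<lambda>_. {True}) u \<and>
      subbox sierpinski (\<lambda>_. {True}) u \<subseteq> V"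
  proof cases
    case 1
    then show ?thesis using V by (intro exI[of _ "{()}"]) (auto simp: subbox_def)
  next
    case 2
    then show ?thesis by (intro exI[of _ "{}"]) (auto simp: subbox_def)
  qed
qed (auto simp: openin_sierpinski)

text \<open>The guard \<open>i \<in> I\<close> makes indices outside of \<open>I\<close> contribute the whole space, so that subbases can be
  indexed by a whole countable type.\<close>

definition cylinder :: "('i \<Rightarrow> 'a topology) \<Rightarrow> 'i set \<Rightarrow> ('i \<Rightarrow> 'j \<Rightarrow> 'a set) \<Rightarrow> 'i \<times> 'j \<Rightarrow> ('i \<Rightarrow> 'a) set"
  where "cylinder X I B = (\<lambda>(i, j). {f \<in> topspace (product_topology X I). i \<in> I \<longrightarrow> f i \<in> B i j})"

lemma subbase_product:
  fixes X :: "'i \<Rightarrow> 'a topology" and B :: "'i \<Rightarrow> 'j \<Rightarrow> 'a set"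
  assumes B: "\<And>i. i \<in> I \<Longrightarrow> subbase (X i) (B i)"
  shows "subbase (product_topology X I) (cylinder X I B)"
proof (rule subbaseI)
  fix k :: "'i \<times> 'j"
  obtain i j where k: "k = (i, j)" by force
  show "openin (product_topology X I) (cylinder X I B k)"
  proof (cases "i \<in> I")
    case True
    have "openin (product_topology X I) {f \<in> topspace (product_topology X I). f i \<in> B i j}"
      by (rule openin_continuous_map_preimage[OF continuous_map_product_projection[OF True]])
        (rule subbase_openin[OF B[OF True]])
    then show ?thesis using True by (simp add: cylinder_def k)
  next
    case False
    then have "cylinder X I B k = topspace (product_topology X I)"
      by (simp add: cylinder_def k)
    then show ?thesis by (metis openin_topspace)
  qed
next
  fix V and f :: "'i \<Rightarrow> 'a"
  assume "openin (product_topology X I) V" "f \<in> V"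
  from product_topology_open_contains_basis[OF this] obtain Y where
    Y: "f \<in> (\<Pi>\<^sub>E i\<in>I. Y i)" "\<And>i. openin (X i) (Y i)"
      "finite {i. Y i \<noteq> topspace (X i)}" "(\<Pi>\<^sub>E i\<in>I. Y i) \<subseteq> V" by auto
  define J where "J = {i \<in> I. Y i \<noteq> topspace (X i)}"
  have finJ: "finite J" using Y(3) by (auto simp: J_def elim: rev_finite_subset)
  have "\<exists>u. finite u \<and> f i \<in> subbox (X i) (B i) u \<and> subbox (X i) (B i) u \<subseteq> Y i" if "i \<in> J" for i
  proof -
    have i: "i \<in> I" "f i \<in> Y i" using that Y(1) by (auto simp: J_def PiE_def)
    show ?thesis using subbaseE[OF B[OF i(1)] Y(2) i(2)] by metis
  qed
  then obtain u where u: "\<And>i. i \<in> J \<Longrightarrow> finite (u i) \<and> f i \<in> subbox (X i) (B i) (u i) \<and>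
      subbox (X i) (B i) (u i) \<subseteq> Y i" by metis
  have ftop: "f \<in> topspace (product_topology X I)"
    using Y(1) openin_subset[OF Y(2)] by (auto simp: PiE_iff)
  have "finite (Sigma J u)" using finJ u by auto
  moreover have "f \<in> subbox (product_topology X I) (cylinder X I B) (Sigma J u)"
    using ftop u unfolding subbox_def cylinder_def by auto
  moreover have "subbox (product_topology X I) (cylinder X I B) (Sigma J u) \<subseteq> (\<Pi>\<^sub>E i\<in>I. Y i)"
  proof
    fix h assume h: "h \<in> subbox (product_topology X I) (cylinder X I B) (Sigma J u)"
    have htop: "h \<in> (\<Pi>\<^sub>E i\<in>I. topspace (X i))" using h by (auto simp: subbox_def)
    have "h i \<in> Y i" if "i \<in> I" for i
    proof (cases "i \<in> J")
      case True
      have "h i \<in> B i j" if "j \<in> u i" for j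
        using h True \<open>i \<in> I\<close> that unfolding subbox_def cylinder_def by fastforce
      moreover have "h i \<in> topspace (X i)" using htop \<open>i \<in> I\<close> by auto
      ultimately have "h i \<in> subbox (X i) (B i) (u i)" by (auto simp: subbox_def)
      then show ?thesis using u[OF True] by auto
    next
      case False
      then show ?thesis using htop that by (auto simp: J_def)
    qed
    then show "h \<in> (\<Pi>\<^sub>E i\<in>I. Y i)" using htop by (auto simp: PiE_iff)
  qed
  ultimately show "\<exists>u. finite u \<and> f \<in> subbox (product_topology X I) (cylinder X I B) u \<and>
      subbox (product_topology X I) (cylinder X I B) u \<subseteq> V"
    using Y(4) by blast
qed

lemma subbase_subtopology:
  assumes "subbase X B"
  shows "subbase (subtopology X A) (\<lambda>n. B n \<inter> A)"
proof (rule subbaseI)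
  fix n show "openin (subtopology X A) (B n \<inter> A)"
    using subbase_openin[OF assms] by (auto simp: openin_subtopology)
next
  fix V x assume "openin (subtopology X A) V" "x \<in> V"
  then obtain T where T: "openin X T" "V = T \<inter> A" by (auto simp: openin_subtopology)
  then have "x \<in> T" using \<open>x \<in> V\<close> by auto
  from subbaseE[OF assms T(1) this] obtain u where u: "finite u" "x \<in> subbox X B u" "subbox X B u \<subseteq> T" .
  show "\<exists>u. finite u \<and> x \<in> subbox (subtopology X A) (\<lambda>n. B n \<inter> A) u \<and>
      subbox (subtopology X A) (\<lambda>n. B n \<inter> A) u \<subseteq> V"
    using u T \<open>x \<in> V\<close> by (intro exI[of _ u]) (auto simp: subbox_def)
qed

lemma subbase_homeomorphic:
  assumes f: "homeomorphic_map X Y f" and B: "subbase Y B"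
  shows "subbase X (\<lambda>n. {x \<in> topspace X. f x \<in> B n})"
proof (rule subbaseI)
  have cf: "continuous_map X Y f" using f homeomorphic_imp_continuous_map by blast
  fix n show "openin X {x \<in> topspace X. f x \<in> B n}"
    by (rule openin_continuous_map_preimage[OF cf subbase_openin[OF B]])
next
  fix V x assume V: "openin X V" "x \<in> V"
  have VX: "V \<subseteq> topspace X" using V(1) openin_subset by blast
  have "openin Y (f ` V)"
    using f V(1) VX homeomorphic_map_openness by blast
  from subbaseE[OF B this] V(2) obtain u where
    u: "finite u" "f x \<in> subbox Y B u" "subbox Y B u \<subseteq> f ` V" by blast
  have inj: "inj_on f (topspace X)" using f homeomorphic_imp_injective_map by blast
  have surj: "f ` topspace X = topspace Y" using f homeomorphic_imp_surjective_map by blast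
  have "y \<in> V" if y: "y \<in> topspace X" "\<And>n. n \<in> u \<Longrightarrow> f y \<in> B n" for y
  proof -
    have "f y \<in> subbox Y B u" using y surj by (auto simp: subbox_def)
    then obtain v where "v \<in> V" "f y = f v" using u(3) by blast
    then show ?thesis using inj y(1) VX by (metis inj_onD subsetD)
  qed
  then show "\<exists>u. finite u \<and> x \<in> subbox X (\<lambda>n. {x \<in> topspace X. f x \<in> B n}) u \<and>
      subbox X (\<lambda>n. {x \<in> topspace X. f x \<in> B n}) u \<subseteq> V"
    using u V VX by (intro exI[of _ u]) (auto simp: subbox_def)
qed

lemma space_borel_of [simp]: "space (borel_of X) = topspace X"
  unfolding borel_of_def by (rule space_measure_of) (auto dest: openin_subset)

lemma sets_borel_of: "sets (borel_of X) = sigma_sets (topspace X) {U. openin X U}"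
  unfolding borel_of_def by (rule sets_measure_of) (auto dest: openin_subset)

lemma openin_borel_of: "openin X U \<Longrightarrow> U \<in> sets (borel_of X)"
  by (simp add: sets_borel_of sigma_sets.Basic)

text \<open>With a countable subbase, every open set is a countable union of boxes, so that measurability
  into the Borel space can be tested on the subbase.\<close>

lemma measurable_borel_of_subbase:
  fixes B :: "'i :: countable \<Rightarrow> 'a set"
  assumes B: "subbase X B" and f: "f \<in> space N \<rightarrow> topspace X"
    and m: "\<And>n. {w \<in> space N. f w \<in> B n} \<in> sets N"
  shows "f \<in> measurable N (borel_of X)"
  unfolding borel_of_def
proof (rule measurable_measure_of)
  show "{U. openin X U} \<subseteq> Pow (topspace X)" by (auto dest: openin_subset)
  show "f \<in> space N \<rightarrow> topspace X" by (rule f)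
  fix V assume "V \<in> {U. openin X U}"
  then have V: "openin X V" by simp
  define \<U> where "\<U> = {u. finite u \<and> subbox X B u \<subseteq> V}"
  have "countable \<U>"
    by (rule countable_subset[OF _ countable_Collect_finite]) (auto simp: \<U>_def)
  have "f -` V \<inter> space N = (\<Union>u\<in>\<U>. {w \<in> space N. f w \<in> subbox X B u})"
  proof
    show "f -` V \<inter> space N \<subseteq> (\<Union>u\<in>\<U>. {w \<in> space N. f w \<in> subbox X B u})"
    proof
      fix w assume w: "w \<in> f -` V \<inter> space N"
      then have "f w \<in> V" by simp
      from subbaseE[OF B V this] obtain u where "finite u" "f w \<in> subbox X B u" "subbox X B u \<subseteq> V" .
      then show "w \<in> (\<Union>u\<in>\<U>. {w \<in> space N. f w \<in> subbox X B u})"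
        using w by (auto simp: \<U>_def)
    qed
  qed (auto simp: \<U>_def)
  moreover have "{w \<in> space N. f w \<in> subbox X B u} \<in> sets N" if "u \<in> \<U>" for u
  proof -
    have "{w \<in> space N. f w \<in> subbox X B u} = {w \<in> space N. \<forall>n\<in>u. f w \<in> B n}"
      using f by (auto simp: subbox_def)
    also have "\<dots> \<in> sets N"
      using that m by (intro sets.sets_Collect_finite_All) (auto simp: \<U>_def)
    finally show ?thesis .
  qed
  ultimately show "f -` V \<inter> space N \<in> sets N"
    using \<open>countable \<U>\<close> by (simp add: sets.countable_UN'')
qed


lemma pred_index:
  fixes P :: "nat \<Rightarrow> 'a \<Rightarrow> bool"
  assumes "\<And>i. Measurable.pred N (P i)" "f \<in> measurable N (count_space UNIV)"
  shows "Measurable.pred N (\<lambda>w. P (f w) w)"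
  by (rule measurable_compose_countable[OF assms])

text \<open>\<open>f\<^sup>-\<^sup>1 c = d\<close> just means \<open>f d = c\<close>.\<close>

lemma measurable_inv_apply:
  fixes f :: "'a \<Rightarrow> nat \<Rightarrow> nat"
  assumes bij: "\<And>w. w \<in> space N \<Longrightarrow> bij (f w)" and f: "\<And>m. (\<lambda>w. f w m) \<in> measurable N (count_space UNIV)"
  shows "(\<lambda>w. inv (f w) c) \<in> measurable N (count_space UNIV)"
proof (subst measurable_count_space_eq2_countable, safe)
  fix d
  have "(\<lambda>w. inv (f w) c) -` {d} \<inter> space N = (\<lambda>w. f w d) -` {c} \<inter> space N"
    using bij by (auto simp: bij_is_inj bij_is_surj surj_f_inv_f)
  also have "\<dots> \<in> sets N" using f[of d] by (rule measurable_sets) simp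
  finally show "(\<lambda>w. inv (f w) c) -` {d} \<inter> space N \<in> sets N" .
qed auto

lemma measurable_apply_index:
  fixes f :: "'a \<Rightarrow> nat \<Rightarrow> 'b"
  assumes "\<And>m. (\<lambda>w. f w m) \<in> measurable N K" "g \<in> measurable N (count_space UNIV)"
  shows "(\<lambda>w. f w (g w)) \<in> measurable N K"
  by (rule measurable_compose_countable[OF assms])


section \<open>Quasi-Polish spaces as spaces of models of countably many rules\<close>

text \<open>A pair \<open>(u, T)\<close> stands for the implication from the finite conjunction \<open>u\<close> to the disjunction of the
  finite conjunctions in \<open>T\<close>. Quasi-Polish spaces are exactly the spaces of truth assignments that
  satisfy countably many such rules. In this form the \<open>\<Pi>\<^sup>0\<^sub>2\<close> condition serves both to produce limits
  of sequences and to decide in a Borel way whether a limit exists.\<close>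

definition rule_holds :: "nat set \<times> nat set set \<Rightarrow> (nat \<Rightarrow> bool) \<Rightarrow> bool"
  where "rule_holds r p \<longleftrightarrow> (\<forall>n\<in>fst r. p n) \<longrightarrow> (\<exists>t\<in>snd r. \<forall>n\<in>t. p n)"

definition presented :: "'a topology \<Rightarrow> (nat \<Rightarrow> 'a set) \<Rightarrow> (nat set \<times> nat set set) set \<Rightarrow> bool"
  where "presented X B \<R> \<longleftrightarrow> subbase X B \<and> countable \<R> \<and>
    (\<forall>x\<in>topspace X. \<forall>y\<in>topspace X. (\<forall>n. x \<in> B n \<longleftrightarrow> y \<in> B n) \<longrightarrow> x = y) \<and>
    (\<forall>r\<in>\<R>. finite (fst r) \<and> (\<forall>t\<in>snd r. finite t)) \<and>
    (\<forall>p. (\<forall>r\<in>\<R>. rule_holds r p) \<longleftrightarrow> (\<exists>x\<in>topspace X. \<forall>n. x \<in> B n \<longleftrightarrow> p n))"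

definition positive :: "nat set \<Rightarrow> (nat \<Rightarrow> bool) set"
  where "positive u = {p. \<forall>n\<in>u. p n}"

lemma openin_Sierpinski_cube_iff:
  assumes "openin (product_topology (\<lambda>_ :: nat. sierpinski) UNIV) V"
  shows "p \<in> V \<longleftrightarrow> (\<exists>u. finite u \<and> positive u \<subseteq> V \<and> p \<in> positive u)"
proof
  assume "p \<in> V"
  let ?X = "product_topology (\<lambda>_ :: nat. sierpinski) UNIV"
  have sb: "subbase ?X (cylinder (\<lambda>_. sierpinski) UNIV (\<lambda>_ (_::unit). {True}))"
    by (rule subbase_product) (rule subbase_sierpinski)
  from subbaseE[OF sb assms \<open>p \<in> V\<close>] obtain u :: "(nat \<times> unit) set" where
    u: "finite u" "p \<in> subbox ?X (cylinder (\<lambda>_. sierpinski) UNIV (\<lambda>_ _. {True})) u"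
      "subbox ?X (cylinder (\<lambda>_. sierpinski) UNIV (\<lambda>_ _. {True})) u \<subseteq> V" .
  have "subbox ?X (cylinder (\<lambda>_. sierpinski) UNIV (\<lambda>_ (_::unit). {True})) u = positive (fst ` u)"
    by (auto simp: subbox_def cylinder_def positive_def)
  then show "\<exists>u. finite u \<and> positive u \<subseteq> V \<and> p \<in> positive u"
    using u by (intro exI[of _ "fst ` u"]) auto
qed auto

text \<open>Membership in \<open>F \<union> V\<close> is the implication from the open set \<open>- F\<close> to the open set \<open>V\<close>. Open sets of
  the Sierpinski cube are unions of sets \<open>positive u\<close>, so that it splits into one rule for every
  \<open>positive u\<close> contained in \<open>- F\<close>.\<close>

lemma quasi_polish_presented:
  assumes "quasi_polish X"
  obtains B \<R> where "presented X B \<R>"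
proof -
  let ?S = "product_topology (\<lambda>_ :: nat. sierpinski) UNIV"
  obtain A f where A: "Pi02_in ?S A" and f: "homeomorphic_map X (subtopology ?S A) f"
    using assms unfolding quasi_polish_def homeomorphic_space by blast
  obtain F V where F: "\<And>i :: nat. closedin ?S (F i)" and V: "\<And>i :: nat. openin ?S (V i)"
    and A_eq: "A = (\<Inter>i. F i \<union> V i)"
    using A unfolding Pi02_in_def by blast
  define B where "B n = {x \<in> topspace X. f x n}" for n
  define \<R> where "\<R> = (\<lambda>(i, u). (u, {t. finite t \<and> positive t \<subseteq> V i})) `
    {(i, u). finite u \<and> positive u \<subseteq> - F i}"
  have topS: "topspace ?S = UNIV" by simp
  have surj: "f ` topspace X = A"
    using homeomorphic_imp_surjective_map[OF f] by (simp add: topspace_subtopology)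
  have inj: "inj_on f (topspace X)" using f homeomorphic_imp_injective_map by blast
  have "subbase (subtopology ?S A) (\<lambda>k. cylinder (\<lambda>_. sierpinski) UNIV (\<lambda>_ (_::unit). {True}) k \<inter> A)"
    by (intro subbase_subtopology subbase_product subbase_sierpinski)
  note sb = subbase_homeomorphic[OF f this]
  have "subbase X B"
  proof (rule subbaseI)
    have eq: "{x \<in> topspace X. f x \<in> cylinder (\<lambda>_. sierpinski) UNIV (\<lambda>_ (_::unit). {True}) k \<inter> A} = B (fst k)" for k
      using surj by (auto simp: B_def cylinder_def split: prod.splits)
    show "openin X (B n)" for n using subbase_openin[OF sb, of "(n, ())"] unfolding eq by simp
    fix W x assume "openin X W" "x \<in> W"
    from subbaseE[OF sb this, unfolded eq] obtain u :: "(nat \<times> unit) set" where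
      u: "finite u" "x \<in> subbox X (\<lambda>k. B (fst k)) u" "subbox X (\<lambda>k. B (fst k)) u \<subseteq> W" .
    then show "\<exists>u. finite u \<and> x \<in> subbox X B u \<and> subbox X B u \<subseteq> W"
      by (intro exI[of _ "fst ` u"]) (auto simp: subbox_def)
  qed
  moreover have "countable \<R>"
  proof -
    have "countable (UNIV \<times> {u :: nat set. finite u} :: (nat \<times> nat set) set)"
      by (intro countable_SIGMA countable_Collect_finite) auto
    then have "countable {(i :: nat, u). finite u \<and> positive u \<subseteq> - F i}"
      by (rule countable_subset[rotated]) auto
    then show ?thesis unfolding \<R>_def by (rule countable_image)
  qed
  moreover have "\<forall>x\<in>topspace X. \<forall>y\<in>topspace X. (\<forall>n. x \<in> B n \<longleftrightarrow> y \<in> B n) \<longrightarrow> x = y"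
  proof (intro ballI impI)
    fix x y assume xy: "x \<in> topspace X" "y \<in> topspace X" "\<forall>n. x \<in> B n \<longleftrightarrow> y \<in> B n"
    then have "f x = f y" by (auto simp: B_def)
    then show "x = y" using inj xy by (meson inj_onD)
  qed
  moreover have "\<forall>r\<in>\<R>. finite (fst r) \<and> (\<forall>t\<in>snd r. finite t)"
    by (auto simp: \<R>_def)
  moreover have "(\<forall>r\<in>\<R>. rule_holds r p) \<longleftrightarrow> (\<exists>x\<in>topspace X. \<forall>n. x \<in> B n \<longleftrightarrow> p n)" for p
  proof -
    have op: "openin ?S (- F i)" for i
      using F[of i] by (simp add: closedin_def Compl_eq_Diff_UNIV)
    have "(\<forall>r\<in>\<R>. rule_holds r p) \<longleftrightarrow>
      (\<forall>i u. finite u \<and> positive u \<subseteq> - F i \<and> p \<in> positive u \<longrightarrow>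
        (\<exists>t. finite t \<and> positive t \<subseteq> V i \<and> p \<in> positive t))"
      by (auto simp: \<R>_def rule_holds_def positive_def)
    also have "\<dots> \<longleftrightarrow> (\<forall>i. p \<in> - F i \<longrightarrow> p \<in> V i)"
      unfolding openin_Sierpinski_cube_iff[OF op] openin_Sierpinski_cube_iff[OF V] by auto
    also have "\<dots> \<longleftrightarrow> p \<in> A" by (auto simp: A_eq)
    also have "\<dots> \<longleftrightarrow> (\<exists>x\<in>topspace X. f x = p)" using surj by auto
    also have "\<dots> \<longleftrightarrow> (\<exists>x\<in>topspace X. \<forall>n. x \<in> B n \<longleftrightarrow> p n)"
      by (auto simp: B_def fun_eq_iff)
    finally show ?thesis .
  qed
  ultimately have "presented X B \<R>" by (simp add: presented_def)
  then show thesis by (rule that)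
qed

lemma presented_points:
  "presented X B \<R> \<Longrightarrow> (\<forall>r\<in>\<R>. rule_holds r p) \<longleftrightarrow> (\<exists>x\<in>topspace X. \<forall>n. x \<in> B n \<longleftrightarrow> p n)"
  unfolding presented_def by (elim conjE) (erule spec)

lemma presented_eqI:
  "presented X B \<R> \<Longrightarrow> x \<in> topspace X \<Longrightarrow> y \<in> topspace X \<Longrightarrow> (\<And>n. x \<in> B n \<longleftrightarrow> y \<in> B n) \<Longrightarrow> x = y"
  unfolding presented_def by (elim conjE) blast


section \<open>Countable structures and their Borel space\<close>

abbreviation Mod_subbase :: "'r language \<Rightarrow> 'r \<times> nat list \<times> bool \<Rightarrow> ('r \<Rightarrow> nat list \<Rightarrow> bool) set"
  where "Mod_subbase L \<equiv> cylinder (\<lambda>R. product_topology (\<lambda>_. discrete_topology UNIV)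
    {xs. length xs = arity L R}) (symbols L)
    (\<lambda>R. cylinder (\<lambda>_. discrete_topology UNIV) {xs. length xs = arity L R} (\<lambda>_ b. {b}))"

lemma subbase_Mod_top: "subbase (Mod_top L) (Mod_subbase L)"
  unfolding Mod_top_def by (intro subbase_product subbase_discrete)

lemma measurable_Mod_top:
  fixes L :: "('r :: countable) language"
  assumes f: "f \<in> space N \<rightarrow> topspace (Mod_top L)"
    and m: "\<And>R xs. R \<in> symbols L \<Longrightarrow> length xs = arity L R \<Longrightarrow> Measurable.pred N (\<lambda>w. f w R xs)"
  shows "f \<in> measurable N (borel_of (Mod_top L))"
proof (rule measurable_borel_of_subbase[OF subbase_Mod_top f])
  fix n :: "'r \<times> nat list \<times> bool"
  obtain R xs b where n: "n = (R, xs, b)" by (cases n)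
  have f': "f w R \<in> topspace (product_topology (\<lambda>_. discrete_topology UNIV) {xs. length xs = arity L R})"
    if "w \<in> space N" "R \<in> symbols L" for w
    using f that by (auto simp: Mod_top_def)
  have "{w \<in> space N. f w \<in> Mod_subbase L n} =
    {w \<in> space N. R \<in> symbols L \<longrightarrow> length xs = arity L R \<longrightarrow> f w R xs = b}"
    using f f' unfolding n cylinder_def by (auto simp: Mod_top_def)
  also have "\<dots> \<in> sets N"
  proof (cases "R \<in> symbols L \<and> length xs = arity L R")
    case True
    then have [measurable]: "Measurable.pred N (\<lambda>w. f w R xs)" using m by blast
    have "Measurable.pred N (\<lambda>w. f w R xs = b)" by measurable
    then show ?thesis using True by (simp add: pred_def)
  qed auto
  finally show "{w \<in> space N. f w \<in> Mod_subbase L n}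
      \<in> sets N" .
qed

lemma pred_Mod_top:
  assumes "R \<in> symbols L" "length xs = arity L R"
  shows "Measurable.pred (borel_of (Mod_top L)) (\<lambda>M. M R xs)"
proof -
  have "openin (Mod_top L) (Mod_subbase L (R, xs, True))"
    by (rule subbase_openin[OF subbase_Mod_top])
  moreover have "Mod_subbase L (R, xs, True)
    = {M \<in> topspace (Mod_top L). M R xs}"
    using assms by (auto simp: cylinder_def Mod_top_def)
  ultimately show ?thesis by (simp add: pred_def openin_borel_of)
qed

abbreviation fun_cylinder :: "nat \<times> nat \<Rightarrow> (nat \<Rightarrow> nat) set"
  where "fun_cylinder \<equiv> cylinder (\<lambda>_. discrete_topology UNIV) UNIV (\<lambda>_ y. {y})"

lemma subbase_S_inf: "subbase S_inf_top
    (\<lambda>n. fun_cylinder n \<inter> {g. bij g})"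
  unfolding S_inf_top_def by (intro subbase_subtopology subbase_product subbase_discrete)

lemma topspace_S_inf [simp]: "topspace S_inf_top = {g. bij g}"
  by (auto simp: S_inf_top_def)

lemma measurable_S_inf:
  assumes f: "\<And>w. w \<in> space N \<Longrightarrow> bij (f w)"
    and m: "\<And>n. (\<lambda>w. f w n) \<in> measurable N (count_space UNIV)"
  shows "f \<in> measurable N (borel_of S_inf_top)"
proof (rule measurable_borel_of_subbase[OF subbase_S_inf])
  fix k :: "nat \<times> nat"
  obtain n y where k: "k = (n, y)" by (cases k)
  have "{w \<in> space N. f w \<in> fun_cylinder k \<inter> {g. bij g}} =
      {w \<in> space N. f w n = y}"
    using f by (auto simp: k cylinder_def)
  also have "\<dots> \<in> sets N"
    using measurable_sets[OF m[of n], of "{y}"] by (simp add: vimage_def Int_def conj_commute)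
  finally show "{w \<in> space N. f w \<in> fun_cylinder k \<inter> {g. bij g}}
    \<in> sets N" .
qed (use f in auto)

lemma measurable_S_inf_apply: "(\<lambda>g. g n) \<in> measurable (borel_of S_inf_top) (count_space UNIV)"
proof (subst measurable_count_space_eq2_countable, safe)
  fix y
  have "openin S_inf_top (fun_cylinder (n, y) \<inter> {g. bij g})"
    by (rule subbase_openin[OF subbase_S_inf])
  moreover have "fun_cylinder (n, y) \<inter> {g. bij g} =
      (\<lambda>g. g n) -` {y} \<inter> space (borel_of S_inf_top)"
    by (auto simp: cylinder_def)
  ultimately show "(\<lambda>g. g n) -` {y} \<inter> space (borel_of S_inf_top) \<in> sets (borel_of S_inf_top)"
    using openin_borel_of by metis
qed auto

text \<open>Countably many binary relation symbols suffice: they are indexed by triples, and their common arity avoids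
  bookkeeping.\<close>

definition bin_lang :: "nat language"
  where "bin_lang = \<lparr>symbols = UNIV, arity = (\<lambda>_. 2)\<rparr>"

lemma bin_lang_simps [simp]: "symbols bin_lang = UNIV" "arity bin_lang R = 2"
  by (simp_all add: bin_lang_def)

lemma length2_iff: "length xs = 2 \<longleftrightarrow> (\<exists>a b. xs = [a, b])"
  by (auto simp: numeral_2_eq_2 length_Suc_conv)

lemma topspace_Mod_binary: "M \<in> topspace (Mod_top bin_lang) \<longleftrightarrow> (\<forall>q. M q \<in> extensional {xs. length xs = 2})"
  by (auto simp: Mod_top_def PiE_def Pi_def)

lemma push_eqI:
  assumes f: "bij f" and N: "N \<in> topspace (Mod_top bin_lang)"
    and eq: "\<And>q a b. N q [f a, f b] \<longleftrightarrow> M q [a, b]"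
  shows "push bin_lang f M = N"
proof (intro ext)
  fix q xs
  show "push bin_lang f M q xs = N q xs"
  proof (cases "length xs = 2")
    case True
    then obtain a b where xs: "xs = [a, b]" by (auto simp: length2_iff)
    have "f (inv f y) = y" for y using f by (simp add: bij_is_surj surj_f_inv_f)
    then show ?thesis using eq[of q "inv f a" "inv f b"] by (simp add: push_def xs)
  next
    case False
    then show ?thesis using N by (auto simp: push_def topspace_Mod_binary extensional_def)
  qed
qed

lemma push_apply: "bij f \<Longrightarrow> push bin_lang f M q [f a, f b] \<longleftrightarrow> M q [a, b]"
  by (simp add: push_def bij_is_inj)

lemma push_topspace: "push bin_lang f M \<in> topspace (Mod_top bin_lang)"
  by (auto simp: topspace_Mod_binary push_def)

definition rcode :: "nat \<Rightarrow> nat \<Rightarrow> nat \<Rightarrow> nat"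
  where "rcode i j n = prod_encode (i, prod_encode (j, n))"

lemma rcode_cases: obtains i j n where "q = rcode i j n"
  unfolding rcode_def by (metis prod.collapse prod_decode_inverse)

lemma push_comp:
  "bij f \<Longrightarrow> bij g \<Longrightarrow> push bin_lang (f \<circ> g) M = push bin_lang f (push bin_lang g M)"
  by (auto simp: push_def fun_eq_iff o_inv_distrib restrict_def)

lemma push_id: "M \<in> topspace (Mod_top bin_lang) \<Longrightarrow> push bin_lang id M = M"
  by (rule push_eqI) auto

lemma push_inv:
  "bij f \<Longrightarrow> M \<in> topspace (Mod_top bin_lang) \<Longrightarrow> push bin_lang (inv f) (push bin_lang f M) = M"
  by (simp add: push_comp[symmetric] bij_imp_bij_inv bij_is_inj push_id)

lemma sat_push:
  assumes g: "bij g"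
  shows "formula L \<phi> \<Longrightarrow> sat (push L g M) \<phi> (g \<circ> v) \<longleftrightarrow> sat M \<phi> v"
proof (induction \<phi> arbitrary: v)
  case (Rel R xs)
  have "inv g (g y) = y" for y using g by (simp add: bij_is_inj)
  then show ?case using Rel by (simp add: push_def o_def)
next
  case (Eq x y)
  then show ?case using g by (simp add: bij_is_inj inj_eq)
next
  case (Exists x \<phi>)
  have upd: "(g \<circ> v)(x := g a) = g \<circ> v(x := a)" for a by auto
  have "(\<exists>a. sat (push L g M) \<phi> ((g \<circ> v)(x := a))) \<longleftrightarrow> (\<exists>a. sat (push L g M) \<phi> ((g \<circ> v)(x := g a)))"
    using g by (metis bij_pointE)
  then show ?case using Exists by (simp only: sat.simps formula.simps upd)
next
  case (Forall x \<phi>)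
  have upd: "(g \<circ> v)(x := g a) = g \<circ> v(x := a)" for a by auto
  have "(\<forall>a. sat (push L g M) \<phi> ((g \<circ> v)(x := a))) \<longleftrightarrow> (\<forall>a. sat (push L g M) \<phi> ((g \<circ> v)(x := g a)))"
    using g by (metis bij_pointE)
  then show ?case using Forall by (simp only: sat.simps formula.simps upd)
qed auto


section \<open>Generic sequences\<close>

text \<open>Step \<open>j\<close> extends the sequence into \<open>D j\<close> and then appends \<open>j\<close>, which makes the limit surjective. Taking
  the least extension makes the limit depend on \<open>D\<close> in a Borel way.\<close>

primrec gen :: "(nat \<Rightarrow> nat list \<Rightarrow> bool) \<Rightarrow> nat list \<Rightarrow> nat \<Rightarrow> nat list"
  where
    "gen D s 0 = s"
  | "gen D s (Suc j) = gen D s j @ list_decode (LEAST c. D j (gen D s j @ list_decode c)) @ [j]"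

definition gseq :: "(nat \<Rightarrow> nat list \<Rightarrow> bool) \<Rightarrow> nat list \<Rightarrow> nat \<Rightarrow> nat"
  where "gseq D s i = gen D s (Suc i) ! i"

lemma length_gen: "j \<le> length (gen D s j)"
  by (induction j) auto

lemma gen_mono: "j \<le> k \<Longrightarrow> \<exists>t. gen D s k = gen D s j @ t"
proof (induction rule: dec_induct)
  case (step n)
  then show ?case by auto
qed auto

lemma gen_nth: "i < length (gen D s j) \<Longrightarrow> gen D s j ! i = gseq D s i"
proof -
  assume i: "i < length (gen D s j)"
  have i': "i < length (gen D s (Suc i))" using length_gen[of "Suc i" D s] by simp
  obtain t where t: "gen D s (max j (Suc i)) = gen D s j @ t" using gen_mono[of j "max j (Suc i)"] by auto
  obtain t' where t': "gen D s (max j (Suc i)) = gen D s (Suc i) @ t'"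
    using gen_mono[of "Suc i" "max j (Suc i)"] by (metis max.cobounded2)
  show ?thesis unfolding gseq_def using t t' i i' by (metis nth_append)
qed

lemma gseq_prefix: "gen D s j = u @ t \<Longrightarrow> map (gseq D s) [0..<length u] = u"
  by (rule nth_equalityI) (auto simp: gen_nth[symmetric, of _ D s j] nth_append)

lemma gseq_extends: "map (gseq D s) [0..<length s] = s"
  by (rule gseq_prefix[of D s 0 s "[]"]) simp

lemma gseq_meets:
  assumes "\<And>u. \<exists>t. D j (u @ t)"
  shows "\<exists>n. D j (map (gseq D s) [0..<n])"
proof -
  let ?c = "LEAST c. D j (gen D s j @ list_decode c)"
  obtain t where "D j (gen D s j @ t)" using assms by blast
  then have "D j (gen D s j @ list_decode (list_encode t))" by simp
  then have D: "D j (gen D s j @ list_decode ?c)" by (rule LeastI)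
  have "gen D s (Suc j) = (gen D s j @ list_decode ?c) @ [j]" by simp
  from gseq_prefix[OF this] D show ?thesis by metis
qed

lemma range_gseq: "range (gseq D s) = UNIV"
proof -
  have "j \<in> range (gseq D s)" for j
  proof -
    have "j = last (gen D s (Suc j))" by simp
    also have "\<dots> = gseq D s (length (gen D s (Suc j)) - 1)"
      using gen_nth[of "length (gen D s (Suc j)) - 1" D s "Suc j"]
      by (subst last_conv_nth) auto
    finally show ?thesis by (metis rangeI)
  qed
  then show ?thesis by auto
qed

lemma generic_sequence_exists:
  assumes "countable \<D>" and dense: "\<And>D s. D \<in> \<D> \<Longrightarrow> \<exists>t. s @ t \<in> D"
  obtains e :: "nat \<Rightarrow> nat" where "range e = UNIV" "\<And>D. D \<in> \<D> \<Longrightarrow> \<exists>n. map e [0..<n] \<in> D"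
proof (cases "\<D> = {}")
  case True
  then show thesis using that[of id] by auto
next
  case False
  define D where "D j s \<longleftrightarrow> s \<in> from_nat_into \<D> j" for j s
  have d: "\<exists>t. D j (u @ t)" for j u
    unfolding D_def using dense[OF from_nat_into[OF False]] .
  show thesis
  proof (rule that)
    show "range (gseq D []) = UNIV" by (rule range_gseq)
    fix E assume "E \<in> \<D>"
    then obtain j where "E = from_nat_into \<D> j"
      using from_nat_into_surj[OF assms(1)] by metis
    then show "\<exists>n. map (gseq D []) [0..<n] \<in> E" using gseq_meets[of D j "[]"] d by (auto simp: D_def)
  qed
qed

section \<open>Definable predicates on finite sequences\<close>

type_synonym 'r struct = "'r \<Rightarrow> nat list \<Rightarrow> bool"

text \<open>The sequence \<open>s\<close> of length \<open>n\<close> is the tuple of values of the variables \<open>0, \<dots>, n - 1\<close>; there is one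
  formula for every length.\<close>

definition definable :: "'r language \<Rightarrow> ('r struct \<Rightarrow> nat list \<Rightarrow> bool) \<Rightarrow> bool"
  where "definable L Q \<longleftrightarrow> (\<exists>\<psi>. \<forall>n. formula L (\<psi> n) \<and> free_vars (\<psi> n) \<subseteq> {..<n} \<and>
    (\<forall>M v. sat M (\<psi> n) v \<longleftrightarrow> Q M (map v [0..<n])))"

lemma definableI:
  assumes "\<And>n. formula L (\<psi> n)" "\<And>n. free_vars (\<psi> n) \<subseteq> {..<n}"
    "\<And>n M v. sat M (\<psi> n) v \<longleftrightarrow> Q M (map v [0..<n])"
  shows "definable L Q"
  unfolding definable_def using assms by (intro exI[of _ \<psi>]) simp

lemma definableE:
  assumes "definable L Q"
  obtains \<psi> where "\<And>n. formula L (\<psi> n)" "\<And>n. free_vars (\<psi> n) \<subseteq> {..<n}"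
    "\<And>n M v. sat M (\<psi> n) v \<longleftrightarrow> Q M (map v [0..<n])"
proof -
  obtain \<psi> where "\<forall>n. formula L (\<psi> n) \<and> free_vars (\<psi> n) \<subseteq> {..<n} \<and>
    (\<forall>M v. sat M (\<psi> n) v \<longleftrightarrow> Q M (map v [0..<n]))"
    using assms unfolding definable_def by blast
  then show thesis by (intro that[of \<psi>]) blast+
qed

lemma definable_not: "definable L Q \<Longrightarrow> definable L (\<lambda>M s. \<not> Q M s)"
  by (erule definableE, rule_tac \<psi> = "\<lambda>n. Neg (\<psi> n)" in definableI) auto

lemma definable_ex:
  fixes Q :: "nat \<Rightarrow> 'r struct \<Rightarrow> nat list \<Rightarrow> bool"
  assumes "\<And>i. definable L (Q i)"
  shows "definable L (\<lambda>M s. \<exists>i. Q i M s)"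
proof -
  have "\<forall>i. \<exists>\<psi>. \<forall>n. formula L (\<psi> n) \<and> free_vars (\<psi> n) \<subseteq> {..<n} \<and>
    (\<forall>M v. sat M (\<psi> n) v \<longleftrightarrow> Q i M (map v [0..<n]))"
    using assms unfolding definable_def by blast
  then obtain \<psi> where \<psi>: "\<forall>i n. formula L (\<psi> i n) \<and> free_vars (\<psi> i n) \<subseteq> {..<n} \<and>
    (\<forall>M v. sat M (\<psi> i n) v \<longleftrightarrow> Q i M (map v [0..<n]))"
    by (auto dest!: choice)
  show ?thesis
    by (rule definableI[where \<psi> = "\<lambda>n. Disj UNIV (\<lambda>i. \<psi> i n)"]) (use \<psi> in auto)
qed

lemma definable_disj:
  assumes "definable L P" "definable L Q"
  shows "definable L (\<lambda>M s. P M s \<or> Q M s)"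
proof -
  have "definable L (\<lambda>M s. \<exists>i :: nat. (if i = 0 then P else Q) M s)"
    using assms by (intro definable_ex) simp
  moreover have "(\<lambda>M s. \<exists>i :: nat. (if i = 0 then P else Q) M s) = (\<lambda>M s. P M s \<or> Q M s)"
    by (auto simp: fun_eq_iff split: if_splits)
  ultimately show ?thesis by simp
qed

lemma definable_False: "definable L (\<lambda>M s. False)"
  by (rule definableI[where \<psi> = "\<lambda>_. Disj {} (\<lambda>_. Eq 0 0)"]) auto

lemma definable_True: "definable L (\<lambda>M s. True)"
  using definable_not[OF definable_False] by simp

lemma definable_rel:
  assumes "R \<in> symbols L" "length is = arity L R"
  shows "definable L (\<lambda>M s. (\<forall>i\<in>set is. i < length s) \<and> M R (map ((!) s) is))"
proof (rule definableI[where \<psi> = "\<lambda>n. if \<forall>i\<in>set is. i < n then Rel R is else Disj {} (\<lambda>_. Eq 0 0)"])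
  fix n and M :: "'a struct" and v :: "nat \<Rightarrow> nat"
  have "map ((!) (map v [0..<n])) is = map v is" if "\<forall>i\<in>set is. i < n"
    using that by (intro map_cong) auto
  note eq = this
  show "sat M (if \<forall>i\<in>set is. i < n then Rel R is else Disj {} (\<lambda>_. Eq 0 0)) v \<longleftrightarrow>
      (\<forall>i\<in>set is. i < length (map v [0..<n])) \<and> M R (map ((!) (map v [0..<n])) is)"
    by (cases "\<forall>i\<in>set is. i < n") (simp add: eq, auto)
qed (use assms in auto)

lemma definable_eq: "definable L (\<lambda>M s. i < length s \<and> j < length s \<and> s ! i = s ! j)"
  by (rule definableI[where \<psi> = "\<lambda>n. if i < n \<and> j < n then Eq i j else Disj {} (\<lambda>_. Eq 0 0)"]) auto

lemma definable_snoc: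
  assumes "definable L Q"
  shows "definable L (\<lambda>M s. \<exists>a. Q M (s @ [a]))"
proof -
  obtain \<psi> where \<psi>: "\<And>n. formula L (\<psi> n)" "\<And>n. free_vars (\<psi> n) \<subseteq> {..<n}"
    "\<And>n M v. sat M (\<psi> n) v \<longleftrightarrow> Q M (map v [0..<n])"
    using assms by (elim definableE) blast
  have map: "map (v(n := a)) [0..<Suc n] = map v [0..<n] @ [a]" for v :: "nat \<Rightarrow> nat" and n a
    by simp
  show ?thesis
  proof (rule definableI[where \<psi> = "\<lambda>n. Exists n (\<psi> (Suc n))"])
    show "free_vars (Exists n (\<psi> (Suc n))) \<subseteq> {..<n}" for n
      using \<psi>(2)[of "Suc n"] by (auto simp: lessThan_Suc)
  qed (use \<psi>(1) in \<open>simp_all only: sat.simps formula.simps \<psi>(3) map\<close>)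
qed

text \<open>Quantification over finite sequences is a countable disjunction over their lengths.\<close>

lemma definable_extension:
  assumes "definable L Q"
  shows "definable L (\<lambda>M s. \<exists>t. Q M (s @ t))"
proof -
  have "definable L (\<lambda>M s. \<exists>t. length t = k \<and> Q M (s @ t))" for k
  proof (induction k)
    case 0
    then show ?case using assms by simp
  next
    case (Suc k)
    have "(\<exists>t. length t = Suc k \<and> Q M (s @ t)) \<longleftrightarrow> (\<exists>a. \<exists>t. length t = k \<and> Q M ((s @ [a]) @ t))" for M s
      by (auto simp: length_Suc_conv)
    then show ?case using definable_snoc[OF Suc] by simp
  qed
  then have "definable L (\<lambda>M s. \<exists>k. \<exists>t. length t = k \<and> Q M (s @ t))" by (rule definable_ex)
  then show ?thesis by simp
qed

lemma sat_Borel: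
  "formula L \<phi> \<Longrightarrow> Measurable.pred (borel_of (Mod_top L)) (\<lambda>M. sat M \<phi> v)"
proof (induction \<phi> arbitrary: v)
  case (Rel R xs)
  then show ?case by (simp add: pred_Mod_top)
next
  case (Conj I \<Phi>)
  then have "Measurable.pred (borel_of (Mod_top L)) (\<lambda>M. sat M (\<Phi> i) v)" if "i \<in> I" for i
    using that by auto
  then show ?case by (auto intro!: pred_intros_countable_bounded)
next
  case (Disj I \<Phi>)
  then have "Measurable.pred (borel_of (Mod_top L)) (\<lambda>M. sat M (\<Phi> i) v)" if "i \<in> I" for i
    using that by auto
  then show ?case by (auto intro!: pred_intros_countable_bounded)
qed (auto intro!: pred_intros_logic pred_intros_countable)

lemma definable_Borel:
  assumes "definable L Q"
  shows "Measurable.pred (borel_of (Mod_top L)) (\<lambda>M. Q M s)"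
proof -
  obtain \<psi> where \<psi>: "\<And>n. formula L (\<psi> n)" "\<And>n. free_vars (\<psi> n) \<subseteq> {..<n}"
    "\<And>n M v. sat M (\<psi> n) v \<longleftrightarrow> Q M (map v [0..<n])"
    using assms by (elim definableE) blast
  have "Measurable.pred (borel_of (Mod_top L)) (\<lambda>M. sat M (\<psi> (length s)) ((!) s))"
    by (rule sat_Borel[OF \<psi>(1)])
  then show ?thesis by (simp add: \<psi>(3) map_nth)
qed


section \<open>Forcing Borel properties of enumerated structures\<close>

text \<open>\<open>Q\<close> describes the finite conditions that force \<open>P\<close>, and the \<open>D j\<close> are the dense sets that an enumeration
  has to meet in order to be generic. The property \<open>Q\<close> plays the role of the Vaught transform of \<open>P\<close>.\<close>

definition forces ::
    "'r language \<Rightarrow> ('r struct \<Rightarrow> (nat \<Rightarrow> nat) \<Rightarrow> bool) \<Rightarrow> ('r struct \<Rightarrow> nat list \<Rightarrow> bool) \<Rightarrow>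
      (nat \<Rightarrow> 'r struct \<Rightarrow> nat list \<Rightarrow> bool) \<Rightarrow> bool"
  where "forces L P Q D \<longleftrightarrow> definable L Q \<and> (\<forall>j. definable L (D j)) \<and>
    (\<forall>M s t. Q M s \<longrightarrow> Q M (s @ t)) \<and> (\<forall>M s j. \<exists>t. D j M (s @ t)) \<and>
    (\<forall>M e. (\<forall>j. \<exists>n. D j M (map e [0..<n])) \<longrightarrow> (P M e \<longleftrightarrow> (\<exists>n. Q M (map e [0..<n]))))"

definition forcible :: "'r language \<Rightarrow> ('r struct \<Rightarrow> (nat \<Rightarrow> nat) \<Rightarrow> bool) \<Rightarrow> bool"
  where "forcible L P \<longleftrightarrow> (\<exists>Q D. forces L P Q D)"

lemma forcibleI:
  fixes D :: "nat \<Rightarrow> 'r struct \<Rightarrow> nat list \<Rightarrow> bool"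
  assumes "definable L Q" "\<And>j. definable L (D j)" "\<And>M s t. Q M s \<Longrightarrow> Q M (s @ t)"
    "\<And>M s j. \<exists>t. D j M (s @ t)"
    "\<And>M e. (\<And>j. \<exists>n. D j M (map e [0..<n])) \<Longrightarrow> P M e \<longleftrightarrow> (\<exists>n. Q M (map e [0..<n]))"
  shows "forcible L P"
  unfolding forcible_def forces_def by (rule exI[of _ Q], rule exI[of _ D]) (use assms in simp)

lemma forcesD:
  assumes "forces L P Q D"
  shows "definable L Q" "\<And>j. definable L (D j)" "\<And>M s t. Q M s \<Longrightarrow> Q M (s @ t)"
    "\<And>M s j. \<exists>t. D j M (s @ t)"
    "\<And>M e. (\<And>j. \<exists>n. D j M (map e [0..<n])) \<Longrightarrow> P M e \<longleftrightarrow> (\<exists>n. Q M (map e [0..<n]))"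
  using assms unfolding forces_def by blast+

lemma map_upt_extend: "n \<le> m \<Longrightarrow> map e [0..<m] = map e [0..<n] @ map e [n..<m]"
  by (metis le_add_diff_inverse map_append upt_add_eq_append zero_le)

lemma forcible_atomic:
  assumes "definable L Q" "\<And>M s t. Q M s \<Longrightarrow> Q M (s @ t)"
    "\<And>M e. P M e \<longleftrightarrow> (\<exists>n. Q M (map e [0..<n]))"
  shows "forcible L P"
  by (rule forcibleI[where Q = Q and D = "\<lambda>_ _ _. True"]) (use assms definable_True in auto)

lemma forcible_rel:
  assumes "R \<in> symbols L" "length is = arity L R"
  shows "forcible L (\<lambda>M e. M R (map e is))"
proof (rule forcible_atomic[OF definable_rel[OF assms]])
  fix M :: "'a struct" and s t
  assume h: "(\<forall>i\<in>set is. i < length s) \<and> M R (map ((!) s) is)"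
  have eq: "map ((!) (s @ t)) is = map ((!) s) is" using h by (intro map_cong) (auto simp: nth_append)
  show "(\<forall>i\<in>set is. i < length (s @ t)) \<and> M R (map ((!) (s @ t)) is)"
    unfolding eq using h by auto
next
  fix M :: "'a struct" and e :: "nat \<Rightarrow> nat"
  have eq: "map ((!) (map e [0..<n])) is = map e is" if "\<forall>i\<in>set is. i < n" for n
    using that by (intro map_cong) auto
  have "\<forall>i\<in>set is. i < Suc (Max (set is))" by (simp add: le_imp_less_Suc)
  with eq show "M R (map e is) \<longleftrightarrow> (\<exists>n. (\<forall>i\<in>set is. i < length (map e [0..<n])) \<and>
      M R (map ((!) (map e [0..<n])) is))"
    by (metis diff_zero length_map length_upt)
qed

lemma forcible_eq: "forcible L (\<lambda>M e. e i = e j)"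
proof (rule forcible_atomic[OF definable_eq[of L i j]])
  fix M :: "'a struct" and e :: "nat \<Rightarrow> nat"
  show "e i = e j \<longleftrightarrow> (\<exists>n. i < length (map e [0..<n]) \<and> j < length (map e [0..<n]) \<and>
      map e [0..<n] ! i = map e [0..<n] ! j)"
  proof
    assume "e i = e j"
    then show "\<exists>n. i < length (map e [0..<n]) \<and> j < length (map e [0..<n]) \<and>
        map e [0..<n] ! i = map e [0..<n] ! j"
      by (intro exI[of _ "Suc (max i j)"]) (auto simp del: upt_Suc simp: less_Suc_eq_le)
  qed auto
qed (auto simp: nth_append)

text \<open>A finite sequence forces the negation if no extension of it forces \<open>P\<close>. The additional dense set
  consists of the sequences that force \<open>P\<close> or its negation.\<close>

lemma forcible_not:
  fixes P :: "'r struct \<Rightarrow> (nat \<Rightarrow> nat) \<Rightarrow> bool"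
  assumes "forcible L P"
  shows "forcible L (\<lambda>M e. \<not> P M e)"
proof -
  obtain Q D where "forces L P Q D" using assms by (auto simp: forcible_def)
  note Q = forcesD(1,3)[OF this] and D = forcesD(2,4)[OF this] and P = forcesD(5)[OF this]
  define Q' where "Q' M s \<longleftrightarrow> \<not> (\<exists>t. Q M (s @ t))" for M s
  define D' where "D' j = (case j of 0 \<Rightarrow> (\<lambda>M s. Q M s \<or> Q' M s) | Suc i \<Rightarrow> D i)" for j
  have Q'_def': "definable L Q'"
    using definable_not[OF definable_extension[OF Q(1)]] by (simp add: Q'_def[abs_def])
  show ?thesis
  proof (rule forcibleI[OF Q'_def'])
    show "definable L (D' j)" for j
      using definable_disj[OF Q(1) Q'_def'] D(1) by (auto simp: D'_def split: nat.splits)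
    show "Q' M (s @ t)" if "Q' M s" for M s t
      using that by (auto simp: Q'_def)
    show "\<exists>t. D' j M (s @ t)" for M s j
    proof (cases j)
      case 0
      then show ?thesis
        by (cases "\<exists>t. Q M (s @ t)") (auto simp: D'_def Q'_def intro: exI[of _ "[]"])
    next
      case (Suc i)
      then show ?thesis using D(2) by (simp add: D'_def)
    qed
    fix M e assume e: "\<And>j. \<exists>n. D' j M (map e [0..<n])"
    have "\<exists>n. D j M (map e [0..<n])" for j using e[of "Suc j"] by (simp add: D'_def)
    then have iff: "P M e \<longleftrightarrow> (\<exists>n. Q M (map e [0..<n]))" by (rule P)
    obtain n where n: "Q M (map e [0..<n]) \<or> Q' M (map e [0..<n])"
      using e[of 0] by (auto simp: D'_def)
    have "\<not> (Q' M (map e [0..<n]) \<and> Q M (map e [0..<m]))" for n m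
    proof
      assume h: "Q' M (map e [0..<n]) \<and> Q M (map e [0..<m])"
      have "Q M (map e [0..<max n m])"
        using h Q(2)[of M "map e [0..<m]" "map e [m..<max n m]"] map_upt_extend[of m "max n m" e] by simp
      then show False using h map_upt_extend[of n "max n m" e] by (auto simp: Q'_def)
    qed
    then show "\<not> P M e \<longleftrightarrow> (\<exists>n. Q' M (map e [0..<n]))" using iff n by blast
  qed
qed

lemma forcible_ex:
  fixes P :: "nat \<Rightarrow> 'r struct \<Rightarrow> (nat \<Rightarrow> nat) \<Rightarrow> bool"
  assumes "\<And>i. forcible L (P i)"
  shows "forcible L (\<lambda>M e. \<exists>i. P i M e)"
proof -
  have "\<forall>i. \<exists>Q D. forces L (P i) Q D" using assms by (simp add: forcible_def)
  then obtain Q D where "\<forall>i. forces L (P i) (Q i) (D i)" by (auto dest!: choice)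
  then have f: "forces L (P i) (Q i) (D i)" for i by blast
  show ?thesis
  proof (rule forcibleI)
    show "definable L (\<lambda>M s. \<exists>i. Q i M s)" using forcesD(1)[OF f] by (rule definable_ex)
    show "definable L (D (fst (prod_decode j)) (snd (prod_decode j)))" for j using forcesD(2)[OF f] .
    show "\<exists>i. Q i M (s @ t)" if "\<exists>i. Q i M s" for M s t using forcesD(3)[OF f] that by blast
    show "\<exists>t. D (fst (prod_decode j)) (snd (prod_decode j)) M (s @ t)" for M s j
      using forcesD(4)[OF f] .
    fix M e assume e: "\<And>j. \<exists>n. D (fst (prod_decode j)) (snd (prod_decode j)) M (map e [0..<n])"
    have "\<exists>n. D i j M (map e [0..<n])" for i j using e[of "prod_encode (i, j)"] by simp
    then have "P i M e \<longleftrightarrow> (\<exists>n. Q i M (map e [0..<n]))" for i by (rule forcesD(5)[OF f])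
    then show "(\<exists>i. P i M e) \<longleftrightarrow> (\<exists>n i. Q i M (map e [0..<n]))" by blast
  qed
qed

text \<open>Only the equality pattern of the enumeration is recorded, not its values: properties in the
  \<open>\<sigma>\<close>-algebra below are those that can be expressed in the structure, with the enumerated elements as
  variables.\<close>

definition atoms :: "'r language \<Rightarrow> ('r struct \<times> (nat \<Rightarrow> nat)) set set"
  where "atoms L = {{p. fst p R (map (snd p) is)} | R is. R \<in> symbols L \<and> length is = arity L R} \<union>
    {{p. snd p i = snd p j} | i j. True}"

definition diagram :: "'r language \<Rightarrow> ('r struct \<times> (nat \<Rightarrow> nat)) measure"
  where "diagram L = sigma UNIV (atoms L)"

lemma space_diagram [simp]: "space (diagram L) = UNIV"
  by (simp add: diagram_def)

lemma sets_diagram: "sets (diagram L) = sigma_sets UNIV (atoms L)"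
  by (simp add: diagram_def)

text \<open>The forcible properties form a \<open>\<sigma>\<close>-algebra containing the atomic ones.\<close>

lemma forcible_diagram:
  assumes "A \<in> sets (diagram L)"
  shows "forcible L (\<lambda>M e. (M, e) \<in> A)"
  using assms unfolding sets_diagram
proof induction
  case (Basic a)
  then consider R "is" where "a = {p. fst p R (map (snd p) is)}" "R \<in> symbols L" "length is = arity L R"
    | i j where "a = {p. snd p i = snd p j}" by (auto simp: atoms_def)
  then show ?case by cases (simp_all add: forcible_rel forcible_eq)
next
  case Empty
  show ?case by (rule forcible_atomic[OF definable_False]) auto
next
  case (Compl a)
  then show ?case using forcible_not by fastforce
next
  case (Union a)
  then show ?case using forcible_ex[of L "\<lambda>i M e. (M, e) \<in> a i"] by simp
qed

lemma measurable_map_seq: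
  assumes "\<And>i. (\<lambda>w. e w i) \<in> measurable N (count_space UNIV)"
  shows "(\<lambda>w. map (e w) xs) \<in> measurable N (count_space (UNIV :: nat list set))"
proof (induction xs)
  case (Cons i xs)
  have "(\<lambda>w. a # map (e w) xs) \<in> measurable N (count_space (UNIV :: nat list set))" for a
    by (rule measurable_compose[OF Cons]) simp
  from measurable_compose_countable[OF this assms[of i]] show ?case by simp
qed simp

lemma measurable_diagramI:
  assumes e: "\<And>i. (\<lambda>w. e w i) \<in> measurable N (count_space UNIV)"
    and f: "\<And>R xs. R \<in> symbols L \<Longrightarrow> length xs = arity L R \<Longrightarrow> Measurable.pred N (\<lambda>w. f w R xs)"
  shows "(\<lambda>w. (f w, e w)) \<in> measurable N (diagram L)"
  unfolding diagram_def
proof (rule measurable_measure_of)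
  fix A assume "A \<in> atoms L"
  then consider R "is" where "A = {p. fst p R (map (snd p) is)}" "R \<in> symbols L" "length is = arity L R"
    | i j where "A = {p. snd p i = snd p j}" by (auto simp: atoms_def)
  then have "Measurable.pred N (\<lambda>w. (f w, e w) \<in> A)"
  proof cases
    case 1
    have "Measurable.pred N (\<lambda>w. length xs = arity L R \<and> f w R xs)" for xs
      by (cases "length xs = arity L R") (simp_all add: f[OF 1(2)])
    from measurable_compose_countable[where f = "\<lambda>xs w. length xs = arity L R \<and> f w R xs" and
        g = "\<lambda>w. map (e w) is", OF this measurable_map_seq[OF e]] show ?thesis
      using 1 by simp
  next
    case 2
    have "Measurable.pred N (\<lambda>w. e w i = c)" for c using e[of i] by measurable
    from measurable_compose_countable[OF this e[of j]] show ?thesis using 2 by simp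
  qed
  moreover have "(\<lambda>w. (f w, e w)) -` A \<inter> space N = {w \<in> space N. (f w, e w) \<in> A}" by auto
  ultimately show "(\<lambda>w. (f w, e w)) -` A \<inter> space N \<in> sets N" by (simp add: pred_def)
qed auto

lemma pred_diagram_rel:
  assumes "R \<in> symbols L" "length is = arity L R"
  shows "Measurable.pred (diagram L) (\<lambda>p. fst p R (map (snd p) is))"
  using assms by (auto simp: pred_def sets_diagram atoms_def intro!: sigma_sets.Basic)

lemma pred_diagram_eq: "Measurable.pred (diagram L) (\<lambda>p. snd p i = snd p j)"
  by (auto simp: pred_def sets_diagram atoms_def intro!: sigma_sets.Basic)

lemma measurable_gen:
  assumes D: "\<And>j u. Measurable.pred N (\<lambda>w. D w j u)"
    and s: "s \<in> measurable N (count_space UNIV)"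
  shows "(\<lambda>w. gen (D w) (s w) k) \<in> measurable N (count_space UNIV)"
proof (induction k)
  case (Suc k)
  have "(\<lambda>w. LEAST c. D w k (u @ list_decode c)) \<in> measurable N (count_space UNIV)" for u
    using D by (intro measurable_Least) auto
  from measurable_compose[OF this, of "\<lambda>c. u @ list_decode c @ [k]" "count_space UNIV" for u]
  have "(\<lambda>w. u @ list_decode (LEAST c. D w k (u @ list_decode c)) @ [k]) \<in> measurable N (count_space UNIV)" for u
    by simp
  from measurable_compose_countable[OF this Suc] show ?case by simp
qed (use s in simp)

lemma measurable_gseq:
  assumes D: "\<And>j u. Measurable.pred N (\<lambda>w. D w j u)"
    and s: "s \<in> measurable N (count_space UNIV)"
  shows "(\<lambda>w. gseq (D w) (s w) i) \<in> measurable N (count_space UNIV)"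
  unfolding gseq_def by (rule measurable_compose[OF measurable_gen[OF D s]]) simp


section \<open>Groupoid algebra and continuity of division\<close>

context groupoid
begin

abbreviation compose (infixl "\<cdot>" 70) where "g \<cdot> h \<equiv> mult G g h"
abbreviation "iv \<equiv> invert G"
abbreviation "src \<equiv> source G"
abbreviation "tgt \<equiv> target G"
abbreviation "one \<equiv> ident G"

lemmas closed_simps [simp] = source_closed target_closed ident_closed source_ident target_ident
  invert_closed source_invert target_invert

lemma mul_closed [simp]:
  assumes "g \<in> Mor G" "h \<in> Mor G" "src g = tgt h"
  shows "g \<cdot> h \<in> Mor G" "src (g \<cdot> h) = src h" "tgt (g \<cdot> h) = tgt g"
  using assms mult_closed[of g h] source_mult[of g h] target_mult[of g h]
  by (auto simp: composable_def)

lemma mul_assoc: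
  assumes "g \<in> Mor G" "h \<in> Mor G" "k \<in> Mor G" "src g = tgt h" "src h = tgt k"
  shows "g \<cdot> h \<cdot> k = g \<cdot> (h \<cdot> k)"
  using assms by (intro mult_assoc) (auto simp: composable_def)

lemma mul_one [simp]: "g \<in> Mor G \<Longrightarrow> src g = x \<Longrightarrow> g \<cdot> one x = g"
  using mult_ident_right by auto

lemma one_mul [simp]: "g \<in> Mor G \<Longrightarrow> tgt g = x \<Longrightarrow> one x \<cdot> g = g"
  using mult_ident_left by auto

lemma iv_mul_self [simp]: "g \<in> Mor G \<Longrightarrow> iv g \<cdot> g = one (src g)"
  by (rule invert_mult)

lemma mul_iv_self [simp]: "g \<in> Mor G \<Longrightarrow> g \<cdot> iv g = one (tgt g)"
  by (rule mult_invert)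

lemma iv_cancel [simp]:
  assumes "g \<in> Mor G" "h \<in> Mor G" "tgt h = src g"
  shows "iv g \<cdot> (g \<cdot> h) = h"
proof -
  have "iv g \<cdot> (g \<cdot> h) = (iv g \<cdot> g) \<cdot> h" using assms by (intro mul_assoc[symmetric]) auto
  then show ?thesis using assms by simp
qed

lemma iv_cancel' [simp]:
  assumes "g \<in> Mor G" "h \<in> Mor G" "tgt h = tgt g"
  shows "g \<cdot> (iv g \<cdot> h) = h"
proof -
  have "g \<cdot> (iv g \<cdot> h) = (g \<cdot> iv g) \<cdot> h" using assms by (intro mul_assoc[symmetric]) auto
  then show ?thesis using assms by simp
qed

lemma left_cancel:
  assumes "g \<in> Mor G" "h \<in> Mor G" "h' \<in> Mor G" "tgt h = src g" "tgt h' = src g" "g \<cdot> h = g \<cdot> h'"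
  shows "h = h'"
  using assms by (metis iv_cancel)

lemma iv_unique:
  assumes "g \<in> Mor G" "h \<in> Mor G" "src g = tgt h" "g \<cdot> h = one (tgt g)"
  shows "h = iv g"
proof (rule left_cancel[of g])
  show "g \<cdot> h = g \<cdot> iv g" using assms by simp
qed (use assms in auto)

lemma iv_iv [simp]: "g \<in> Mor G \<Longrightarrow> iv (iv g) = g"
  by (rule iv_unique[symmetric]) auto

lemma iv_mul:
  assumes "g \<in> Mor G" "h \<in> Mor G" "src g = tgt h"
  shows "iv (g \<cdot> h) = iv h \<cdot> iv g"
proof (rule iv_unique[symmetric])
  have "g \<cdot> h \<cdot> (iv h \<cdot> iv g) = g \<cdot> (h \<cdot> (iv h \<cdot> iv g))"
    using assms by (intro mul_assoc) auto
  also have "\<dots> = one (tgt g)" using assms by simp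
  finally show "g \<cdot> h \<cdot> (iv h \<cdot> iv g) = one (tgt (g \<cdot> h))" using assms by simp
qed (use assms in auto)

lemma iv_div:
  assumes "g \<in> Mor G" "h \<in> Mor G" "tgt g = tgt h"
  shows "iv (iv g \<cdot> h) = iv h \<cdot> g"
  using assms by (simp add: iv_mul)

lemma div_mul_div:
  assumes "g \<in> Mor G" "h \<in> Mor G" "k \<in> Mor G" "tgt g = tgt h" "tgt h = tgt k"
  shows "(iv g \<cdot> h) \<cdot> (iv h \<cdot> k) = iv g \<cdot> k"
proof -
  have "(iv g \<cdot> h) \<cdot> (iv h \<cdot> k) = iv g \<cdot> (h \<cdot> (iv h \<cdot> k))"
    using assms by (intro mul_assoc) auto
  then show ?thesis using assms by simp
qed

lemma div_translate:
  assumes "k \<in> Mor G" "g \<in> Mor G" "h \<in> Mor G" "src k = tgt g" "tgt g = tgt h"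
  shows "iv (k \<cdot> g) \<cdot> (k \<cdot> h) = iv g \<cdot> h"
proof -
  have "iv (k \<cdot> g) \<cdot> (k \<cdot> h) = iv g \<cdot> iv k \<cdot> (k \<cdot> h)" using assms by (simp add: iv_mul)
  also have "\<dots> = iv g \<cdot> (iv k \<cdot> (k \<cdot> h))" using assms by (intro mul_assoc) auto
  finally show ?thesis using assms by simp
qed

end

context topological_groupoid
begin

lemma openin_Mor: "openin (mor_top G) V \<Longrightarrow> V \<subseteq> Mor G"
  using openin_subset topspace_mor by blast

lemma openin_Obj: "openin (obj_top G) V \<Longrightarrow> V \<subseteq> Obj G"
  using openin_subset topspace_obj by blast

lemma openin_source_vimage:
  "openin (obj_top G) V \<Longrightarrow> openin (mor_top G) {g \<in> Mor G. src g \<in> V}"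
  using openin_continuous_map_preimage[OF continuous_source] by (simp add: topspace_mor)

lemma openin_target_vimage:
  "openin (obj_top G) V \<Longrightarrow> openin (mor_top G) {g \<in> Mor G. tgt g \<in> V}"
  using openin_continuous_map_preimage[OF continuous_target] by (simp add: topspace_mor)

lemma openin_invert_vimage:
  "openin (mor_top G) V \<Longrightarrow> openin (mor_top G) {g \<in> Mor G. iv g \<in> V}"
  using openin_continuous_map_preimage[OF continuous_invert] by (simp add: topspace_mor)

lemma mult_nbhds:
  assumes "g \<in> Mor G" "h \<in> Mor G" "src g = tgt h" "openin (mor_top G) V" "g \<cdot> h \<in> V"
  obtains A B where "openin (mor_top G) A" "openin (mor_top G) B" "g \<in> A" "h \<in> B"
    "\<And>a b. a \<in> A \<Longrightarrow> b \<in> B \<Longrightarrow> src a = tgt b \<Longrightarrow> a \<cdot> b \<in> V"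
proof -
  let ?P = "subtopology (prod_topology (mor_top G) (mor_top G)) (composable G)"
  have "composable G \<subseteq> Mor G \<times> Mor G" by (auto simp: composable_def)
  then have tp: "topspace ?P = composable G"
    by (auto simp: topspace_mor)
  have "openin ?P {p \<in> composable G. (\<lambda>(g, h). mult G g h) p \<in> V}"
    using openin_continuous_map_preimage[OF continuous_mult assms(4)] unfolding tp .
  then obtain T where T: "openin (prod_topology (mor_top G) (mor_top G)) T"
    and T_eq: "{p \<in> composable G. (\<lambda>(g, h). mult G g h) p \<in> V} = T \<inter> composable G"
    by (auto simp: openin_subtopology)
  have "(g, h) \<in> {p \<in> composable G. (\<lambda>(g, h). mult G g h) p \<in> V}"
    using assms by (simp add: composable_def)
  then have "(g, h) \<in> T" unfolding T_eq by simp
  from T[unfolded openin_prod_topology_alt, rule_format, OF this]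
  obtain A B where AB: "openin (mor_top G) A" "openin (mor_top G) B" "g \<in> A" "h \<in> B" "A \<times> B \<subseteq> T"
    by blast
  have "a \<cdot> b \<in> V" if "a \<in> A" "b \<in> B" "src a = tgt b" for a b
  proof -
    have "(a, b) \<in> T \<inter> composable G"
      using that AB openin_Mor[OF AB(1)] openin_Mor[OF AB(2)] by (auto simp: composable_def)
    then show ?thesis unfolding T_eq[symmetric] by auto
  qed
  then show thesis by (rule that[OF AB(1-4)])
qed

lemma div_nbhds:
  assumes "g \<in> Mor G" "h \<in> Mor G" "tgt g = tgt h" "openin (mor_top G) V" "iv g \<cdot> h \<in> V"
  obtains A B where "openin (mor_top G) A" "openin (mor_top G) B" "g \<in> A" "h \<in> B"
    "\<And>a b. a \<in> A \<Longrightarrow> b \<in> B \<Longrightarrow> tgt a = tgt b \<Longrightarrow> iv a \<cdot> b \<in> V"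
proof -
  obtain A B where AB: "openin (mor_top G) A" "openin (mor_top G) B" "iv g \<in> A" "h \<in> B"
    "\<And>a b. a \<in> A \<Longrightarrow> b \<in> B \<Longrightarrow> src a = tgt b \<Longrightarrow> a \<cdot> b \<in> V"
    using mult_nbhds[of "iv g" h V] assms by auto
  show thesis
  proof (rule that)
    show "openin (mor_top G) {a \<in> Mor G. iv a \<in> A}" by (rule openin_invert_vimage[OF AB(1)])
    fix a b assume "a \<in> {a \<in> Mor G. iv a \<in> A}" "b \<in> B" "tgt a = tgt b"
    then show "iv a \<cdot> b \<in> V" by (intro AB(5)) auto
  qed (use AB assms in auto)
qed

end


section \<open>Open groupoids with a countable base of open subgroupoids\<close>

text \<open>Both spaces come with a presentation by a subbase and countably many rules.
  Every subgroupoid in the sequence \<open>U\<close> occurs infinitely often. This makes all the fibres of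
  cosets below infinite, so that they can be enumerated without repetitions by \<open>\<nat>\<close>.\<close>

locale based_groupoid = topological_groupoid G
  for G :: "('o, 'm) top_groupoid" +
  fixes W U :: "nat \<Rightarrow> 'm set"
    and BO :: "nat \<Rightarrow> 'o set" and RO :: "(nat set \<times> nat set set) set"
    and BM :: "nat \<Rightarrow> 'm set" and RM :: "(nat set \<times> nat set set) set"
  assumes openin_target_image: "openin (mor_top G) V \<Longrightarrow> openin (obj_top G) (target G ` V)"
    and openin_W: "openin (mor_top G) (W n)"
    and W_base: "openin (mor_top G) V \<Longrightarrow> g \<in> V \<Longrightarrow> \<exists>n. g \<in> W n \<and> W n \<subseteq> V"
    and U_open_subgroupoid: "open_subgroupoid G (U i)"
    and U_base: "x \<in> Obj G \<Longrightarrow> openin (mor_top G) V \<Longrightarrow> ident G x \<in> V \<Longrightarrow>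
      \<exists>i. ident G x \<in> U i \<and> U i \<subseteq> V"
    and U_repeats: "infinite {j. U j = U i}"
    and presented_obj: "presented (obj_top G) BO RO"
    and presented_mor: "presented (mor_top G) BM RM"
begin

lemma W_Mor: "g \<in> W n \<Longrightarrow> g \<in> Mor G"
  using openin_Mor[OF openin_W] by auto

lemma openin_U: "openin (mor_top G) (U i)"
  using U_open_subgroupoid by (auto simp: open_subgroupoid_def)

lemma U_Mor: "g \<in> U i \<Longrightarrow> g \<in> Mor G"
  using openin_Mor[OF openin_U] by auto

lemma U_iv: "g \<in> U i \<Longrightarrow> iv g \<in> U i"
  using U_open_subgroupoid by (auto simp: open_subgroupoid_def)

lemma U_mul: "g \<in> U i \<Longrightarrow> h \<in> U i \<Longrightarrow> src g = tgt h \<Longrightarrow> g \<cdot> h \<in> U i"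
  using U_open_subgroupoid by (auto simp: open_subgroupoid_def)

lemma U_one_src: "g \<in> U i \<Longrightarrow> one (src g) \<in> U i"
  using U_mul[OF U_iv, of g i g] U_Mor by force

lemma W_ex: "g \<in> Mor G \<Longrightarrow> \<exists>n. g \<in> W n"
  using W_base[of "Mor G" g] by (metis openin_topspace topspace_mor)

lemma U_ex: "x \<in> Obj G \<Longrightarrow> \<exists>i. one x \<in> U i"
  using U_base[of x "Mor G"] by (metis ident_closed openin_topspace topspace_mor)

lemma div_base:
  assumes "g \<in> Mor G" "h \<in> Mor G" "tgt g = tgt h" "openin (mor_top G) V" "iv g \<cdot> h \<in> V"
  obtains n n' where "g \<in> W n" "h \<in> W n'"
    "\<And>a b. a \<in> W n \<Longrightarrow> b \<in> W n' \<Longrightarrow> tgt a = tgt b \<Longrightarrow> iv a \<cdot> b \<in> V"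
proof -
  obtain A B where AB: "openin (mor_top G) A" "openin (mor_top G) B" "g \<in> A" "h \<in> B"
    "\<And>a b. a \<in> A \<Longrightarrow> b \<in> B \<Longrightarrow> tgt a = tgt b \<Longrightarrow> iv a \<cdot> b \<in> V"
    using div_nbhds[OF assms] by blast
  obtain n n' where n: "g \<in> W n" "W n \<subseteq> A" "h \<in> W n'" "W n' \<subseteq> B"
    using W_base AB by meson
  show thesis by (rule that[OF n(1,3)], rule AB(5)) (use n in auto)
qed

lemma mult_base:
  assumes "g \<in> Mor G" "h \<in> Mor G" "src g = tgt h" "openin (mor_top G) V" "g \<cdot> h \<in> V"
  obtains n n' where "g \<in> W n" "h \<in> W n'"
    "\<And>a b. a \<in> W n \<Longrightarrow> b \<in> W n' \<Longrightarrow> src a = tgt b \<Longrightarrow> a \<cdot> b \<in> V"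
proof -
  obtain A B where AB: "openin (mor_top G) A" "openin (mor_top G) B" "g \<in> A" "h \<in> B"
    "\<And>a b. a \<in> A \<Longrightarrow> b \<in> B \<Longrightarrow> src a = tgt b \<Longrightarrow> a \<cdot> b \<in> V"
    using mult_nbhds[OF assms] by blast
  obtain n n' where n: "g \<in> W n" "W n \<subseteq> A" "h \<in> W n'" "W n' \<subseteq> B"
    using W_base AB by meson
  show thesis by (rule that[OF n(1,3)], rule AB(5)) (use n in auto)
qed

lemma left_U_base:
  assumes "openin (mor_top G) V" "k \<in> V"
  obtains i n where "one (tgt k) \<in> U i" "k \<in> W n"
    "\<And>j u w. U j \<subseteq> U i \<Longrightarrow> u \<in> U j \<Longrightarrow> w \<in> W n \<Longrightarrow> src u = tgt w \<Longrightarrow> u \<cdot> w \<in> V"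
proof -
  have k: "k \<in> Mor G" using assms openin_Mor by blast
  obtain m n where mn: "one (tgt k) \<in> W m" "k \<in> W n"
    "\<And>a b. a \<in> W m \<Longrightarrow> b \<in> W n \<Longrightarrow> src a = tgt b \<Longrightarrow> a \<cdot> b \<in> V"
    using mult_base[of "one (tgt k)" k V] assms k by auto
  obtain i where "one (tgt k) \<in> U i" "U i \<subseteq> W m"
    using U_base[OF _ openin_W mn(1)] k by auto
  note i = this
  show thesis by (rule that[OF i(1) mn(2)], rule mn(3)) (use i in auto)
qed

lemma right_U_base:
  assumes "openin (mor_top G) V" "k \<in> V"
  obtains i n where "one (src k) \<in> U i" "k \<in> W n"
    "\<And>u w. u \<in> U i \<Longrightarrow> w \<in> W n \<Longrightarrow> src w = tgt u \<Longrightarrow> w \<cdot> u \<in> V"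
proof -
  have k: "k \<in> Mor G" using assms openin_Mor by blast
  obtain n m where mn: "k \<in> W n" "one (src k) \<in> W m"
    "\<And>a b. a \<in> W n \<Longrightarrow> b \<in> W m \<Longrightarrow> src a = tgt b \<Longrightarrow> a \<cdot> b \<in> V"
    using mult_base[of k "one (src k)" V] assms k by auto
  obtain i where "one (src k) \<in> U i" "U i \<subseteq> W m"
    using U_base[OF _ openin_W mn(2)] k by auto
  note i = this
  show thesis by (rule that[OF i(1) mn(1)], rule mn(3)) (use i in auto)
qed

lemma mor_separated:
  assumes "g \<in> Mor G" "h \<in> Mor G" "\<And>V. openin (mor_top G) V \<Longrightarrow> g \<in> V \<longleftrightarrow> h \<in> V"
  shows "g = h"
proof -
  have "\<forall>n. g \<in> BM n \<longleftrightarrow> h \<in> BM n"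
    using assms(3) presented_mor by (auto simp: presented_def subbase_def)
  then show ?thesis using presented_mor assms by (auto simp: presented_def topspace_mor)
qed

subsection \<open>Left cosets\<close>

definition coset :: "nat \<Rightarrow> 'm \<Rightarrow> 'm set"
  where "coset j g = {h \<in> Mor G. tgt h = tgt g \<and> iv g \<cdot> h \<in> U j}"

text \<open>The underlying set of the structure attached to \<open>x\<close>. The tags keep cosets of equal subgroupoids
  with different indices apart, which makes it infinite.\<close>

definition fib :: "'o \<Rightarrow> (nat \<times> 'm set) set"
  where "fib x = {(j, coset j g) | j g. g \<in> Mor G \<and> tgt g = x \<and> one (src g) \<in> U j}"

definition act :: "'m \<Rightarrow> nat \<times> 'm set \<Rightarrow> nat \<times> 'm set"
  where "act k a = (fst a, (\<lambda>h. k \<cdot> h) ` snd a)"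

lemma fst_act [simp]: "fst (act k a) = fst a"
  by (simp add: act_def)

lemma coset_self: "g \<in> Mor G \<Longrightarrow> one (src g) \<in> U j \<Longrightarrow> g \<in> coset j g"
  by (simp add: coset_def)

lemma fibI: "g \<in> Mor G \<Longrightarrow> tgt g = x \<Longrightarrow> one (src g) \<in> U j \<Longrightarrow> (j, coset j g) \<in> fib x"
  by (auto simp: fib_def)

lemma fib_nonempty:
  assumes "a \<in> fib x"
  obtains h where "h \<in> snd a"
proof -
  obtain j g where "a = (j, coset j g)" "g \<in> Mor G" "one (src g) \<in> U j"
    using assms by (auto simp: fib_def)
  then have "g \<in> snd a" by (simp add: coset_self)
  then show thesis by (rule that)
qed

lemma coset_eq:
  assumes g: "g \<in> Mor G" and h: "h \<in> coset j g"
  shows "coset j h = coset j g"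
proof -
  have h': "h \<in> Mor G" "tgt h = tgt g" "iv g \<cdot> h \<in> U j" using h by (auto simp: coset_def)
  have "iv h \<cdot> g \<in> U j" using U_iv[OF h'(3)] g h' by (simp add: iv_div)
  have "iv g \<cdot> k \<in> U j \<longleftrightarrow> iv h \<cdot> k \<in> U j" if k: "k \<in> Mor G" "tgt k = tgt g" for k
  proof
    assume "iv g \<cdot> k \<in> U j"
    then have "(iv h \<cdot> g) \<cdot> (iv g \<cdot> k) \<in> U j"
      using \<open>iv h \<cdot> g \<in> U j\<close> g h' k by (rule_tac U_mul) auto
    then show "iv h \<cdot> k \<in> U j" using g h' k by (simp add: div_mul_div)
  next
    assume "iv h \<cdot> k \<in> U j"
    then have "(iv g \<cdot> h) \<cdot> (iv h \<cdot> k) \<in> U j"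
      using h'(3) g h' k by (rule_tac U_mul) auto
    then show "iv g \<cdot> k \<in> U j" using g h' k by (simp add: div_mul_div)
  qed
  then show ?thesis using h' by (auto simp: coset_def)
qed

lemma fib_memD:
  assumes "a \<in> fib x" "h \<in> snd a"
  shows "h \<in> Mor G" "tgt h = x" "one (src h) \<in> U (fst a)" "snd a = coset (fst a) h"
proof -
  obtain j g where a: "a = (j, coset j g)" "g \<in> Mor G" "tgt g = x" "one (src g) \<in> U j"
    using assms by (auto simp: fib_def)
  have h: "h \<in> coset j g" using assms a by simp
  then show "h \<in> Mor G" "tgt h = x" "snd a = coset (fst a) h"
    using a coset_eq[OF a(2) h] by (auto simp: coset_def)
  have "iv g \<cdot> h \<in> U j" using h by (auto simp: coset_def)
  from U_one_src[OF this] show "one (src h) \<in> U (fst a)"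
    using a h by (auto simp: coset_def)
qed

lemma fib_mem_iff:
  assumes "a \<in> fib x" "g \<in> snd a"
  shows "h \<in> snd a \<longleftrightarrow> h \<in> Mor G \<and> tgt h = x \<and> iv g \<cdot> h \<in> U (fst a)"
  using fib_memD[OF assms] by (auto simp: coset_def)

lemma fib_eqI:
  assumes "a \<in> fib x" "b \<in> fib x" "fst a = fst b" "g \<in> snd a" "h \<in> snd b" "iv g \<cdot> h \<in> U (fst a)"
  shows "a = b"
proof -
  note h = fib_memD[OF assms(2,5)]
  have "h \<in> snd a" using fib_mem_iff[OF assms(1,4)] h assms by auto
  from fib_memD(4)[OF assms(1) this] h assms show ?thesis by (metis prod.expand)
qed

lemma act_coset:
  assumes k: "k \<in> Mor G" and g: "g \<in> Mor G" "tgt g = src k"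
  shows "(\<lambda>h. k \<cdot> h) ` coset j g = coset j (k \<cdot> g)"
proof
  show "(\<lambda>h. k \<cdot> h) ` coset j g \<subseteq> coset j (k \<cdot> g)"
    using k g by (auto simp: coset_def div_translate)
  show "coset j (k \<cdot> g) \<subseteq> (\<lambda>h. k \<cdot> h) ` coset j g"
  proof
    fix h assume "h \<in> coset j (k \<cdot> g)"
    then have h: "h \<in> Mor G" "tgt h = tgt k" "iv (k \<cdot> g) \<cdot> h \<in> U j"
      using k g by (auto simp: coset_def)
    then have "iv (k \<cdot> g) \<cdot> (k \<cdot> (iv k \<cdot> h)) \<in> U j" using k by simp
    then have "iv g \<cdot> (iv k \<cdot> h) \<in> U j" using k g h by (subst (asm) div_translate) auto
    then have "iv k \<cdot> h \<in> coset j g" using k g h by (auto simp: coset_def)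
    moreover have "h = k \<cdot> (iv k \<cdot> h)" using k h by simp
    ultimately show "h \<in> (\<lambda>h. k \<cdot> h) ` coset j g" by blast
  qed
qed

lemma act_fib:
  assumes "k \<in> Mor G" "a \<in> fib (src k)"
  shows "act k a \<in> fib (tgt k)"
proof -
  obtain j g where a: "a = (j, coset j g)" "g \<in> Mor G" "tgt g = src k" "one (src g) \<in> U j"
    using assms by (auto simp: fib_def)
  then show ?thesis using assms act_coset[OF assms(1) a(2,3)] by (auto simp: act_def intro!: fibI)
qed

lemma act_mem: "h \<in> snd a \<Longrightarrow> k \<cdot> h \<in> snd (act k a)"
  by (auto simp: act_def)

lemma act_mul:
  assumes "k \<in> Mor G" "l \<in> Mor G" "src k = tgt l" "a \<in> fib (src l)"
  shows "act (k \<cdot> l) a = act k (act l a)"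
proof -
  have "k \<cdot> l \<cdot> h = k \<cdot> (l \<cdot> h)" if "h \<in> snd a" for h
    using fib_memD[OF assms(4) that] assms by (simp add: mul_assoc)
  then show ?thesis by (auto simp: act_def image_image)
qed

lemma act_one: "x \<in> Obj G \<Longrightarrow> a \<in> fib x \<Longrightarrow> act (one x) a = a"
  using fib_memD[of a x] by (force simp: act_def image_def intro: prod_eqI)

lemma act_iv:
  assumes "k \<in> Mor G" "a \<in> fib (src k)"
  shows "act (iv k) (act k a) = a"
  using act_mul[of "iv k" k a] assms by (simp add: act_one)

lemma act_iv':
  assumes "k \<in> Mor G" "a \<in> fib (tgt k)"
  shows "act k (act (iv k) a) = a"
  using act_mul[of k "iv k" a] assms by (simp add: act_one)

text \<open>Continuity of division at \<open>(h, h)\<close>, where its value is a unit in \<open>U\<close>, makes cosets open among the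
  morphisms with target \<open>x\<close>. In the space of all morphisms they are not open in general.\<close>

lemma fib_open:
  assumes a: "a \<in> fib x" and h: "h \<in> snd a"
  obtains n where "h \<in> W n" "\<And>h'. h' \<in> W n \<Longrightarrow> tgt h' = x \<Longrightarrow> h' \<in> snd a"
proof -
  note h' = fib_memD[OF a h]
  have "iv h \<cdot> h \<in> U (fst a)" using h' by simp
  then obtain n n' where n: "h \<in> W n" "h \<in> W n'"
    "\<And>a' b. a' \<in> W n \<Longrightarrow> b \<in> W n' \<Longrightarrow> tgt a' = tgt b \<Longrightarrow> iv a' \<cdot> b \<in> U (fst a)"
    using div_base[OF h'(1) h'(1) refl openin_U] by blast
  show thesis
  proof (rule that)
    fix k assume "k \<in> W n'" "tgt k = x"
    then show "k \<in> snd a" using fib_mem_iff[OF a h] n h' W_Mor by auto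
  qed (rule n)
qed

text \<open>Since \<open>h \<cdot> 1 = h\<close>, continuity of multiplication gives a subgroupoid \<open>U\<close> with \<open>h U \<subseteq> V\<close>. Small
  cosets are thus a neighbourhood base in the space of morphisms with target \<open>x\<close>, which is what the density
  arguments below rest on.\<close>

lemma small_coset:
  assumes a: "a \<in> fib x" and h: "h \<in> snd a" and V: "openin (mor_top G) V" "h \<in> V"
    and T: "openin (mor_top G) T" "one (src h) \<in> T"
  obtains b where "b \<in> fib x" "h \<in> snd b" "snd b \<subseteq> snd a" "snd b \<subseteq> V" "U (fst b) \<subseteq> U (fst a)"
    "U (fst b) \<subseteq> T"
proof -
  note h' = fib_memD[OF a h]
  obtain n m where n: "one (src h) \<in> U n" "h \<in> W m"
      "\<And>u w. u \<in> U n \<Longrightarrow> w \<in> W m \<Longrightarrow> src w = tgt u \<Longrightarrow> w \<cdot> u \<in> V"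
    using right_U_base[OF V] by blast
  have "openin (mor_top G) (U n \<inter> U (fst a) \<inter> T)"
    using openin_U T by (intro openin_Int) auto
  then obtain i where i: "one (src h) \<in> U i" "U i \<subseteq> U n \<inter> U (fst a) \<inter> T"
    using U_base[of "src h" "U n \<inter> U (fst a) \<inter> T"] n h' T by auto
  have mem: "h = k \<or> (k \<in> V \<and> k \<in> snd a)" if "k \<in> coset i h" for k
  proof -
    have k: "k \<in> Mor G" "tgt k = tgt h" "iv h \<cdot> k \<in> U i" using that by (auto simp: coset_def)
    have "h \<cdot> (iv h \<cdot> k) \<in> V" using k i n h' by (intro n(3)) auto
    moreover have "k \<in> snd a" using k i h' by (subst fib_mem_iff[OF a h]) auto
    ultimately show ?thesis using k h' by simp
  qed
  show thesis
  proof (rule that[of "(i, coset i h)"])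
    show "(i, coset i h) \<in> fib x" using h' i by (intro fibI) auto
    show "h \<in> snd (i, coset i h)" using coset_self h' i by simp
  qed (use mem i h V in auto)
qed

end

text \<open>For basic sets \<open>W m\<close> and \<open>W n\<close>, choose one open subgroupoid inside \<open>W n\<close> that contains the units of \<open>W m\<close>, if there
  is any. Every open subgroupoid that contains a unit contains the units of some basic neighbourhood of
  it, so these countably many choices still form a base at the units.\<close>

lemma based_groupoid_exists:
  fixes G :: "('o, 'm) top_groupoid"
  assumes op: "open_groupoid G" and na: "non_archimedean G" and qp: "quasi_polish_groupoid G"
  obtains W U BO RO BM RM where "based_groupoid G W U BO RO BM RM"
proof -
  interpret topological_groupoid G using op by (simp add: open_groupoid_def)
  obtain BO RO where O: "presented (obj_top G) BO RO"
    using qp quasi_polish_presented by (auto simp: quasi_polish_groupoid_def)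
  obtain BM RM where M: "presented (mor_top G) BM RM"
    using qp quasi_polish_presented by (auto simp: quasi_polish_groupoid_def)
  have sbM: "subbase (mor_top G) BM" using M by (simp add: presented_def)
  define W where "W n = subbox (mor_top G) BM (set (list_decode n))" for n
  have W_open: "openin (mor_top G) (W n)" for n
    unfolding W_def by (intro openin_subbox sbM) auto
  have W_base: "\<exists>n. g \<in> W n \<and> W n \<subseteq> V" if V: "openin (mor_top G) V" "g \<in> V" for V g
  proof -
    from subbaseE[OF sbM V] obtain u where
      u: "finite u" "g \<in> subbox (mor_top G) BM u" "subbox (mor_top G) BM u \<subseteq> V" .
    obtain xs where "set xs = u" using finite_list[OF u(1)] by blast
    then show ?thesis using u by (intro exI[of _ "list_encode xs"]) (simp add: W_def)
  qed
  define adm where "adm m n S \<longleftrightarrow> open_subgroupoid G S \<and> S \<subseteq> W n \<and> W m \<inter> one ` Obj G \<subseteq> S" for m n S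
  define T where "T m n = (if \<exists>S. adm m n S then SOME S. adm m n S else {})" for m n
  have T_adm: "adm m n (T m n)" if "\<exists>S. adm m n S" for m n
    using someI_ex[OF that] that by (simp add: T_def)
  have T: "open_subgroupoid G (T m n)" for m n
  proof (cases "\<exists>S. adm m n S")
    case True then show ?thesis using T_adm by (auto simp: adm_def)
  next
    case False
    then have "T m n = {}" unfolding T_def by (rule if_not_P)
    then show ?thesis by (simp add: open_subgroupoid_def)
  qed
  \<comment> \<open>The third component of the code \<open>k\<close> is a dummy that produces the repetitions.\<close>
  define U where "U k = T (fst (prod_decode k)) (fst (prod_decode (snd (prod_decode k))))" for k
  have U_code: "U (prod_encode (m, prod_encode (n, r))) = T m n" for m n r
    by (simp add: U_def)
  have "based_groupoid G W U BO RO BM RM"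
  proof unfold_locales
    fix V assume V: "openin (mor_top G) V"
    have "tgt ` V = src ` {g \<in> Mor G. iv g \<in> V}"
    proof
      show "tgt ` V \<subseteq> src ` {g \<in> Mor G. iv g \<in> V}"
      proof
        fix x assume "x \<in> tgt ` V"
        then obtain g where g: "g \<in> V" "x = tgt g" by blast
        then have "g \<in> Mor G" using openin_Mor[OF V] by blast
        then show "x \<in> src ` {g \<in> Mor G. iv g \<in> V}"
          using g by (intro image_eqI[of _ _ "iv g"]) auto
      qed
      show "src ` {g \<in> Mor G. iv g \<in> V} \<subseteq> tgt ` V" by force
    qed
    moreover have "openin (obj_top G) (src ` {g \<in> Mor G. iv g \<in> V})"
      using op openin_invert_vimage[OF V] by (auto simp: open_groupoid_def open_map_def)
    ultimately show "openin (obj_top G) (tgt ` V)" by simp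
  next
    fix x V assume x: "x \<in> Obj G" and V: "openin (mor_top G) V" "one x \<in> V"
    obtain n where n: "one x \<in> W n" "W n \<subseteq> V" using W_base[OF V] by blast
    obtain S where S: "open_subgroupoid G S" "one x \<in> S" "S \<subseteq> W n"
      using na x W_open[of n] n(1) unfolding non_archimedean_def by blast
    then obtain m where m: "one x \<in> W m" "W m \<subseteq> S"
      using W_base[of S "one x"] by (auto simp: open_subgroupoid_def)
    have "adm m n S" using S m by (auto simp: adm_def)
    then have "adm m n (T m n)" using T_adm by blast
    then show "\<exists>i. one x \<in> U i \<and> U i \<subseteq> V"
      using x m n by (intro exI[of _ "prod_encode (m, prod_encode (n, 0))"])
        (auto simp: U_code adm_def)
  next
    fix i
    obtain m n r where i: "i = prod_encode (m, prod_encode (n, r))"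
      by (metis prod.collapse prod_decode_inverse)
    have "range (\<lambda>r. prod_encode (m, prod_encode (n, r))) \<subseteq> {j. U j = U i}"
      by (auto simp: U_code i)
    moreover have "infinite (range (\<lambda>r. prod_encode (m, prod_encode (n, r))))"
      by (rule range_inj_infinite) (auto intro!: injI)
    ultimately show "infinite {j. U j = U i}" using finite_subset by blast
  qed (use W_open W_base T O M in \<open>auto simp: U_def\<close>)
  then show thesis by (rule that)
qed

context based_groupoid
begin

section \<open>Borel enumeration of the fibres\<close>

text \<open>Members of \<open>W n\<close> with a common target then lie in a common coset of \<open>U j\<close>, so that the pair
  \<open>(j, n)\<close> names at most one coset in every fibre. Enumerating least names makes the enumeration of
  \<open>fib x\<close> free of repetitions and Borel in \<open>x\<close>.\<close>

definition valid :: "nat \<Rightarrow> nat \<Rightarrow> bool"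
  where "valid j n \<longleftrightarrow> (\<forall>g\<in>W n. \<forall>h\<in>W n. tgt g = tgt h \<longrightarrow> iv g \<cdot> h \<in> U j)"

definition meets :: "nat \<times> 'm set \<Rightarrow> nat \<Rightarrow> nat \<Rightarrow> bool"
  where "meets a j n \<longleftrightarrow> fst a = j \<and> snd a \<inter> W n \<noteq> {}"

abbreviation "name_index c \<equiv> fst (prod_decode c)"
abbreviation "name_base c \<equiv> snd (prod_decode c)"

definition names :: "nat \<times> 'm set \<Rightarrow> nat \<Rightarrow> bool"
  where "names a c \<longleftrightarrow> valid (name_index c) (name_base c) \<and>
    meets a (name_index c) (name_base c)"

lemma valid_ex:
  assumes h: "h \<in> Mor G" "one (src h) \<in> U j" and V: "openin (mor_top G) V" "h \<in> V"
  obtains n where "h \<in> W n" "W n \<subseteq> V" "valid j n"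
proof -
  have "iv h \<cdot> h \<in> U j" using h by simp
  then obtain n n' where n: "h \<in> W n" "h \<in> W n'"
    "\<And>a b. a \<in> W n \<Longrightarrow> b \<in> W n' \<Longrightarrow> tgt a = tgt b \<Longrightarrow> iv a \<cdot> b \<in> U j"
    using div_base[OF h(1) h(1) refl openin_U] by blast
  have "openin (mor_top G) (W n \<inter> W n' \<inter> V)" using openin_W V by (intro openin_Int) auto
  then obtain m where "h \<in> W m" "W m \<subseteq> W n \<inter> W n' \<inter> V"
    using W_base[of "W n \<inter> W n' \<inter> V" h] n V by auto
  then show thesis using n(3) by (intro that[of m]) (auto simp: valid_def)
qed

lemma valid_eq:
  assumes "a \<in> fib x" "b \<in> fib x" "valid j n" "meets a j n" "meets b j n"
  shows "a = b"
proof -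
  obtain g h where gh: "g \<in> snd a" "g \<in> W n" "h \<in> snd b" "h \<in> W n" "fst a = j" "fst b = j"
    using assms by (auto simp: meets_def)
  have "tgt g = tgt h" using fib_memD(2) assms gh by metis
  then show ?thesis using assms(3) gh
    by (intro fib_eqI[OF assms(1,2) _ gh(1,3)]) (auto simp: valid_def)
qed

text \<open>A coset is determined by the basic open sets it meets. This is how cosets are handled in a Borel way:
  every property of them is expressed by \<open>meets\<close>.\<close>

lemma fib_eq_meets:
  assumes a: "a \<in> fib x" and b: "b \<in> fib x" and eq: "\<And>j n. meets a j n \<Longrightarrow> meets b j n"
  shows "a = b"
proof -
  obtain h where h: "h \<in> snd a" using fib_nonempty[OF a] by blast
  note h' = fib_memD[OF a h]
  obtain n where n: "h \<in> W n" "valid (fst a) n"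
    using valid_ex[OF h'(1,3), of "Mor G"] h' by (metis openin_topspace topspace_mor)
  then have "meets a (fst a) n" using h by (auto simp: meets_def)
  then show ?thesis using valid_eq[OF a b n(2)] eq by blast
qed

lemma names_unique: "a \<in> fib x \<Longrightarrow> b \<in> fib x \<Longrightarrow> names a c \<Longrightarrow> names b c \<Longrightarrow> a = b"
  unfolding names_def using valid_eq by blast

lemma names_ex:
  assumes a: "a \<in> fib x"
  shows "\<exists>c. names a c"
proof -
  obtain h where h: "h \<in> snd a" using fib_nonempty[OF a] by blast
  note h' = fib_memD[OF a h]
  obtain n where n: "h \<in> W n" "valid (fst a) n"
    using valid_ex[OF h'(1,3), of "Mor G"] h' by (metis openin_topspace topspace_mor)
  then show ?thesis using h
    by (intro exI[of _ "prod_encode (fst a, n)"]) (auto simp: names_def meets_def)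
qed

definition name :: "nat \<times> 'm set \<Rightarrow> nat"
  where "name a = (LEAST c. names a c)"

definition name_set :: "'o \<Rightarrow> nat set"
  where "name_set x = name ` fib x"

definition el :: "'o \<Rightarrow> nat \<Rightarrow> nat \<times> 'm set"
  where "el x m = inv_into (fib x) name (enumerate (name_set x) m)"

lemma names_name: "a \<in> fib x \<Longrightarrow> names a (name a)"
  unfolding name_def using names_ex by (metis LeastI_ex)

lemma inj_name: "inj_on name (fib x)"
  by (rule inj_onI) (metis names_name names_unique)

lemma infinite_name_set:
  assumes x: "x \<in> Obj G"
  shows "infinite (name_set x)"
proof
  assume "finite (name_set x)"
  then have "finite (fib x)"
    unfolding name_set_def using finite_imageD inj_name by blast
  then have fin: "finite (fst ` fib x)" by blast
  obtain i where i: "one x \<in> U i" using U_ex[OF x] by blast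
  have "{j. U j = U i} \<subseteq> fst ` fib x"
  proof
    fix j assume "j \<in> {j. U j = U i}"
    then have "(j, coset j (one x)) \<in> fib x" using x i by (intro fibI) auto
    then show "j \<in> fst ` fib x" by force
  qed
  then show False using fin U_repeats[of i] finite_subset by blast
qed

lemma name_el: "x \<in> Obj G \<Longrightarrow> name (el x m) = enumerate (name_set x) m"
  using infinite_name_set[of x] enumerate_in_set[of "name_set x" m]
  by (simp add: el_def name_set_def f_inv_into_f)

lemma bij_el:
  assumes x: "x \<in> Obj G"
  shows "bij_betw (el x) UNIV (fib x)"
proof -
  have "bij_betw (enumerate (name_set x)) UNIV (name_set x)"
    using bij_enumerate infinite_name_set[OF x] by blast
  moreover have "bij_betw (inv_into (fib x) name) (name_set x) (fib x)"
    by (rule bij_betw_inv_into) (simp add: bij_betw_def inj_name name_set_def)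
  ultimately have "bij_betw (inv_into (fib x) name \<circ> enumerate (name_set x)) UNIV (fib x)"
    by (rule bij_betw_trans)
  moreover have "inv_into (fib x) name \<circ> enumerate (name_set x) = el x"
    by (auto simp: el_def)
  ultimately show ?thesis by simp
qed

lemma el_fib [simp]: "x \<in> Obj G \<Longrightarrow> el x m \<in> fib x"
  using bij_el by (auto simp: bij_betw_def)

lemma el_inj: "x \<in> Obj G \<Longrightarrow> el x m = el x m' \<Longrightarrow> m = m'"
  using bij_el by (auto simp: bij_betw_def inj_on_def)

lemma el_ex: "x \<in> Obj G \<Longrightarrow> a \<in> fib x \<Longrightarrow> \<exists>m. el x m = a"
  using bij_el by (metis bij_betw_imp_surj_on imageE)


subsection \<open>Borel dependence on the object\<close>

abbreviation "OB \<equiv> borel_of (obj_top G)"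
abbreviation "MB \<equiv> borel_of (mor_top G)"

declare topspace_obj [simp] topspace_mor [simp]

lemma pred_tgt_W [measurable]: "Measurable.pred OB (\<lambda>x. x \<in> tgt ` W n)"
proof -
  have op: "openin (obj_top G) (tgt ` W n)" by (intro openin_target_image openin_W)
  have "{x \<in> space OB. x \<in> tgt ` W n} = tgt ` W n" using openin_Obj[OF op] by auto
  then show ?thesis using openin_borel_of[OF op] by (simp add: pred_def)
qed

text \<open>Two basic sets \<open>W m\<close> and \<open>W m'\<close> that witness, by continuity of division, that the two descriptions
  fit together turn the condition on \<open>x\<close> into membership in images of basic open sets under the target map,
  which are open.\<close>

lemma names_meets_iff:
  assumes x: "x \<in> Obj G"
  shows "(\<exists>a\<in>fib x. names a c \<and> meets a j n) \<longleftrightarrow>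
    valid (name_index c) (name_base c) \<and> name_index c = j \<and>
    (\<exists>m m'. (W m \<subseteq> W (name_base c) \<and> W m' \<subseteq> W n \<and>
        (\<forall>a\<in>W m. \<forall>b\<in>W m'. tgt a = tgt b \<longrightarrow> iv a \<cdot> b \<in> U j)) \<and>
      x \<in> tgt ` W m \<and> x \<in> tgt ` W m')" (is "_ \<longleftrightarrow> ?r")
proof
  assume "\<exists>a\<in>fib x. names a c \<and> meets a j n"
  then obtain a where a: "a \<in> fib x" "names a c" "meets a j n" by blast
  then obtain g h where gh: "g \<in> snd a" "g \<in> W (name_base c)" "h \<in> snd a" "h \<in> W n"
    "fst a = j" "name_index c = j"
    by (auto simp: names_def meets_def)
  note g' = fib_memD[OF a(1) gh(1)] and h' = fib_memD[OF a(1) gh(3)]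
  have "iv g \<cdot> h \<in> U j" using fib_mem_iff[OF a(1) gh(1)] gh by auto
  then obtain m m' where m: "g \<in> W m" "h \<in> W m'"
    "\<And>a b. a \<in> W m \<Longrightarrow> b \<in> W m' \<Longrightarrow> tgt a = tgt b \<Longrightarrow> iv a \<cdot> b \<in> U j"
    using div_base[OF g'(1) h'(1) _ openin_U] g' h' by metis
  obtain p where p: "g \<in> W p" "W p \<subseteq> W m \<inter> W (name_base c)"
    using W_base[of "W m \<inter> W (name_base c)" g] m gh openin_W by blast
  obtain p' where p': "h \<in> W p'" "W p' \<subseteq> W m' \<inter> W n"
    using W_base[of "W m' \<inter> W n" h] m gh openin_W by blast
  have "\<forall>a\<in>W p. \<forall>b\<in>W p'. tgt a = tgt b \<longrightarrow> iv a \<cdot> b \<in> U j"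
  proof (intro ballI impI)
    fix a b assume "a \<in> W p" "b \<in> W p'" "tgt a = tgt b"
    then show "iv a \<cdot> b \<in> U j" using p(2) p'(2) by (intro m(3)) blast+
  qed
  then have "W p \<subseteq> W (name_base c) \<and> W p' \<subseteq> W n \<and>
    (\<forall>a\<in>W p. \<forall>b\<in>W p'. tgt a = tgt b \<longrightarrow> iv a \<cdot> b \<in> U j)" using p(2) p'(2) by blast
  moreover have "x \<in> tgt ` W p \<and> x \<in> tgt ` W p'"
    using p(1) p'(1) g'(2) h'(2) by (metis imageI)
  ultimately show ?r
    using a gh by (auto simp: names_def)
next
  assume ?r
  then obtain g h where v: "valid j (name_base c)" "name_index c = j"
    and gh: "g \<in> W (name_base c)" "h \<in> W n" "tgt g = x" "tgt h = x" "iv g \<cdot> h \<in> U j"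
    by fastforce
  have gM: "g \<in> Mor G" "h \<in> Mor G" using gh W_Mor by auto
  have one: "one (src g) \<in> U j" using v gh(1) gM by (force simp: valid_def)
  have "names (j, coset j g) c"
    using v gh gM coset_self[OF gM(1) one] by (auto simp: names_def meets_def)
  moreover have "meets (j, coset j g) j n" using gh gM by (auto simp: meets_def coset_def)
  moreover have "(j, coset j g) \<in> fib x" using gM gh one by (intro fibI) auto
  ultimately show "\<exists>a\<in>fib x. names a c \<and> meets a j n" by blast
qed

lemma pred_names_meets [measurable]:
  "Measurable.pred OB (\<lambda>x. \<exists>a\<in>fib x. names a c \<and> meets a j n)"
proof -
  have "Measurable.pred OB (\<lambda>x. valid (name_index c) (name_base c) \<and>
    name_index c = j \<and>
    (\<exists>m m'. (W m \<subseteq> W (name_base c) \<and> W m' \<subseteq> W n \<and>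
        (\<forall>a\<in>W m. \<forall>b\<in>W m'. tgt a = tgt b \<longrightarrow> iv a \<cdot> b \<in> U j)) \<and>
      x \<in> tgt ` W m \<and> x \<in> tgt ` W m'))"
    by measurable
  then show ?thesis
    by (subst measurable_cong[OF names_meets_iff]) simp_all
qed

lemma name_set_iff:
  "c \<in> name_set x \<longleftrightarrow>
    (\<exists>a\<in>fib x. names a c \<and> meets a (name_index c) (name_base c)) \<and>
    (\<forall>c'. \<not> (c' < c \<and> valid (name_index c') (name_base c') \<and>
      (\<exists>a\<in>fib x. names a c \<and> meets a (name_index c') (name_base c'))))"
    (is "_ \<longleftrightarrow> ?r")
proof
  assume "c \<in> name_set x"
  then obtain a where a: "a \<in> fib x" "c = name a" by (auto simp: name_set_def)
  have n: "names a c" using names_name a by simp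
  have "\<not> names b c'" if "c' < c" "b \<in> fib x" "names b c" for b c'
  proof -
    have "b = a" using names_unique[OF that(2) a(1) that(3) n] .
    then show ?thesis using that(1) not_less_Least[of c' "names a"] a by (auto simp: name_def)
  qed
  then show ?r using a n unfolding names_def by blast
next
  assume r: ?r
  then obtain a where a: "a \<in> fib x" "names a c" by blast
  have "name a = c"
    unfolding name_def
  proof (rule Least_equality)
    show "names a c" by (rule a)
    fix c' assume "names a c'"
    then show "c \<le> c'" using r a by (metis names_def not_le)
  qed
  then show "c \<in> name_set x" using a by (auto simp: name_set_def)
qed

lemma pred_name_set [measurable]: "Measurable.pred OB (\<lambda>x. c \<in> name_set x)"
  unfolding name_set_iff by measurable

lemma measurable_enumerate_name_set [measurable]:
  "(\<lambda>x. enumerate (name_set x) m) \<in> measurable OB (count_space UNIV)"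
proof (induction m)
  case 0
  show ?case unfolding enumerate_0 by measurable
next
  case (Suc m)
  note Suc [measurable]
  have "(\<lambda>x. LEAST s. s \<in> name_set x \<and> enumerate (name_set x) m < s) \<in> measurable OB (count_space UNIV)"
    by measurable
  then show ?case
    by (subst measurable_cong[OF enumerate_Suc'']) (simp_all add: infinite_name_set)
qed

lemma meets_el_iff:
  assumes x: "x \<in> Obj G"
  shows "meets (el x m) j n \<longleftrightarrow>
    (\<exists>c. enumerate (name_set x) m = c \<and> (\<exists>a\<in>fib x. names a c \<and> meets a j n))"
  using names_name[OF el_fib[OF x, of m]] name_el[OF x, of m] el_fib[OF x, of m] names_unique
  by metis

lemma pred_meets_el [measurable]: "Measurable.pred OB (\<lambda>x. meets (el x m) j n)"
proof -
  have "Measurable.pred OB (\<lambda>x. \<exists>c. enumerate (name_set x) m = c \<and>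
      (\<exists>a\<in>fib x. names a c \<and> meets a j n))"
    by measurable
  then show ?thesis by (subst measurable_cong[OF meets_el_iff]) simp_all
qed


section \<open>The structure attached to an object\<close>

text \<open>Invariant under left multiplication, as \<open>(k g)\<^sup>-\<^sup>1 (k h) = g\<^sup>-\<^sup>1 h\<close>.\<close>

definition rel :: "nat \<Rightarrow> nat \<Rightarrow> nat \<Rightarrow> nat \<times> 'm set \<Rightarrow> nat \<times> 'm set \<Rightarrow> bool"
  where "rel i j n a b \<longleftrightarrow> fst a = i \<and> fst b = j \<and> (\<exists>g\<in>snd a. \<exists>h\<in>snd b. iv g \<cdot> h \<in> W n)"

definition str :: "'o \<Rightarrow> nat \<Rightarrow> nat list \<Rightarrow> bool"
  where "str x = (\<lambda>q. \<lambda>xs\<in>{xs. length xs = 2}.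
    rel (fst (prod_decode q)) (fst (prod_decode (snd (prod_decode q))))
      (snd (prod_decode (snd (prod_decode q)))) (el x (xs ! 0)) (el x (xs ! 1)))"

lemma str_rcode [simp]: "str x (rcode i j n) [m, m'] \<longleftrightarrow> rel i j n (el x m) (el x m')"
  by (simp add: str_def rcode_def)

lemma str_topspace: "str x \<in> topspace (Mod_top bin_lang)"
  by (simp add: topspace_Mod_binary str_def)

lemma rel_act:
  assumes k: "k \<in> Mor G" and a: "a \<in> fib (src k)" and b: "b \<in> fib (src k)"
  shows "rel i j n (act k a) (act k b) \<longleftrightarrow> rel i j n a b"
proof -
  have "iv (k \<cdot> g) \<cdot> (k \<cdot> h) = iv g \<cdot> h" if "g \<in> snd a" "h \<in> snd b" for g h
    using fib_memD[OF a that(1)] fib_memD[OF b that(2)] k by (intro div_translate) auto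
  then show ?thesis by (auto simp: rel_def act_def)
qed

lemma rel_iff:
  assumes a: "a \<in> fib x" and b: "b \<in> fib x"
  shows "rel i j n a b \<longleftrightarrow> (\<exists>p p'. (\<forall>g\<in>W p. \<forall>h\<in>W p'. tgt g = tgt h \<longrightarrow> iv g \<cdot> h \<in> W n) \<and>
    meets a i p \<and> meets b j p')" (is "_ \<longleftrightarrow> ?r")
proof
  assume "rel i j n a b"
  then obtain g h where gh: "fst a = i" "fst b = j" "g \<in> snd a" "h \<in> snd b" "iv g \<cdot> h \<in> W n"
    by (auto simp: rel_def)
  note g' = fib_memD[OF a gh(3)] and h' = fib_memD[OF b gh(4)]
  obtain p p' where "g \<in> W p" "h \<in> W p'"
    "\<And>g h. g \<in> W p \<Longrightarrow> h \<in> W p' \<Longrightarrow> tgt g = tgt h \<Longrightarrow> iv g \<cdot> h \<in> W n"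
    using div_base[OF g'(1) h'(1) _ openin_W gh(5)] g'(2) h'(2) by metis
  then show ?r
    using gh by (intro exI[of _ p] exI[of _ p']) (auto simp: meets_def)
next
  assume ?r
  then obtain p p' where p: "\<forall>g\<in>W p. \<forall>h\<in>W p'. tgt g = tgt h \<longrightarrow> iv g \<cdot> h \<in> W n"
    "meets a i p" "meets b j p'" by blast
  then obtain g h where gh: "g \<in> snd a" "g \<in> W p" "h \<in> snd b" "h \<in> W p'" "fst a = i" "fst b = j"
    by (auto simp: meets_def)
  have "tgt g = tgt h" using fib_memD(2)[OF a gh(1)] fib_memD(2)[OF b gh(3)] by simp
  then show "rel i j n a b" using p(1) gh by (auto simp: rel_def)
qed

text \<open>In particular the index of a coset is part of the structure.\<close>

lemma rel_refl_iff: "a \<in> fib x \<Longrightarrow> (\<exists>n. rel i i n a a) \<longleftrightarrow> fst a = i"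
proof
  assume a: "a \<in> fib x" and "fst a = i"
  obtain h where h: "h \<in> snd a" using fib_nonempty[OF a] by blast
  note h' = fib_memD[OF a h]
  obtain n where "one (src h) \<in> W n" using W_ex[of "one (src h)"] h' by auto
  then have "iv h \<cdot> h \<in> W n" using h' by simp
  then show "\<exists>n. rel i i n a a" using h \<open>fst a = i\<close> by (auto simp: rel_def)
qed (auto simp: rel_def)

lemma pred_rel_el [measurable]: "Measurable.pred OB (\<lambda>x. rel i j n (el x m) (el x m'))"
proof -
  have "Measurable.pred OB (\<lambda>x. \<exists>p p'. (\<forall>g\<in>W p. \<forall>h\<in>W p'. tgt g = tgt h \<longrightarrow> iv g \<cdot> h \<in> W n) \<and>
      meets (el x m) i p \<and> meets (el x m') j p')" by measurable
  then show ?thesis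
    by (subst measurable_cong[OF rel_iff[OF el_fib el_fib]]) simp_all
qed

lemma measurable_str: "str \<in> measurable OB (borel_of (Mod_top bin_lang))"
proof (rule measurable_Mod_top)
  fix q :: nat and xs :: "nat list" assume "length xs = arity bin_lang q"
  then obtain a b where xs: "xs = [a, b]" by (auto simp: length2_iff)
  obtain i j n where "q = rcode i j n" using rcode_cases .
  then show "Measurable.pred OB (\<lambda>x. str x q xs)" by (simp add: xs)
qed (simp add: str_topspace)


section \<open>Morphisms as isomorphisms of structures\<close>

definition perm :: "'m \<Rightarrow> nat \<Rightarrow> nat"
  where "perm g m = inv_into UNIV (el (tgt g)) (act g (el (src g) m))"

lemma el_perm:
  assumes "g \<in> Mor G"
  shows "el (tgt g) (perm g m) = act g (el (src g) m)"
proof -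
  have "act g (el (src g) m) \<in> fib (tgt g)" using assms by (intro act_fib) auto
  then show ?thesis
    using bij_el[of "tgt g"] assms by (simp add: perm_def bij_betw_def f_inv_into_f)
qed

lemma perm_unique:
  assumes "g \<in> Mor G" "el (tgt g) m' = act g (el (src g) m)"
  shows "perm g m = m'"
  using assms el_perm by (intro el_inj[of "tgt g"]) auto

lemma perm_mul:
  assumes "g \<in> Mor G" "h \<in> Mor G" "src g = tgt h"
  shows "perm (g \<cdot> h) = perm g \<circ> perm h"
proof
  fix m
  have "el (tgt g) (perm g (perm h m)) = act g (act h (el (src h) m))"
    using assms el_perm[of g "perm h m"] el_perm[of h m] by simp
  also have "\<dots> = act (g \<cdot> h) (el (src h) m)"
    using assms by (intro act_mul[symmetric]) auto
  finally show "perm (g \<cdot> h) m = (perm g \<circ> perm h) m"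
    using assms by (intro perm_unique) auto
qed

lemma perm_one: "x \<in> Obj G \<Longrightarrow> perm (one x) = id"
  by (rule ext, rule perm_unique) (auto simp: act_one)

lemma perm_iv:
  assumes "g \<in> Mor G"
  shows "perm (iv g) \<circ> perm g = id" "perm g \<circ> perm (iv g) = id"
  using perm_mul[of "iv g" g] perm_mul[of g "iv g"] assms by (simp_all add: perm_one)

lemma bij_perm: "g \<in> Mor G \<Longrightarrow> bij (perm g)"
  using perm_iv o_bij by blast

lemma str_perm:
  assumes g: "g \<in> Mor G"
  shows "str (tgt g) q [perm g a, perm g b] \<longleftrightarrow> str (src g) q [a, b]"
proof -
  obtain i j n where "q = rcode i j n" using rcode_cases .
  then show ?thesis using g by (simp add: el_perm rel_act)
qed

lemma push_perm: "g \<in> Mor G \<Longrightarrow> push bin_lang (perm g) (str (src g)) = str (tgt g)"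
  by (intro push_eqI bij_perm str_topspace) (auto simp: str_perm)

lemma measurable_src [measurable]: "src \<in> measurable MB OB"
  unfolding borel_of_def[of "obj_top G"]
proof (rule measurable_measure_of)
  fix V assume "V \<in> {V. openin (obj_top G) V}"
  then have "openin (mor_top G) {g \<in> Mor G. src g \<in> V}" using openin_source_vimage by simp
  moreover have "src -` V \<inter> space MB = {g \<in> Mor G. src g \<in> V}" by auto
  ultimately show "src -` V \<inter> space MB \<in> sets MB" using openin_borel_of by metis
qed (auto dest: openin_Obj)

lemma measurable_tgt [measurable]: "tgt \<in> measurable MB OB"
  unfolding borel_of_def[of "obj_top G"]
proof (rule measurable_measure_of)
  fix V assume "V \<in> {V. openin (obj_top G) V}"
  then have "openin (mor_top G) {g \<in> Mor G. tgt g \<in> V}" using openin_target_vimage by simp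
  moreover have "tgt -` V \<inter> space MB = {g \<in> Mor G. tgt g \<in> V}" by auto
  ultimately show "tgt -` V \<inter> space MB \<in> sets MB" using openin_borel_of by metis
qed (auto dest: openin_Obj)

lemma pred_mor_open: "openin (mor_top G) V \<Longrightarrow> Measurable.pred MB (\<lambda>g. g \<in> V)"
proof -
  assume V: "openin (mor_top G) V"
  have "{g \<in> space MB. g \<in> V} = V" using openin_Mor[OF V] by auto
  then show "Measurable.pred MB (\<lambda>g. g \<in> V)" using openin_borel_of[OF V] by (simp add: pred_def)
qed

lemma pred_W [measurable]: "Measurable.pred MB (\<lambda>g. g \<in> W n)"
  by (rule pred_mor_open[OF openin_W])

text \<open>By continuity of multiplication, the image of a coset is determined by basic neighbourhoods of
  the morphism and of a member of the coset.\<close>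

lemma perm_iff:
  assumes g: "g \<in> Mor G"
  shows "perm g m = m' \<longleftrightarrow> (\<exists>n p q j. (valid j q \<and> (\<forall>a\<in>W n. \<forall>b\<in>W p. src a = tgt b \<longrightarrow> a \<cdot> b \<in> W q)) \<and>
    g \<in> W n \<and> meets (el (src g) m) j p \<and> meets (el (tgt g) m') j q)" (is "_ \<longleftrightarrow> ?r")
proof
  assume eq: "perm g m = m'"
  have fib: "el (src g) m \<in> fib (src g)" "el (tgt g) m' \<in> fib (tgt g)" using g by auto
  obtain w where w: "w \<in> snd (el (src g) m)" using fib_nonempty[OF fib(1)] by blast
  note w' = fib_memD[OF fib(1) w]
  have el: "el (tgt g) m' = act g (el (src g) m)" using el_perm[OF g] eq by blast
  have c: "g \<cdot> w \<in> snd (el (tgt g) m')" using act_mem[OF w] el by simp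
  let ?j = "fst (el (src g) m)"
  have j: "fst (el (tgt g) m') = ?j" using el by simp
  obtain q where q: "g \<cdot> w \<in> W q" "valid ?j q"
    using valid_ex[of "g \<cdot> w" ?j "Mor G"] w' g by (metis mul_closed openin_topspace topspace_mor)
  obtain n p where "g \<in> W n" "w \<in> W p" "\<And>a b. a \<in> W n \<Longrightarrow> b \<in> W p \<Longrightarrow> src a = tgt b \<Longrightarrow> a \<cdot> b \<in> W q"
    using mult_base[OF g w'(1) _ openin_W q(1)] w'(2) by metis
  then show ?r
    using q w c j
    by (intro exI[of _ n] exI[of _ p] exI[of _ q] exI[of _ ?j]) (auto simp: meets_def)
next
  assume ?r
  then obtain n p q j where h: "valid j q" "\<forall>a\<in>W n. \<forall>b\<in>W p. src a = tgt b \<longrightarrow> a \<cdot> b \<in> W q"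
    "g \<in> W n" "meets (el (src g) m) j p" "meets (el (tgt g) m') j q" by blast
  have fib: "el (src g) m \<in> fib (src g)" "el (tgt g) m' \<in> fib (tgt g)" using g by auto
  obtain w where w: "w \<in> snd (el (src g) m)" "w \<in> W p" "fst (el (src g) m) = j"
    using h(4) by (auto simp: meets_def)
  have "g \<cdot> w \<in> W q" using h w fib_memD[OF fib(1) w(1)] by auto
  then have "meets (act g (el (src g) m)) j q"
    using act_mem[OF w(1)] w(3) by (auto simp: meets_def)
  then have "el (tgt g) m' = act g (el (src g) m)"
    using valid_eq[OF fib(2) act_fib[OF g fib(1)] h(1,5)] by simp
  then show "perm g m = m'" by (rule perm_unique[OF g])
qed

lemma measurable_perm [measurable]: "(\<lambda>g. perm g m) \<in> measurable MB (count_space UNIV)"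
proof -
  have "Measurable.pred MB (\<lambda>g. perm g m = m')" for m'
  proof -
    have [measurable]: "Measurable.pred MB (\<lambda>g. meets (el (src g) m) j p)"
      "Measurable.pred MB (\<lambda>g. meets (el (tgt g) m) j p)" for m j p
      by (rule measurable_compose[OF measurable_src pred_meets_el],
        rule measurable_compose[OF measurable_tgt pred_meets_el])
    have "Measurable.pred MB (\<lambda>g. \<exists>n p q j. (valid j q \<and>
        (\<forall>a\<in>W n. \<forall>b\<in>W p. src a = tgt b \<longrightarrow> a \<cdot> b \<in> W q)) \<and>
      g \<in> W n \<and> meets (el (src g) m) j p \<and> meets (el (tgt g) m') j q)"
      by measurable
    then show ?thesis by (subst measurable_cong[OF perm_iff]) simp_all
  qed
  then show ?thesis
    by (subst measurable_count_space_eq2_countable) (auto simp: pred_def vimage_def Int_def conj_commute)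
qed

lemma measurable_perm_S_inf: "perm \<in> measurable MB (borel_of S_inf_top)"
  by (rule measurable_S_inf) (auto intro: bij_perm)


subsection \<open>A morphism is determined by its action, in a Borel way\<close>

text \<open>If a member \<open>u\<close> of \<open>U i\<close> lies in a coset of index \<open>i\<close>, then so does \<open>u \<cdot> u\<^sup>-\<^sup>1\<close>, the unit at \<open>x\<close>.\<close>

lemma one_mem_el_iff:
  assumes a: "a \<in> fib x" and x: "x \<in> Obj G"
  shows "fst a = i \<and> one x \<in> snd a \<longleftrightarrow> (\<exists>q. W q \<subseteq> U i \<and> meets a i q)"
proof
  assume h: "fst a = i \<and> one x \<in> snd a"
  then have "one x \<in> U i" using fib_memD(3)[OF a, of "one x"] x by simp
  then obtain q where "one x \<in> W q" "W q \<subseteq> U i" using W_base[OF openin_U] by blast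
  then show "\<exists>q. W q \<subseteq> U i \<and> meets a i q" using h by (auto simp: meets_def)
next
  assume "\<exists>q. W q \<subseteq> U i \<and> meets a i q"
  then obtain u where u: "fst a = i" "u \<in> snd a" "u \<in> U i" by (auto simp: meets_def)
  note u' = fib_memD[OF a u(2)]
  have "iv u \<cdot> one x \<in> U i" using u' U_iv[OF u(3)] by simp
  then show "fst a = i \<and> one x \<in> snd a"
    using fib_mem_iff[OF a u(2)] u x by auto
qed

text \<open>The image of the coset \<open>1 U\<close> under \<open>k\<close> is \<open>k U\<close>, and these sets shrink to \<open>k\<close>. Hence the action on cosets
  determines the open sets containing \<open>k\<close>, which gives faithfulness as well as the measurability of
  morphisms that are only known through their actions.\<close>

lemma act_mem_open_iff:
  assumes k: "k \<in> Mor G" and V: "openin (mor_top G) V"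
    and th: "\<And>m. el (tgt k) (\<theta> m) = act k (el (src k) m)"
  shows "k \<in> V \<longleftrightarrow> (\<exists>m i p q. ((\<forall>a\<in>W p. \<forall>u\<in>U i. src a = tgt u \<longrightarrow> a \<cdot> u \<in> V) \<and> W q \<subseteq> U i) \<and>
    meets (el (src k) m) i q \<and> meets (el (tgt k) (\<theta> m)) i p)" (is "_ \<longleftrightarrow> ?r")
proof
  assume "k \<in> V"
  then obtain i p where i: "one (src k) \<in> U i" "k \<in> W p"
    "\<And>u w. u \<in> U i \<Longrightarrow> w \<in> W p \<Longrightarrow> src w = tgt u \<Longrightarrow> w \<cdot> u \<in> V"
    by (rule right_U_base[OF V]) (rule that)
  have "(i, coset i (one (src k))) \<in> fib (src k)" using i k by (intro fibI) auto
  then obtain m where m: "el (src k) m = (i, coset i (one (src k)))"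
    using el_ex[of "src k"] k by auto
  have one: "one (src k) \<in> snd (el (src k) m)" using m i k coset_self by auto
  then obtain q where q: "W q \<subseteq> U i" "meets (el (src k) m) i q"
    using one_mem_el_iff[OF el_fib[of "src k" m], of i] k m by auto
  have "k \<cdot> one (src k) \<in> snd (el (tgt k) (\<theta> m))" unfolding th using one by (rule act_mem)
  then have "meets (el (tgt k) (\<theta> m)) i p" using k i m th by (auto simp: meets_def)
  then show ?r
    using i(3) q by (intro exI[of _ m] exI[of _ i] exI[of _ p] exI[of _ q]) simp
next
  assume ?r
  then obtain m i p q where h: "\<forall>a\<in>W p. \<forall>u\<in>U i. src a = tgt u \<longrightarrow> a \<cdot> u \<in> V" "W q \<subseteq> U i"
    "meets (el (src k) m) i q" "meets (el (tgt k) (\<theta> m)) i p" by blast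
  have one: "fst (el (src k) m) = i" "one (src k) \<in> snd (el (src k) m)"
    using one_mem_el_iff[OF el_fib[of "src k" m], of i] k h by auto
  have fib: "el (tgt k) (\<theta> m) \<in> fib (tgt k)" using k by simp
  have "k \<cdot> one (src k) \<in> snd (el (tgt k) (\<theta> m))" unfolding th using one(2) by (rule act_mem)
  then have km: "k \<in> snd (el (tgt k) (\<theta> m))" using k by simp
  obtain w where w: "w \<in> W p" "w \<in> snd (el (tgt k) (\<theta> m))" using h(4) by (auto simp: meets_def)
  note w' = fib_memD[OF fib w(2)]
  have "iv w \<cdot> k \<in> U i" using fib_mem_iff[OF fib w(2), of k] km th one by simp
  from h(1)[rule_format, OF w(1) this] have "w \<cdot> (iv w \<cdot> k) \<in> V" using w' k by simp
  then show "k \<in> V" using w' k by simp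
qed

text \<open>The form in which \<open>act_mem_open_iff\<close> is applied: a family of morphisms is measurable as soon as its
  sources, targets and actions are.\<close>

lemma measurable_lift:
  assumes a: "a \<in> measurable N OB" and b: "b \<in> measurable N OB"
    and th: "\<And>m. (\<lambda>w. \<theta> w m) \<in> measurable N (count_space UNIV)"
    and k: "\<And>w. w \<in> space N \<Longrightarrow> k w \<in> Mor G \<and> src (k w) = a w \<and> tgt (k w) = b w"
    and eq: "\<And>w m. w \<in> space N \<Longrightarrow> el (b w) (\<theta> w m) = act (k w) (el (a w) m)"
  shows "k \<in> measurable N MB"
  unfolding borel_of_def[of "mor_top G"]
proof (rule measurable_measure_of)
  fix V assume "V \<in> {V. openin (mor_top G) V}"
  then have V: "openin (mor_top G) V" by simp
  have [measurable]: "Measurable.pred N (\<lambda>w. meets (el (a w) m) i q)" for m i q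
    by (rule measurable_compose[OF a pred_meets_el])
  have bm: "Measurable.pred N (\<lambda>w. meets (el (b w) m) i q)" for m i q
    by (rule measurable_compose[OF b pred_meets_el])
  have [measurable]: "Measurable.pred N (\<lambda>w. meets (el (b w) (\<theta> w m)) i q)" for m i q
    by (rule measurable_compose_countable[OF bm th])
  have pQ: "Measurable.pred N (\<lambda>w. \<exists>m i p q.
    ((\<forall>a\<in>W p. \<forall>u\<in>U i. src a = tgt u \<longrightarrow> a \<cdot> u \<in> V) \<and> W q \<subseteq> U i) \<and>
    meets (el (a w) m) i q \<and> meets (el (b w) (\<theta> w m)) i p)"
    by measurable
  have keq: "k w \<in> V \<longleftrightarrow> (\<exists>m i p q.
    ((\<forall>a\<in>W p. \<forall>u\<in>U i. src a = tgt u \<longrightarrow> a \<cdot> u \<in> V) \<and> W q \<subseteq> U i) \<and>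
    meets (el (a w) m) i q \<and> meets (el (b w) (\<theta> w m)) i p)" if w: "w \<in> space N" for w
    using act_mem_open_iff[OF _ V, of "k w" "\<theta> w"] k[OF w] eq[OF w] by simp
  have "Measurable.pred N (\<lambda>w. k w \<in> V)"
    by (rule measurable_cong[THEN iffD2, OF keq pQ])
  moreover have "k -` V \<inter> space N = {w \<in> space N. k w \<in> V}" by auto
  ultimately show "k -` V \<inter> space N \<in> sets N" by (simp add: pred_def)
qed (use k in \<open>auto dest: openin_Mor\<close>)

lemma perm_faithful:
  assumes k: "k \<in> Mor G" and l: "l \<in> Mor G" and "src k = src l" "tgt k = tgt l" "perm k = perm l"
  shows "k = l"
proof (rule mor_separated[OF k l])
  fix V assume V: "openin (mor_top G) V"
  have "el (tgt k) (perm k m) = act k (el (src k) m)" "el (tgt l) (perm k m) = act l (el (src l) m)" for m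
    using el_perm[OF k, of m] el_perm[OF l, of m] assms(5) by simp_all
  from act_mem_open_iff[OF k V, of "perm k"] act_mem_open_iff[OF l V, of "perm k"] this assms
  show "k \<in> V \<longleftrightarrow> l \<in> V" by simp
qed


section \<open>Descending sequences of cosets\<close>

text \<open>Inclusion of cosets, both of the sets and of the subgroupoids, as a relation that can be read off from the
  structure alone (see \<open>below_str_iff\<close>).\<close>

definition below :: "nat struct \<Rightarrow> nat \<Rightarrow> nat \<Rightarrow> bool"
  where "below M b a \<longleftrightarrow> (\<exists>i j n. (U i \<subseteq> U j \<and> W n \<subseteq> U j) \<and> M (rcode i j n) [b, a])"

text \<open>The values are positions in \<open>e\<close> rather than members of the structure, so that they depend only on
  which atomic statements about \<open>e\<close> hold.\<close>

primrec chain :: "nat struct \<Rightarrow> (nat \<Rightarrow> nat) \<Rightarrow> nat \<Rightarrow> nat"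
  where
    "chain M e 0 = 0"
  | "chain M e (Suc k) = (if below M (e (Suc k)) (e (chain M e k)) then Suc k else chain M e k)"

lemma below_str_iff:
  assumes x: "x \<in> Obj G"
  shows "below (str x) b a \<longleftrightarrow> U (fst (el x b)) \<subseteq> U (fst (el x a)) \<and> snd (el x b) \<subseteq> snd (el x a)"
proof -
  have fb: "el x b \<in> fib x" and fa: "el x a \<in> fib x" using x by auto
  show ?thesis
  proof
    assume "below (str x) b a"
    then obtain i j n where n: "U i \<subseteq> U j" "W n \<subseteq> U j" "rel i j n (el x b) (el x a)"
      by (auto simp: below_def)
    then obtain g h where gh: "g \<in> snd (el x b)" "h \<in> snd (el x a)" "iv g \<cdot> h \<in> U j"
      "fst (el x b) = i" "fst (el x a) = j" by (auto simp: rel_def)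
    note g' = fib_memD[OF fb gh(1)] and h' = fib_memD[OF fa gh(2)]
    have hg: "iv h \<cdot> g \<in> U j" using U_iv[OF gh(3)] g' h' by (simp add: iv_div)
    have "k \<in> snd (el x a)" if k: "k \<in> snd (el x b)" for k
    proof -
      note k' = fib_memD[OF fb k]
      have "iv g \<cdot> k \<in> U j" using k fib_mem_iff[OF fb gh(1)] gh n by auto
      then have "(iv h \<cdot> g) \<cdot> (iv g \<cdot> k) \<in> U j" using hg g' h' k' by (rule_tac U_mul) auto
      then have "iv h \<cdot> k \<in> U j" using g' h' k' by (simp add: div_mul_div)
      then show ?thesis using fib_mem_iff[OF fa gh(2)] gh k' by auto
    qed
    then show "U (fst (el x b)) \<subseteq> U (fst (el x a)) \<and> snd (el x b) \<subseteq> snd (el x a)"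
      using n gh by auto
  next
    assume sub: "U (fst (el x b)) \<subseteq> U (fst (el x a)) \<and> snd (el x b) \<subseteq> snd (el x a)"
    obtain g where g: "g \<in> snd (el x b)" using fib_nonempty[OF fb] by blast
    then have ga: "g \<in> snd (el x a)" using sub by auto
    note g' = fib_memD[OF fa ga]
    obtain n where "one (src g) \<in> W n" "W n \<subseteq> U (fst (el x a))" using W_base[OF openin_U g'(3)] by blast
    then have "rel (fst (el x b)) (fst (el x a)) n (el x b) (el x a)"
      using g ga g' by (auto simp: rel_def intro!: bexI[of _ g])
    then show "below (str x) b a"
      using sub \<open>W n \<subseteq> U (fst (el x a))\<close> unfolding below_def str_rcode by blast
  qed
qed

lemma chain_le: "chain M e k \<le> k"
  by (induction k) auto

lemma chain_cong: "(\<And>i. i \<le> k \<Longrightarrow> e i = e' i) \<Longrightarrow> chain M e k = chain M e' k"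
proof (induction k)
  case (Suc k)
  then have "chain M e k = chain M e' k" by simp
  moreover have "e (chain M e k) = e' (chain M e k)" using Suc.prems chain_le[of M e k] by simp
  ultimately show ?case using Suc.prems by simp
qed simp

lemma chain_decreasing:
  assumes x: "x \<in> Obj G" and "k \<le> l"
  shows "snd (el x (e (chain (str x) e l))) \<subseteq> snd (el x (e (chain (str x) e k)))"
  using assms(2)
proof (induction rule: dec_induct)
  case (step n)
  have "snd (el x (e (chain (str x) e (Suc n)))) \<subseteq> snd (el x (e (chain (str x) e n)))"
    using below_str_iff[OF x] by simp
  then show ?case using step by blast
qed simp

text \<open>The finite sequences whose chain ends in \<open>D\<close>. This transfers density with respect to \<open>below\<close> to
  density in the tree of finite sequences.\<close>

definition tails :: "nat struct \<Rightarrow> nat set \<Rightarrow> nat list set"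
  where "tails M D = {s. s \<noteq> [] \<and> s ! chain M ((!) s) (length s - 1) \<in> D}"

lemma tails_dense:
  assumes "\<And>m. \<exists>m'\<in>D. below M m' m"
  shows "\<exists>t. s @ t \<in> tails M D"
proof -
  \<comment> \<open>The appended entry gives the chain a starting point in case that \<open>s\<close> is empty.\<close>
  define s' where "s' = s @ [0]"
  let ?m = "s' ! chain M ((!) s') (length s)"
  obtain m' where m': "m' \<in> D" "below M m' ?m" using assms by blast
  have cl: "chain M ((!) s') (length s) < length s'"
    using chain_le[of M "(!) s'" "length s"] by (simp add: s'_def)
  have c: "chain M ((!) (s' @ [m'])) (length s) = chain M ((!) s') (length s)"
    by (rule chain_cong) (auto simp: s'_def nth_append)
  have last: "(s' @ [m']) ! Suc (length s) = m'" by (simp add: s'_def nth_append)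
  have "chain M ((!) (s' @ [m'])) (Suc (length s)) = Suc (length s)"
    using m'(2) cl by (simp add: c last nth_append[of s' "[m']" "chain M ((!) s') (length s)"])
  then have "s' @ [m'] \<in> tails M D" using m'(1) last by (simp add: tails_def s'_def)
  then show ?thesis by (auto simp: s'_def)
qed

lemma tails_chain:
  assumes "map e [0..<n] \<in> tails M D"
  shows "\<exists>k. e (chain M e k) \<in> D"
proof -
  have n: "n > 0" "map e [0..<n] ! chain M ((!) (map e [0..<n])) (n - 1) \<in> D"
    using assms by (auto simp: tails_def)
  have "chain M ((!) (map e [0..<n])) (n - 1) = chain M e (n - 1)"
    using n by (intro chain_cong) auto
  moreover have "chain M e (n - 1) < n" using n chain_le[of M e "n - 1"] by simp
  ultimately show ?thesis using n by (intro exI[of _ "n - 1"]) simp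
qed


section \<open>Convergence\<close>

definition converges :: "'o \<Rightarrow> (nat \<Rightarrow> nat) \<Rightarrow> 'm \<Rightarrow> bool"
  where "converges x e g \<longleftrightarrow> g \<in> Mor G \<and> tgt g = x \<and>
    (\<forall>k. g \<in> snd (el x (e (chain (str x) e k)))) \<and>
    (\<forall>i. one (src g) \<in> U i \<longrightarrow> (\<exists>k. U (fst (el x (e (chain (str x) e k)))) \<subseteq> U i))"

abbreviation "mbox \<equiv> subbox (mor_top G) BM"

text \<open>The cosets that are disjoint from \<open>A\<close> or refine the cover \<open>\<C>\<close> of \<open>A\<close>. If a generic chain is
  eventually inside of \<open>A\<close>, it is therefore eventually inside of some member of \<open>\<C>\<close>.\<close>

definition cover_set :: "'o \<Rightarrow> 'm set \<Rightarrow> 'm set set \<Rightarrow> nat set"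
  where "cover_set x A \<C> = {m. snd (el x m) \<inter> A = {} \<or> (\<exists>C\<in>\<C>. snd (el x m) \<subseteq> C)}"

definition type_set :: "'o \<Rightarrow> nat \<Rightarrow> nat set"
  where "type_set x i = {m. U (fst (el x m)) \<subseteq> U i \<or> (\<forall>h\<in>snd (el x m). one (src h) \<notin> U i)}"

definition inside :: "'o \<Rightarrow> 'm set \<Rightarrow> 'm set set"
  where "inside x A = {mbox u | u. finite u \<and> (\<forall>h\<in>mbox u. tgt h = x \<longrightarrow> h \<in> A)}"

definition over :: "nat \<Rightarrow> 'm set"
  where "over n = {h \<in> Mor G. tgt h \<in> BO n}"

text \<open>The first family makes the filter generated by the chain obey the rules of the space of morphisms, so that it has a
  limit. The second makes the limit a member of all cosets of the chain, the third gives it the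
  right target, and the last makes the subgroupoids shrink to the unit at its source.\<close>

definition dense_sets :: "'o \<Rightarrow> nat set set"
  where "dense_sets x = (\<lambda>r. cover_set x (mbox (fst r)) (mbox ` snd r)) ` RM \<union>
    range (\<lambda>m. cover_set x (snd (el x m)) (inside x (snd (el x m)))) \<union>
    range (\<lambda>n. cover_set x (over n) {mbox u | u. finite u \<and> mbox u \<subseteq> over n}) \<union>
    range (type_set x)"

lemma RM_finite: "r \<in> RM \<Longrightarrow> finite (fst r)" "r \<in> RM \<Longrightarrow> t \<in> snd r \<Longrightarrow> finite t"
  using presented_mor by (auto simp: presented_def)

lemma subbase_BM: "subbase (mor_top G) BM"
  using presented_mor by (simp add: presented_def)

lemma subbase_BO: "subbase (obj_top G) BO"
  using presented_obj by (simp add: presented_def)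

lemma countable_dense_sets: "countable (dense_sets x)"
  using presented_mor by (auto simp: dense_sets_def presented_def)

lemma RM_covers:
  assumes r: "r \<in> RM" and g: "g \<in> mbox (fst r)"
  shows "\<exists>t\<in>snd r. g \<in> mbox t"
proof -
  have gM: "g \<in> Mor G" using g by (simp add: subbox_def)
  have "\<exists>x\<in>Mor G. \<forall>n. x \<in> BM n \<longleftrightarrow> g \<in> BM n" using gM by blast
  then have "\<forall>r\<in>RM. rule_holds r (\<lambda>n. g \<in> BM n)"
    using presented_points[OF presented_mor, of "\<lambda>n. g \<in> BM n"] unfolding topspace_mor by simp
  then have "rule_holds r (\<lambda>n. g \<in> BM n)" using r by blast
  then show ?thesis using g gM by (auto simp: rule_holds_def subbox_def)
qed

lemma cover_set_dense:
  assumes x: "x \<in> Obj G" and op: "\<And>C. C \<in> \<C> \<Longrightarrow> openin (mor_top G) C"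
    and cov: "\<And>h. h \<in> A \<Longrightarrow> h \<in> Mor G \<Longrightarrow> tgt h = x \<Longrightarrow> \<exists>C\<in>\<C>. h \<in> C"
  shows "\<exists>m'\<in>cover_set x A \<C>. below (str x) m' m"
proof (cases "snd (el x m) \<inter> A = {}")
  case True
  then have "m \<in> cover_set x A \<C>" by (simp add: cover_set_def)
  moreover have "below (str x) m m" using below_str_iff[OF x] by simp
  ultimately show ?thesis by blast
next
  case False
  then obtain h where h: "h \<in> snd (el x m)" "h \<in> A" by blast
  note h' = fib_memD[OF el_fib[OF x] h(1)]
  obtain C where C: "C \<in> \<C>" "h \<in> C" using cov[OF h(2) h'(1,2)] by blast
  obtain b where b: "b \<in> fib x" "snd b \<subseteq> snd (el x m)" "snd b \<subseteq> C" "U (fst b) \<subseteq> U (fst (el x m))"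
    by (rule small_coset[OF el_fib[OF x] h(1) op[OF C(1)] C(2) openin_U h'(3)]) blast
  obtain m' where m': "el x m' = b" using el_ex[OF x b(1)] by blast
  have "m' \<in> cover_set x A \<C>" using m' b C by (auto simp: cover_set_def)
  moreover have "below (str x) m' m" using m' b by (simp add: below_str_iff[OF x])
  ultimately show ?thesis by blast
qed

lemma type_set_dense:
  assumes x: "x \<in> Obj G"
  shows "\<exists>m'\<in>type_set x i. below (str x) m' m"
proof (cases "m \<in> type_set x i")
  case True
  then show ?thesis using below_str_iff[OF x] by blast
next
  case False
  then obtain h where h: "h \<in> snd (el x m)" "one (src h) \<in> U i" by (auto simp: type_set_def)
  note h' = fib_memD[OF el_fib[OF x] h(1)]
  have op: "openin (mor_top G) (Mor G)" by (metis openin_topspace topspace_mor)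
  obtain b where b: "b \<in> fib x" "snd b \<subseteq> snd (el x m)" "U (fst b) \<subseteq> U (fst (el x m))" "U (fst b) \<subseteq> U i"
    by (rule small_coset[OF el_fib[OF x] h(1) op h'(1) openin_U h(2)]) blast
  obtain m' where m': "el x m' = b" using el_ex[OF x b(1)] by blast
  have "m' \<in> type_set x i" using m' b by (auto simp: type_set_def)
  moreover have "below (str x) m' m" using m' b by (simp add: below_str_iff[OF x])
  ultimately show ?thesis by blast
qed

lemma inside_covers:
  assumes x: "x \<in> Obj G" and a: "a \<in> fib x" and h: "h \<in> snd a"
  shows "\<exists>C\<in>inside x (snd a). h \<in> C"
proof -
  obtain n where n: "h \<in> W n" "\<And>h'. h' \<in> W n \<Longrightarrow> tgt h' = x \<Longrightarrow> h' \<in> snd a"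
    using fib_open[OF a h] by blast
  from subbaseE[OF subbase_BM openin_W n(1)] obtain u where
    u: "finite u" "h \<in> mbox u" "mbox u \<subseteq> W n" .
  then have "mbox u \<in> inside x (snd a)" using n(2) unfolding inside_def by blast
  then show ?thesis using u by blast
qed

lemma dense_sets_dense:
  assumes x: "x \<in> Obj G" and D: "D \<in> dense_sets x"
  shows "\<exists>m'\<in>D. below (str x) m' m"
proof -
  consider r where "r \<in> RM" "D = cover_set x (mbox (fst r)) (mbox ` snd r)"
    | l where "D = cover_set x (snd (el x l)) (inside x (snd (el x l)))"
    | n where "D = cover_set x (over n) {mbox u | u. finite u \<and> mbox u \<subseteq> over n}"
    | i where "D = type_set x i"
    using D unfolding dense_sets_def by blast
  then show ?thesis
  proof cases
    case 1
    show ?thesis unfolding 1(2)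
    proof (rule cover_set_dense[OF x])
      show "openin (mor_top G) C" if "C \<in> mbox ` snd r" for C
        using that RM_finite(2)[OF 1(1)] openin_subbox[OF subbase_BM] by auto
      show "\<exists>C\<in>mbox ` snd r. h \<in> C" if "h \<in> mbox (fst r)" for h
        using RM_covers[OF 1(1) that] by blast
    qed
  next
    case 2
    show ?thesis unfolding 2
    proof (rule cover_set_dense[OF x])
      show "openin (mor_top G) C" if "C \<in> inside x (snd (el x l))" for C
        using that openin_subbox[OF subbase_BM] by (auto simp: inside_def)
      show "\<exists>C\<in>inside x (snd (el x l)). h \<in> C" if "h \<in> snd (el x l)" for h
        using inside_covers[OF x el_fib[OF x] that] .
    qed
  next
    case (3 n)
    show ?thesis unfolding 3
    proof (rule cover_set_dense[OF x])
      show "openin (mor_top G) C" if "C \<in> {mbox u | u. finite u \<and> mbox u \<subseteq> over n}" for C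
        using that openin_subbox[OF subbase_BM] by auto
      have op: "openin (mor_top G) (over n)"
        unfolding over_def by (rule openin_target_vimage[OF subbase_openin[OF subbase_BO]])
      show "\<exists>C\<in>{mbox u | u. finite u \<and> mbox u \<subseteq> over n}. h \<in> C" if h: "h \<in> over n" for h
      proof -
        from subbaseE[OF subbase_BM op h] obtain u where
          "finite u" "h \<in> mbox u" "mbox u \<subseteq> over n" .
        then show ?thesis by blast
      qed
    qed
  next
    case 4
    then show ?thesis using type_set_dense[OF x] by blast
  qed
qed

text \<open>The limit is the point of the space of morphisms whose basic neighbourhoods are those that contain
  a coset of the chain; the rules hold for this assignment by genericity.\<close>

lemma converges_ex:
  assumes x: "x \<in> Obj G" and e: "\<And>D. D \<in> dense_sets x \<Longrightarrow> \<exists>k. e (chain (str x) e k) \<in> D"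
  shows "\<exists>g. converges x e g"
proof -
  define a where "a k = el x (e (chain (str x) e k))" for k
  have fib: "a k \<in> fib x" for k using x by (simp add: a_def)
  have dec: "snd (a l) \<subseteq> snd (a k)" if "k \<le> l" for k l
    unfolding a_def by (rule chain_decreasing[OF x that])
  have ne: "snd (a k) \<noteq> {}" for k using fib_nonempty[OF fib] by blast
  have cover: "\<exists>k. \<exists>C\<in>\<C>. snd (a k) \<subseteq> C"
    if "cover_set x A \<C> \<in> dense_sets x" "snd (a l) \<subseteq> A" for A \<C> l
  proof -
    from e[OF that(1)] obtain k where k: "e (chain (str x) e k) \<in> cover_set x A \<C>" by blast
    have "snd (a k) \<inter> A \<noteq> {}"
      using dec[of k "max k l"] dec[of l "max k l"] ne[of "max k l"] that(2) by fastforce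
    then show ?thesis using k by (auto simp: cover_set_def a_def)
  qed
  define p where "p n \<longleftrightarrow> (\<exists>k. snd (a k) \<subseteq> BM n)" for n
  have pbox: "\<exists>k. snd (a k) \<subseteq> mbox u" if "finite u" "\<forall>n\<in>u. p n" for u
    using that
  proof (induction u)
    case empty
    have "snd (a 0) \<subseteq> mbox {}" using fib_memD(1)[OF fib] by (auto simp: subbox_def)
    then show ?case by blast
  next
    case (insert n u)
    then obtain k l where kl: "snd (a k) \<subseteq> mbox u" "snd (a l) \<subseteq> BM n" by (auto simp: p_def)
    have "snd (a (max k l)) \<subseteq> snd (a k)" "snd (a (max k l)) \<subseteq> snd (a l)" by (simp_all add: dec)
    then have "snd (a (max k l)) \<subseteq> mbox (insert n u)" using kl by (auto simp: subbox_def)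
    then show ?case by blast
  qed
  have "rule_holds r p" if r: "r \<in> RM" for r
    unfolding rule_holds_def
  proof
    assume "\<forall>n\<in>fst r. p n"
    then obtain l where l: "snd (a l) \<subseteq> mbox (fst r)" using pbox RM_finite(1)[OF r] by blast
    have "cover_set x (mbox (fst r)) (mbox ` snd r) \<in> dense_sets x"
      using r by (auto simp: dense_sets_def)
    from cover[OF this l] obtain k t where "t \<in> snd r" "snd (a k) \<subseteq> mbox t" by blast
    then show "\<exists>t\<in>snd r. \<forall>n\<in>t. p n" by (intro bexI[of _ t]) (auto simp: p_def subbox_def)
  qed
  then have "\<exists>g\<in>Mor G. \<forall>n. g \<in> BM n \<longleftrightarrow> p n"
    using presented_points[OF presented_mor, of p] unfolding topspace_mor by simp
  then obtain g where g: "g \<in> Mor G" "\<And>n. g \<in> BM n \<longleftrightarrow> p n" by blast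
  have open_sub: "\<exists>k. snd (a k) \<subseteq> V" if V: "openin (mor_top G) V" "g \<in> V" for V
  proof -
    from subbaseE[OF subbase_BM V] obtain u where u: "finite u" "g \<in> mbox u" "mbox u \<subseteq> V" .
    then have "\<forall>n\<in>u. p n" using g by (auto simp: subbox_def)
    then show ?thesis using pbox[OF u(1)] u(3) by blast
  qed
  have box_mem: "g \<in> mbox u" if "snd (a k) \<subseteq> mbox u" for k u
  proof -
    have "snd (a k) \<subseteq> BM n" if "n \<in> u" for n
      using that \<open>snd (a k) \<subseteq> mbox u\<close> by (auto simp: subbox_def)
    then show ?thesis using g by (auto simp: subbox_def p_def)
  qed
  have tgt: "tgt g = x"
  proof -
    have "tgt g \<in> BO n \<longleftrightarrow> x \<in> BO n" for n
    proof
      assume "tgt g \<in> BO n"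
      then obtain k where "snd (a k) \<subseteq> {h \<in> Mor G. tgt h \<in> BO n}"
        using open_sub[OF openin_target_vimage[OF subbase_openin[OF subbase_BO]]] g by blast
      then show "x \<in> BO n" using ne[of k] fib_memD(2)[OF fib[of k]] by blast
    next
      assume "x \<in> BO n"
      then have l: "snd (a 0) \<subseteq> over n" using fib_memD(1,2)[OF fib] by (auto simp: over_def)
      have "cover_set x (over n) {mbox u | u. finite u \<and> mbox u \<subseteq> over n} \<in> dense_sets x"
        by (auto simp: dense_sets_def)
      from cover[OF this l] obtain k u where "mbox u \<subseteq> over n" "snd (a k) \<subseteq> mbox u" by blast
      then show "tgt g \<in> BO n" using box_mem by (auto simp: over_def)
    qed
    then show ?thesis
      using g x by (intro presented_eqI[OF presented_obj]) auto
  qed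
  have mem: "g \<in> snd (a l)" for l
  proof -
    have "cover_set x (snd (a l)) (inside x (snd (a l))) \<in> dense_sets x"
      by (auto simp: dense_sets_def a_def)
    from cover[OF this subset_refl] obtain k u where
      "\<forall>h\<in>mbox u. tgt h = x \<longrightarrow> h \<in> snd (a l)" "snd (a k) \<subseteq> mbox u"
      unfolding inside_def by blast
    then show ?thesis using box_mem tgt by blast
  qed
  have "\<exists>k. U (fst (a k)) \<subseteq> U i" if i: "one (src g) \<in> U i" for i
  proof -
    have "type_set x i \<in> dense_sets x" by (simp add: dense_sets_def)
    from e[OF this] obtain k where "e (chain (str x) e k) \<in> type_set x i" by blast
    then show ?thesis using mem[of k] i by (auto simp: type_set_def a_def)
  qed
  then have "converges x e g" using g tgt mem by (simp add: converges_def a_def)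
  then show ?thesis by blast
qed

lemma fst_chain_base:
  assumes "converges x e g"
  shows "one (src g) \<in> U (fst (el x (e (chain (str x) e k))))"
proof -
  have x: "x \<in> Obj G" using assms by (auto simp: converges_def)
  show ?thesis
    using fib_memD(3)[OF el_fib[OF x], of g "e (chain (str x) e k)"] assms by (auto simp: converges_def)
qed


section \<open>Reading off the limit from the structure\<close>

text \<open>When \<open>e\<close> converges to \<open>g\<close>, the subgroupoids along the chain are a base at the unit of \<open>src g\<close>, and
  their objects single out \<open>src g\<close>.\<close>

definition base_seq :: "nat struct \<Rightarrow> (nat \<Rightarrow> nat) \<Rightarrow> nat \<Rightarrow> bool"
  where "base_seq M e n \<longleftrightarrow> (\<exists>k i r. {x \<in> Obj G. one x \<in> U i} \<subseteq> BO n \<and>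
    M (rcode i i r) [e (chain M e k), e (chain M e k)])"

text \<open>When \<open>e\<close> converges to \<open>g\<close>, these are the indices of the basic sets that the coset \<open>g\<^sup>-\<^sup>1 b\<close> meets, for the member
  \<open>b\<close> at position \<open>l\<close> (see \<open>nbhd_set_str\<close>). The first condition allows the error made in replacing
  \<open>g\<close> by another member of its coset in the chain.\<close>

definition nbhd_set :: "nat struct \<Rightarrow> (nat \<Rightarrow> nat) \<Rightarrow> nat \<Rightarrow> nat \<Rightarrow> nat \<Rightarrow> bool"
  where "nbhd_set M e l j n \<longleftrightarrow> (\<exists>k i n'. (\<forall>u\<in>U i. \<forall>w\<in>W n'. src u = tgt w \<longrightarrow> u \<cdot> w \<in> W n) \<and>
    M (rcode i j n') [e (chain M e k), e l])"

lemma base_seq_str: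
  assumes c: "converges x e g"
  shows "base_seq (str x) e n \<longleftrightarrow> src g \<in> BO n"
proof
  have g: "g \<in> Mor G" "tgt g = x" using c by (auto simp: converges_def)
  then have x: "x \<in> Obj G" by auto
  {
    assume "base_seq (str x) e n"
    then obtain k i r where k: "{x \<in> Obj G. one x \<in> U i} \<subseteq> BO n"
      "rel i i r (el x (e (chain (str x) e k))) (el x (e (chain (str x) e k)))"
      by (auto simp: base_seq_def)
    then have "fst (el x (e (chain (str x) e k))) = i" by (simp add: rel_def)
    then show "src g \<in> BO n" using fst_chain_base[OF c, of k] k(1) g by auto
  next
    assume n: "src g \<in> BO n"
    have "openin (mor_top G) {h \<in> Mor G. src h \<in> BO n}"
      by (rule openin_source_vimage[OF subbase_openin[OF subbase_BO]])
    then obtain i where i: "one (src g) \<in> U i" "U i \<subseteq> {h \<in> Mor G. src h \<in> BO n}"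
      using U_base[of "src g" "{h \<in> Mor G. src h \<in> BO n}"] n g by auto
    obtain k where k: "U (fst (el x (e (chain (str x) e k)))) \<subseteq> U i"
      using c i(1) by (auto simp: converges_def)
    let ?a = "el x (e (chain (str x) e k))"
    obtain r where "rel (fst ?a) (fst ?a) r ?a ?a"
      using rel_refl_iff[OF el_fib[OF x], of "fst ?a" "e (chain (str x) e k)"] by auto
    moreover have "{x \<in> Obj G. one x \<in> U (fst ?a)} \<subseteq> BO n" using i(2) k by fastforce
    ultimately show "base_seq (str x) e n" by (auto simp: base_seq_def)
  }
qed

lemma meets_act_iv:
  assumes "g \<in> Mor G" "a \<in> fib (tgt g)"
  shows "meets (act (iv g) a) j n \<longleftrightarrow> fst a = j \<and> (\<exists>h\<in>snd a. iv g \<cdot> h \<in> W n)"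
  by (auto simp: meets_def act_def)

lemma nbhd_set_str:
  assumes c: "converges x e g"
  shows "nbhd_set (str x) e l j n \<longleftrightarrow> meets (act (iv g) (el x (e l))) j n"
proof -
  have g: "g \<in> Mor G" "tgt g = x" using c by (auto simp: converges_def)
  then have x: "x \<in> Obj G" by auto
  let ?a = "\<lambda>k. el x (e (chain (str x) e k))"
  let ?b = "el x (e l)"
  have fa: "?a k \<in> fib x" for k using x by simp
  have fb: "?b \<in> fib x" using x by simp
  have ga: "g \<in> snd (?a k)" for k using c by (auto simp: converges_def)
  have "meets (act (iv g) ?b) j n \<longleftrightarrow> fst ?b = j \<and> (\<exists>h\<in>snd ?b. iv g \<cdot> h \<in> W n)"
    using g fb by (intro meets_act_iv) auto
  also have "\<dots> \<longleftrightarrow> nbhd_set (str x) e l j n"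
  proof
    assume "fst ?b = j \<and> (\<exists>h\<in>snd ?b. iv g \<cdot> h \<in> W n)"
    then obtain h where h: "fst ?b = j" "h \<in> snd ?b" "iv g \<cdot> h \<in> W n" by blast
    note h' = fib_memD[OF fb h(2)]
    obtain i n' where i: "one (tgt (iv g \<cdot> h)) \<in> U i" "iv g \<cdot> h \<in> W n'"
      "\<And>j u w. U j \<subseteq> U i \<Longrightarrow> u \<in> U j \<Longrightarrow> w \<in> W n' \<Longrightarrow> src u = tgt w \<Longrightarrow> u \<cdot> w \<in> W n"
      by (rule left_U_base[OF openin_W h(3)]) (rule that)
    have "one (src g) \<in> U i" using i(1) g h' by simp
    then obtain k where k: "U (fst (?a k)) \<subseteq> U i" using c by (auto simp: converges_def)
    have "str x (rcode (fst (?a k)) j n') [e (chain (str x) e k), e l]"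
      using h i(2) ga[of k] by (auto simp: rel_def)
    then show "nbhd_set (str x) e l j n"
      unfolding nbhd_set_def using i(3)[OF k] by blast
  next
    assume "nbhd_set (str x) e l j n"
    then obtain k i n' where k: "\<forall>u\<in>U i. \<forall>w\<in>W n'. src u = tgt w \<longrightarrow> u \<cdot> w \<in> W n"
      "rel i j n' (?a k) ?b" by (auto simp: nbhd_set_def)
    then obtain f h where fh: "fst (?a k) = i" "fst ?b = j" "f \<in> snd (?a k)" "h \<in> snd ?b"
      "iv f \<cdot> h \<in> W n'" by (auto simp: rel_def)
    note f' = fib_memD[OF fa fh(3)] and h' = fib_memD[OF fb fh(4)]
    have "iv g \<cdot> f \<in> U i" using fib_mem_iff[OF fa ga[of k], of f] fh by simp
    from k(1)[rule_format, OF this fh(5)] have "(iv g \<cdot> f) \<cdot> (iv f \<cdot> h) \<in> W n"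
      using f' h' g by simp
    then have "iv g \<cdot> h \<in> W n" using f' h' g by (simp add: div_mul_div)
    then show "fst ?b = j \<and> (\<exists>h\<in>snd ?b. iv g \<cdot> h \<in> W n)" using fh by blast
  qed
  finally show ?thesis by blast
qed

lemma tails_dense_sets_dense:
  assumes "x \<in> Obj G" "D \<in> dense_sets x"
  shows "\<exists>t. s @ t \<in> tails (str x) D"
  by (rule tails_dense) (rule dense_sets_dense[OF assms])

lemma tails_converges:
  assumes x: "x \<in> Obj G" and e: "\<And>D. D \<in> dense_sets x \<Longrightarrow> \<exists>n. map e [0..<n] \<in> tails (str x) D"
  shows "\<exists>g. converges x e g"
proof (rule converges_ex[OF x])
  fix D assume "D \<in> dense_sets x"
  from e[OF this] obtain n where "map e [0..<n] \<in> tails (str x) D" by blast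
  then show "\<exists>k. e (chain (str x) e k) \<in> D" by (rule tails_chain)
qed


section \<open>Every isomorphism of structures comes from a morphism\<close>

text \<open>A morphism \<open>k\<close> inducing \<open>\<theta>\<close> must lie in the images under \<open>\<theta>\<close> of the cosets of the unit, but these need not
  converge by themselves: the left uniformity is not complete in general. Choosing a sequence \<open>e\<close> such
  that both \<open>e\<close> and \<open>\<theta> \<circ> e\<close> are generic avoids this. Their limits \<open>g\<close> and \<open>h\<close> have a common source
  because the structures cannot tell them apart, and \<open>k\<close> is found as \<open>h g\<^sup>-\<^sup>1\<close>.\<close>

lemma perm_full:
  assumes x: "x \<in> Obj G" and y: "y \<in> Obj G" and th: "bij \<theta>"
    and iso: "\<And>q a b. str y q [\<theta> a, \<theta> b] \<longleftrightarrow> str x q [a, b]"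
  obtains k where "k \<in> Mor G" "src k = x" "tgt k = y" "perm k = \<theta>"
proof -
  have below: "below (str y) (\<theta> b) (\<theta> a) \<longleftrightarrow> below (str x) b a" for a b
    unfolding below_def iso ..
  have chain: "chain (str y) (\<theta> \<circ> e) k = chain (str x) e k" for e k
    by (induction k) (simp_all add: below)
  define \<D> where "\<D> = tails (str x) ` dense_sets x \<union> (\<lambda>D. tails (str x) (\<theta> -` D)) ` dense_sets y"
  have "countable \<D>" using countable_dense_sets by (auto simp: \<D>_def)
  moreover have "\<exists>t. s @ t \<in> D" if "D \<in> \<D>" for D s
  proof -
    have "\<exists>t. s @ t \<in> tails (str x) (\<theta> -` E)" if "E \<in> dense_sets y" for E
    proof (rule tails_dense)
      fix m
      from dense_sets_dense[OF y that]
      obtain d where d: "d \<in> E" "below (str y) d (\<theta> m)" by blast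
      obtain m' where "d = \<theta> m'" using th by (metis bij_pointE)
      then show "\<exists>m'\<in>\<theta> -` E. below (str x) m' m" using d below by auto
    qed
    then show ?thesis using that tails_dense_sets_dense[OF x] by (auto simp: \<D>_def)
  qed
  ultimately obtain e :: "nat \<Rightarrow> nat" where e: "range e = UNIV" "\<And>D. D \<in> \<D> \<Longrightarrow> \<exists>n. map e [0..<n] \<in> D"
    using generic_sequence_exists[of \<D>] by metis
  obtain g where g: "converges x e g"
    using tails_converges[OF x, of e] e(2) by (auto simp: \<D>_def)
  have "\<exists>h. converges y (\<theta> \<circ> e) h"
  proof (rule converges_ex[OF y])
    fix D assume "D \<in> dense_sets y"
    then have "tails (str x) (\<theta> -` D) \<in> \<D>" by (simp add: \<D>_def)
    from e(2)[OF this] obtain n where "map e [0..<n] \<in> tails (str x) (\<theta> -` D)" by blast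
    from tails_chain[OF this] show "\<exists>k. (\<theta> \<circ> e) (chain (str y) (\<theta> \<circ> e) k) \<in> D"
      by (simp add: chain)
  qed
  then obtain h where h: "converges y (\<theta> \<circ> e) h" by blast
  have gM: "g \<in> Mor G" "tgt g = x" and hM: "h \<in> Mor G" "tgt h = y"
    using g h by (auto simp: converges_def)
  have "base_seq (str y) (\<theta> \<circ> e) n \<longleftrightarrow> base_seq (str x) e n" for n
    unfolding base_seq_def chain by (simp only: o_apply iso)
  then have src: "src g = src h"
    using gM hM base_seq_str[OF g] base_seq_str[OF h] by (intro presented_eqI[OF presented_obj]) auto
  have nbhd: "nbhd_set (str y) (\<theta> \<circ> e) l j n \<longleftrightarrow> nbhd_set (str x) e l j n" for l j n
    unfolding nbhd_set_def chain by (simp only: o_apply iso)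
  have eq: "act (iv g) (el x m) = act (iv h) (el y (\<theta> m))" for m
  proof (rule fib_eq_meets)
    show "act (iv g) (el x m) \<in> fib (src g)" "act (iv h) (el y (\<theta> m)) \<in> fib (src g)"
      using act_fib[of "iv g" "el x m"] act_fib[of "iv h" "el y (\<theta> m)"] gM hM x y src by auto
    fix j n
    obtain l where "m = e l" using e(1) by (metis rangeE UNIV_I)
    then show "meets (act (iv g) (el x m)) j n \<Longrightarrow> meets (act (iv h) (el y (\<theta> m))) j n"
      using nbhd_set_str[OF g, of l j n] nbhd_set_str[OF h, of l j n] nbhd by simp
  qed
  let ?k = "h \<cdot> iv g"
  have k: "?k \<in> Mor G" "src ?k = x" "tgt ?k = y" using gM hM src by auto
  have "perm ?k m = \<theta> m" for m
  proof (rule perm_unique[OF k(1)])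
    have "act ?k (el x m) = act h (act (iv g) (el x m))"
      using gM hM src x by (intro act_mul) auto
    also have "\<dots> = el y (\<theta> m)" unfolding eq using hM y by (intro act_iv') auto
    finally show "el (tgt ?k) (\<theta> m) = act ?k (el (src ?k) m)" by (simp only: k)
  qed
  then show thesis using that k by blast
qed


section \<open>Structures recognized as isomorphic to one attached to an object\<close>

text \<open>The object with the neighbourhoods prescribed by \<open>base_seq\<close>, provided that \<open>has_limit\<close> holds; otherwise the
  value is arbitrary.\<close>

definition limit :: "nat struct \<Rightarrow> (nat \<Rightarrow> nat) \<Rightarrow> 'o"
  where "limit M e = (SOME x. x \<in> Obj G \<and> (\<forall>n. x \<in> BO n \<longleftrightarrow> base_seq M e n))"

definition has_limit :: "nat struct \<Rightarrow> (nat \<Rightarrow> nat) \<Rightarrow> bool"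
  where "has_limit M e \<longleftrightarrow> (\<forall>r\<in>RO. rule_holds r (base_seq M e))"

definition matches :: "nat struct \<Rightarrow> (nat \<Rightarrow> nat) \<Rightarrow> nat \<Rightarrow> nat \<Rightarrow> bool"
  where "matches M e l m \<longleftrightarrow> (\<forall>j n. nbhd_set M e l j n \<longleftrightarrow> meets (el (limit M e) m) j n)"

text \<open>Matching positions of \<open>e\<close> with members of the structure of the limit is an isomorphism.\<close>

definition good :: "nat struct \<Rightarrow> (nat \<Rightarrow> nat) \<Rightarrow> bool"
  where "good M e \<longleftrightarrow> has_limit M e \<and> (\<forall>l. \<exists>m. matches M e l m) \<and> (\<forall>m. \<exists>l. matches M e l m) \<and>
    (\<forall>l l' m m'. matches M e l m \<and> matches M e l' m' \<longrightarrow> (e l = e l' \<longleftrightarrow> m = m') \<and>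
      (\<forall>q. M q [e l, e l'] \<longleftrightarrow> str (limit M e) q [m, m']))"

definition match :: "nat struct \<Rightarrow> (nat \<Rightarrow> nat) \<Rightarrow> nat \<Rightarrow> nat"
  where "match M e m = e (LEAST l. matches M e l m)"

lemma limit:
  assumes "has_limit M e"
  shows "limit M e \<in> Obj G" "limit M e \<in> BO n \<longleftrightarrow> base_seq M e n"
proof -
  have "\<exists>x. x \<in> Obj G \<and> (\<forall>n. x \<in> BO n \<longleftrightarrow> base_seq M e n)"
    using presented_points[OF presented_obj, of "base_seq M e"] assms
    unfolding has_limit_def topspace_obj by blast
  from someI_ex[OF this] show "limit M e \<in> Obj G" "limit M e \<in> BO n \<longleftrightarrow> base_seq M e n"
    by (simp_all add: limit_def)
qed

lemma limit_str:
  assumes c: "converges x e g"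
  shows "has_limit (str x) e" "limit (str x) e = src g"
proof -
  have g: "g \<in> Mor G" using c by (auto simp: converges_def)
  have "\<exists>x'\<in>Obj G. \<forall>n. x' \<in> BO n \<longleftrightarrow> base_seq (str x) e n"
    using g base_seq_str[OF c] by (intro bexI[of _ "src g"]) auto
  then show hl: "has_limit (str x) e"
    using presented_points[OF presented_obj, of "base_seq (str x) e"]
    unfolding has_limit_def topspace_obj by blast
  show "limit (str x) e = src g"
    using limit[OF hl] g base_seq_str[OF c] by (intro presented_eqI[OF presented_obj]) auto
qed

lemma good_str:
  assumes c: "converges x e g" and e: "range e = UNIV"
  shows "good (str x) e"
proof -
  have g: "g \<in> Mor G" "tgt g = x" using c by (auto simp: converges_def)
  then have x: "x \<in> Obj G" by auto
  note lim = limit_str[OF c]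
  have fib: "act (iv g) (el x l) \<in> fib (src g)" for l
    using act_fib[of "iv g" "el x l"] g x by simp
  have m: "matches (str x) e l m \<longleftrightarrow> act (iv g) (el x (e l)) = el (src g) m" for l m
  proof
    assume "matches (str x) e l m"
    then show "act (iv g) (el x (e l)) = el (src g) m"
      using g by (intro fib_eq_meets[OF fib]) (auto simp: matches_def nbhd_set_str[OF c] lim)
  qed (simp add: matches_def nbhd_set_str[OF c] lim)
  have "\<exists>m. matches (str x) e l m" for l
  proof -
    have "src g \<in> Obj G" using g by simp
    from el_ex[OF this fib[of "e l"]] show ?thesis unfolding m by metis
  qed
  moreover have "\<exists>l. matches (str x) e l m'" for m'
  proof -
    have "act g (el (src g) m') \<in> fib x" using act_fib[of g "el (src g) m'"] g by simp
    then obtain p where "el x p = act g (el (src g) m')" using el_ex[OF x] by blast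
    moreover obtain l where "p = e l" using e by (metis rangeE UNIV_I)
    ultimately show ?thesis unfolding m using g by (intro exI[of _ l]) (simp add: act_iv)
  qed
  moreover have "e l = e l' \<longleftrightarrow> p = p'"
    if "matches (str x) e l p" "matches (str x) e l' p'" for l l' p p'
  proof
    assume "e l = e l'"
    then show "p = p'" using that el_inj[of "src g" p p'] g unfolding m by simp
  next
    assume "p = p'"
    then have "act g (act (iv g) (el x (e l))) = act g (act (iv g) (el x (e l')))"
      using that unfolding m by simp
    then show "e l = e l'" using act_iv'[OF g(1)] g x el_inj[OF x] by simp
  qed
  moreover have "str x q [e l, e l'] \<longleftrightarrow> str (limit (str x) e) q [p, p']"
    if "matches (str x) e l p" "matches (str x) e l' p'" for l l' p p' q
  proof -
    obtain i j n where q: "q = rcode i j n" using rcode_cases .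
    have "rel i j n (act (iv g) (el x (e l))) (act (iv g) (el x (e l'))) \<longleftrightarrow> rel i j n (el x (e l)) (el x (e l'))"
      using g x by (intro rel_act) auto
    then show ?thesis using that unfolding m q str_rcode lim by simp
  qed
  ultimately show ?thesis using lim(1) unfolding good_def by blast
qed

lemma match_iso:
  assumes good: "good M e" and e: "range e = UNIV" and M: "M \<in> topspace (Mod_top bin_lang)"
  shows "bij (match M e)" "push bin_lang (match M e) (str (limit M e)) = M" "limit M e \<in> Obj G"
proof -
  have ex: "\<exists>l. matches M e l m" for m using good by (simp add: good_def)
  define L where "L m = (LEAST l. matches M e l m)" for m
  have L: "matches M e (L m) m" for m unfolding L_def using ex by (rule LeastI_ex)
  have match: "match M e m = e (L m)" for m by (simp add: match_def L_def)
  have iff: "e l = e l' \<longleftrightarrow> m = m'" if "matches M e l m" "matches M e l' m'" for l l' m m'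
    using good that unfolding good_def by blast
  have q: "M q [e l, e l'] \<longleftrightarrow> str (limit M e) q [m, m']"
    if "matches M e l m" "matches M e l' m'" for l l' m m' q
    using good that unfolding good_def by blast
  have inj: "inj (match M e)" by (rule injI) (use iff[OF L L] match in metis)
  have "b \<in> range (match M e)" for b
  proof -
    obtain l where l: "b = e l" using e by (metis rangeE UNIV_I)
    obtain m where m: "matches M e l m" using good unfolding good_def by blast
    have "match M e m = b" using iff[OF L m] match l by simp
    then show ?thesis by blast
  qed
  then show bij: "bij (match M e)" using inj by (auto simp: bij_def)
  show "limit M e \<in> Obj G" using good limit by (simp add: good_def)
  show "push bin_lang (match M e) (str (limit M e)) = M"
    by (rule push_eqI[OF bij M]) (simp add: match q[OF L L])
qed


section \<open>Recognition is Borel\<close>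

abbreviation "diag \<equiv> diagram bin_lang"

lemma pred_diag_rel [measurable]: "Measurable.pred diag (\<lambda>p. fst p q [snd p i, snd p j])"
  using pred_diagram_rel[of q bin_lang "[i, j]"] by simp

lemma pred_diag_eq [measurable]: "Measurable.pred diag (\<lambda>p. snd p i = snd p j)"
  by (rule pred_diagram_eq)

lemma pred_below [measurable]: "Measurable.pred diag (\<lambda>p. below (fst p) (snd p i) (snd p j))"
  unfolding below_def by measurable

lemma measurable_chain [measurable]:
  "(\<lambda>p. chain (fst p) (snd p) k) \<in> measurable diag (count_space UNIV)"
proof (induction k)
  case (Suc k)
  have [measurable]: "Measurable.pred diag (\<lambda>p. below (fst p) (snd p (Suc k)) (snd p (chain (fst p) (snd p) k)))"
    by (rule pred_index[OF pred_below Suc])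
  note Suc [measurable]
  show ?case unfolding chain.simps by measurable
qed simp

lemma pred_diag_rel_chain [measurable]:
  "Measurable.pred diag (\<lambda>p. fst p q [snd p (chain (fst p) (snd p) k), snd p l])"
  by (rule pred_index[OF pred_diag_rel measurable_chain])

lemma pred_base_seq [measurable]: "Measurable.pred diag (\<lambda>p. base_seq (fst p) (snd p) n)"
proof -
  have [measurable]: "Measurable.pred diag (\<lambda>p. fst p q
      [snd p (chain (fst p) (snd p) k), snd p (chain (fst p) (snd p) k)])" for q k
    by (rule pred_index[OF pred_diag_rel_chain measurable_chain])
  show ?thesis unfolding base_seq_def by measurable
qed

lemma pred_nbhd_set [measurable]: "Measurable.pred diag (\<lambda>p. nbhd_set (fst p) (snd p) l j n)"
  unfolding nbhd_set_def by measurable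

lemma pred_has_limit: "Measurable.pred diag (\<lambda>p. has_limit (fst p) (snd p))"
proof -
  have RO: "countable RO" "\<And>r. r \<in> RO \<Longrightarrow> \<forall>t\<in>snd r. finite t"
    using presented_obj by (auto simp: presented_def)
  have "{p \<in> space diag. rule_holds r (base_seq (fst p) (snd p))} \<in> sets diag" if r: "r \<in> RO" for r
  proof -
    have "(\<exists>t\<in>snd r. \<forall>n\<in>t. b n) \<longleftrightarrow> (\<exists>xs. set xs \<in> snd r \<and> (\<forall>n\<in>set xs. b n))" for b
      using RO(2)[OF r] by (metis finite_list)
    then have "rule_holds r b \<longleftrightarrow> ((\<forall>n\<in>fst r. b n) \<longrightarrow> (\<exists>xs. set xs \<in> snd r \<and> (\<forall>n\<in>set xs. b n)))" for b
      by (simp add: rule_holds_def)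
    moreover have "Measurable.pred diag (\<lambda>p. (\<forall>n\<in>fst r. base_seq (fst p) (snd p) n) \<longrightarrow>
        (\<exists>xs. set xs \<in> snd r \<and> (\<forall>n\<in>set xs. base_seq (fst p) (snd p) n)))"
      by measurable
    ultimately show ?thesis by (simp add: pred_def)
  qed
  from sets.sets_Collect_countable_All'[OF this RO(1)] show ?thesis
    by (simp add: pred_def has_limit_def)
qed

lemma
  assumes f: "f \<in> measurable N diag"
    and lim: "\<And>w. w \<in> space N \<Longrightarrow> has_limit (fst (f w)) (snd (f w))"
  shows measurable_limit: "(\<lambda>w. limit (fst (f w)) (snd (f w))) \<in> measurable N OB"
    and pred_matches: "Measurable.pred N (\<lambda>w. matches (fst (f w)) (snd (f w)) l m)"
    and pred_good_aux: "Measurable.pred N (\<lambda>w. good (fst (f w)) (snd (f w)))"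
proof -
  show L: "(\<lambda>w. limit (fst (f w)) (snd (f w))) \<in> measurable N OB"
  proof (rule measurable_borel_of_subbase[OF subbase_BO])
    fix n
    have "Measurable.pred N (\<lambda>w. base_seq (fst (f w)) (snd (f w)) n)"
      by (rule measurable_compose[OF f pred_base_seq])
    then have "{w \<in> space N. base_seq (fst (f w)) (snd (f w)) n} \<in> sets N" by (simp add: pred_def)
    moreover have "{w \<in> space N. limit (fst (f w)) (snd (f w)) \<in> BO n} =
        {w \<in> space N. base_seq (fst (f w)) (snd (f w)) n}"
      using limit(2)[OF lim] by blast
    ultimately show "{w \<in> space N. limit (fst (f w)) (snd (f w)) \<in> BO n} \<in> sets N" by simp
  qed (use limit(1)[OF lim] in auto)
  have [measurable]: "Measurable.pred N (\<lambda>w. meets (el (limit (fst (f w)) (snd (f w))) m) j n)" for m j n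
    by (rule measurable_compose[OF L pred_meets_el])
  have [measurable]: "Measurable.pred N (\<lambda>w. nbhd_set (fst (f w)) (snd (f w)) l j n)" for l j n
    by (rule measurable_compose[OF f pred_nbhd_set])
  have M [measurable]: "Measurable.pred N (\<lambda>w. matches (fst (f w)) (snd (f w)) l m)" for l m
    unfolding matches_def by measurable
  then show "Measurable.pred N (\<lambda>w. matches (fst (f w)) (snd (f w)) l m)" .
  have [measurable]: "Measurable.pred N (\<lambda>w. snd (f w) l = snd (f w) l')" for l l'
    by (rule measurable_compose[OF f pred_diag_eq])
  have [measurable]: "Measurable.pred N (\<lambda>w. fst (f w) q [snd (f w) l, snd (f w) l'])" for q l l'
    by (rule measurable_compose[OF f pred_diag_rel])
  have [measurable]: "Measurable.pred N (\<lambda>w. str (limit (fst (f w)) (snd (f w))) q [m, m'])" for q m m'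
  proof -
    obtain i j n where "q = rcode i j n" using rcode_cases .
    then show ?thesis using measurable_compose[OF L pred_rel_el] by simp
  qed
  have [measurable]: "Measurable.pred N (\<lambda>w. has_limit (fst (f w)) (snd (f w)))"
    by (rule measurable_compose[OF f pred_has_limit])
  show "Measurable.pred N (\<lambda>w. good (fst (f w)) (snd (f w)))"
    unfolding good_def by measurable
qed

text \<open>The limit is a meaningful object only where \<open>has_limit\<close> holds, so measurability is first shown on that
  subspace.\<close>

lemma good_Borel: "{p. good (fst p) (snd p)} \<in> sets diag"
proof -
  let ?H = "{p. has_limit (fst p) (snd p)}"
  have H: "?H \<in> sets diag" using pred_has_limit by (simp add: pred_def)
  have "Measurable.pred (restrict_space diag ?H) (\<lambda>p. good (fst p) (snd p))"
    by (rule pred_good_aux[where f = "\<lambda>p. p"]) (auto simp: space_restrict_space intro: measurable_restrict_space1)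
  then have "{p \<in> ?H. good (fst p) (snd p)} \<in> sets (restrict_space diag ?H)"
    by (simp add: pred_def space_restrict_space)
  then have "{p \<in> ?H. good (fst p) (snd p)} \<in> sets diag"
    using H by (subst (asm) sets_restrict_space_iff) auto
  moreover have "{p \<in> ?H. good (fst p) (snd p)} = {p. good (fst p) (snd p)}" by (auto simp: good_def)
  ultimately show ?thesis by simp
qed

lemma good_forcible: "forcible bin_lang good"
  using forcible_diagram[OF good_Borel] by simp

end


section \<open>The sentence and the two functors\<close>

text \<open>The data provided by the forcibility of \<open>good\<close>, together with a sentence which expresses that some
  finite sequence forces it.\<close>

locale coded_groupoid = based_groupoid G W U BO RO BM RM
  for G :: "('o, 'm) top_groupoid" and W U BO RO BM RM +
  fixes Q :: "nat struct \<Rightarrow> nat list \<Rightarrow> bool" and D :: "nat \<Rightarrow> nat struct \<Rightarrow> nat list \<Rightarrow> bool"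
    and \<phi> :: "nat fm"
  assumes forces: "forces bin_lang good Q D"
    and sentence: "sentence bin_lang \<phi>"
    and sat_iff: "sat M \<phi> v \<longleftrightarrow> (\<exists>s. Q M s)"
begin

abbreviation "\<M> \<equiv> Models bin_lang \<phi>"
abbreviation "\<H> \<equiv> action_groupoid bin_lang \<phi>"
abbreviation "\<G> \<equiv> borel_groupoid_of G"

lemma Models_iff: "M \<in> \<M> \<longleftrightarrow> M \<in> topspace (Mod_top bin_lang) \<and> (\<exists>s. Q M s)"
  by (auto simp: Models_def sat_iff)

lemma push_Models:
  assumes "bij g" "M \<in> \<M>"
  shows "push bin_lang g M \<in> \<M>"
proof -
  have "sat (push bin_lang g M) \<phi> (g \<circ> undefined)"
    using assms sat_push[OF assms(1), of bin_lang \<phi> M undefined] sentence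
    by (simp add: sentence_def Models_def)
  then show ?thesis by (auto simp: Models_iff push_topspace sat_iff)
qed

text \<open>Choose an enumeration that is generic for the dense sets of the fibre of \<open>x\<close> as well as for those of the forcing
  relation: it converges, hence is good, and so some initial segment of it forces this.\<close>

lemma str_Models:
  assumes x: "x \<in> Obj G"
  shows "str x \<in> \<M>"
proof -
  define \<D> where "\<D> = tails (str x) ` dense_sets x \<union> range (\<lambda>j. {s. D j (str x) s})"
  have "countable \<D>" using countable_dense_sets by (auto simp: \<D>_def)
  moreover have "\<exists>t. s @ t \<in> E" if "E \<in> \<D>" for E s
    using that tails_dense_sets_dense[OF x] forcesD(4)[OF forces] by (auto simp: \<D>_def)
  ultimately obtain e :: "nat \<Rightarrow> nat" where e: "range e = UNIV" "\<And>E. E \<in> \<D> \<Longrightarrow> \<exists>n. map e [0..<n] \<in> E"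
    using generic_sequence_exists[of \<D>] by metis
  obtain g where "converges x e g"
    using tails_converges[OF x, of e] e(2) by (auto simp: \<D>_def)
  then have good: "good (str x) e" using e(1) by (rule good_str)
  have "\<exists>n. D j (str x) (map e [0..<n])" for j
    using e(2)[of "{s. D j (str x) s}"] by (auto simp: \<D>_def)
  from forcesD(5)[OF forces, OF this] good show ?thesis
    using str_topspace[of x] by (auto simp: Models_iff)
qed

text \<open>An extension of the least sequence that forces \<open>good\<close>. Since all choices are least ones, it is Borel
  in \<open>M\<close>.\<close>

definition enum :: "nat struct \<Rightarrow> nat \<Rightarrow> nat"
  where "enum M = gseq (\<lambda>j. D j M) (list_decode (LEAST c. Q M (list_decode c)))"

definition base :: "nat struct \<Rightarrow> 'o"
  where "base M = limit M (enum M)"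

definition iso :: "nat struct \<Rightarrow> nat \<Rightarrow> nat"
  where "iso M = match M (enum M)"

lemma good_enum:
  assumes "M \<in> \<M>"
  shows "good M (enum M)"
proof -
  obtain s where "Q M s" using assms by (auto simp: Models_iff)
  then have "Q M (list_decode (list_encode s))" by simp
  then have "Q M (list_decode (LEAST c. Q M (list_decode c)))" by (rule LeastI)
  then have Q: "\<exists>n. Q M (map (enum M) [0..<n])" unfolding enum_def using gseq_extends by metis
  have "\<exists>n. D j M (map (enum M) [0..<n])" for j
    unfolding enum_def using forcesD(4)[OF forces] by (rule gseq_meets)
  from forcesD(5)[OF forces, OF this] Q show ?thesis by simp
qed

lemma iso:
  assumes "M \<in> \<M>"
  shows "bij (iso M)" "push bin_lang (iso M) (str (base M)) = M" "base M \<in> Obj G"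
  using match_iso[OF good_enum[OF assms]] assms range_gseq
  by (auto simp: iso_def base_def enum_def Models_iff)

abbreviation "MM \<equiv> Mod_borel bin_lang \<phi>"

lemma space_MM [simp]: "space MM = \<M>"
  by (auto simp: Mod_borel_def space_restrict_space Models_iff)

lemma measurable_MM:
  assumes "f \<in> space N \<rightarrow> \<M>" "f \<in> measurable N (borel_of (Mod_top bin_lang))"
  shows "f \<in> measurable N MM"
  unfolding Mod_borel_def using assms by (intro measurable_restrict_space2) auto

lemma pred_MM: "Measurable.pred (borel_of (Mod_top bin_lang)) P \<Longrightarrow> Measurable.pred MM P"
  unfolding Mod_borel_def by (rule measurable_restrict_space1)

lemma pred_MM_rel: "length xs = 2 \<Longrightarrow> Measurable.pred MM (\<lambda>M. M q xs)"
  by (rule pred_MM, rule pred_Mod_top) auto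

lemma measurable_enum: "(\<lambda>M. enum M i) \<in> measurable MM (count_space UNIV)"
  unfolding enum_def
proof (rule measurable_gseq)
  show "Measurable.pred MM (\<lambda>M. D j M u)" for j u
    by (rule pred_MM, rule definable_Borel, rule forcesD(2)[OF forces])
  have "Measurable.pred MM (\<lambda>M. Q M (list_decode c))" for c
    by (rule pred_MM, rule definable_Borel, rule forcesD(1)[OF forces])
  then have "(\<lambda>M. LEAST c. Q M (list_decode c)) \<in> measurable MM (count_space UNIV)"
    by (rule measurable_Least)
  from measurable_compose[OF this, of list_decode "count_space UNIV"]
  show "(\<lambda>M. list_decode (LEAST c. Q M (list_decode c))) \<in> measurable MM (count_space UNIV)" by simp
qed

lemma measurable_enum_diag: "(\<lambda>M. (M, enum M)) \<in> measurable MM diag"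
  by (rule measurable_diagramI[OF measurable_enum]) (simp add: pred_MM_rel)

lemma has_limit_enum: "M \<in> \<M> \<Longrightarrow> has_limit M (enum M)"
  using good_enum by (simp add: good_def)

lemma measurable_base [measurable]: "base \<in> measurable MM OB"
  using measurable_limit[OF measurable_enum_diag] has_limit_enum by (simp add: base_def[abs_def])

lemma measurable_iso [measurable]: "(\<lambda>M. iso M m) \<in> measurable MM (count_space UNIV)"
proof -
  have "Measurable.pred MM (\<lambda>M. matches M (enum M) l m)" for l
    using pred_matches[OF measurable_enum_diag] has_limit_enum by simp
  then have "(\<lambda>M. LEAST l. matches M (enum M) l m) \<in> measurable MM (count_space UNIV)"
    by (rule measurable_Least)
  from measurable_apply_index[OF measurable_enum this] show ?thesis by (simp add: iso_def match_def)
qed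

abbreviation "HM \<equiv> borel_of S_inf_top \<Otimes>\<^sub>M MM"

lemma space_HM: "space HM = {g. bij g} \<times> \<M>"
  by (simp add: space_pair_measure)

lemma measurable_HM_apply: "(\<lambda>w. fst w m) \<in> measurable HM (count_space UNIV)"
  by (rule measurable_compose[OF measurable_fst measurable_S_inf_apply])

lemma measurable_push: "(\<lambda>w. push bin_lang (fst w) (snd w)) \<in> measurable HM MM"
proof (rule measurable_MM)
  show "(\<lambda>w. push bin_lang (fst w) (snd w)) \<in> space HM \<rightarrow> \<M>"
    using push_Models by (auto simp: space_HM)
  show "(\<lambda>w. push bin_lang (fst w) (snd w)) \<in> measurable HM (borel_of (Mod_top bin_lang))"
  proof (rule measurable_Mod_top)
    fix q :: nat and xs :: "nat list" assume len: "length xs = arity bin_lang q"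
    then obtain a b where xs: "xs = [a, b]" by (auto simp: length2_iff)
    have inv: "(\<lambda>w. inv (fst w) c) \<in> measurable HM (count_space UNIV)" for c
      by (rule measurable_inv_apply[OF _ measurable_HM_apply]) (auto simp: space_HM)
    have "Measurable.pred HM (\<lambda>w. snd w q [c, d])" for c d
      by (rule measurable_compose[OF measurable_snd pred_MM_rel]) simp
    from pred_index[OF this inv[of b]] have "Measurable.pred HM (\<lambda>w. snd w q [c, inv (fst w) b])" for c .
    from pred_index[OF this inv[of a]] have "Measurable.pred HM (\<lambda>w. snd w q [inv (fst w) a, inv (fst w) b])" .
    then show "Measurable.pred HM (\<lambda>w. push bin_lang (fst w) (snd w) q xs)"
      by (simp add: push_def xs)
  qed (auto simp: push_topspace)
qed

definition lift :: "'o \<Rightarrow> 'o \<Rightarrow> (nat \<Rightarrow> nat) \<Rightarrow> 'm"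
  where "lift x y \<theta> = (SOME k. k \<in> Mor G \<and> src k = x \<and> tgt k = y \<and> perm k = \<theta>)"

lemma lift:
  assumes "x \<in> Obj G" "y \<in> Obj G" "bij \<theta>" "push bin_lang \<theta> (str x) = str y"
  shows "lift x y \<theta> \<in> Mor G" "src (lift x y \<theta>) = x" "tgt (lift x y \<theta>) = y" "perm (lift x y \<theta>) = \<theta>"
proof -
  have "str y q [\<theta> a, \<theta> b] \<longleftrightarrow> str x q [a, b]" for q a b
    using push_apply[OF assms(3), of "str x"] assms(4) by simp
  then obtain k where "k \<in> Mor G \<and> src k = x \<and> tgt k = y \<and> perm k = \<theta>"
    using perm_full[OF assms(1-3)] by metis
  then have "lift x y \<theta> \<in> Mor G \<and> src (lift x y \<theta>) = x \<and> tgt (lift x y \<theta>) = y \<and> perm (lift x y \<theta>) = \<theta>"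
    unfolding lift_def by (rule someI)
  then show "lift x y \<theta> \<in> Mor G" "src (lift x y \<theta>) = x" "tgt (lift x y \<theta>) = y" "perm (lift x y \<theta>) = \<theta>"
    by auto
qed

text \<open>The isomorphism \<open>\<theta>\<close> of \<open>M\<close> onto its image, transported along \<open>iso\<close> to the structures attached to
  objects.\<close>

definition transported :: "(nat \<Rightarrow> nat) \<Rightarrow> nat struct \<Rightarrow> nat \<Rightarrow> nat"
  where "transported \<theta> M = inv (iso (push bin_lang \<theta> M)) \<circ> \<theta> \<circ> iso M"

definition coding :: "('o, 'm, nat struct, (nat \<Rightarrow> nat) \<times> nat struct) gpd_functor"
  where "coding = \<lparr>on_obj = str, on_mor = (\<lambda>g. (perm g, str (src g)))\<rparr>"

definition decoding :: "(nat struct, (nat \<Rightarrow> nat) \<times> nat struct, 'o, 'm) gpd_functor"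
  where "decoding = \<lparr>on_obj = base,
    on_mor = (\<lambda>w. lift (base (snd w)) (base (push bin_lang (fst w) (snd w))) (transported (fst w) (snd w)))\<rparr>"

lemma transported:
  assumes "bij \<theta>" "M \<in> \<M>"
  shows "bij (transported \<theta> M)" "push bin_lang (transported \<theta> M) (str (base M)) = str (base (push bin_lang \<theta> M))"
    "iso (push bin_lang \<theta> M) \<circ> transported \<theta> M = \<theta> \<circ> iso M"
proof -
  let ?N = "push bin_lang \<theta> M"
  note M = iso[OF assms(2)] and N = iso[OF push_Models[OF assms]]
  have inv: "bij (inv (iso ?N))" using N(1) by (rule bij_imp_bij_inv)
  show "bij (transported \<theta> M)" unfolding transported_def using M(1) inv assms(1) by (intro bij_comp)
  have "push bin_lang (transported \<theta> M) (str (base M)) =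
      push bin_lang (inv (iso ?N)) (push bin_lang \<theta> (push bin_lang (iso M) (str (base M))))"
    unfolding transported_def using M(1) inv assms(1) by (simp add: push_comp bij_comp)
  also have "\<dots> = push bin_lang (inv (iso ?N)) (push bin_lang (iso ?N) (str (base ?N)))"
    by (simp only: M(2) N(2))
  also have "\<dots> = str (base ?N)" by (rule push_inv[OF N(1) str_topspace])
  finally show "push bin_lang (transported \<theta> M) (str (base M)) = str (base ?N)" .
  show "iso ?N \<circ> transported \<theta> M = \<theta> \<circ> iso M"
    using N(1) by (simp add: transported_def fun_eq_iff bij_is_surj surj_f_inv_f)
qed

lemma decoding_mor:
  assumes "bij \<theta>" "M \<in> \<M>"
  shows "on_mor decoding (\<theta>, M) \<in> Mor G" "src (on_mor decoding (\<theta>, M)) = base M"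
    "tgt (on_mor decoding (\<theta>, M)) = base (push bin_lang \<theta> M)"
    "perm (on_mor decoding (\<theta>, M)) = transported \<theta> M"
  using lift[OF iso(3)[OF assms(2)] iso(3)[OF push_Models[OF assms]] transported(1,2)[OF assms]]
  by (simp_all add: decoding_def)

lemma borel_groupoid_of_simps [simp]:
  "Obj (borel_groupoid_of G) = Obj G" "Mor (borel_groupoid_of G) = Mor G"
  "source (borel_groupoid_of G) = src" "target (borel_groupoid_of G) = tgt"
  "ident (borel_groupoid_of G) = one" "mult (borel_groupoid_of G) = mult G"
  "obj_borel (borel_groupoid_of G) = OB" "mor_borel (borel_groupoid_of G) = MB"
  by (simp_all add: borel_groupoid_of_def groupoid.defs borel_groupoid.defs)

lemma action_groupoid_simps [simp]:
  "Obj \<H> = \<M>" "Mor \<H> = {g. bij g} \<times> \<M>"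
  "source \<H> = snd" "target \<H> = (\<lambda>w. push bin_lang (fst w) (snd w))"
  "ident \<H> = (\<lambda>M. (id, M))" "mult \<H> v w = (fst v \<circ> fst w, snd w)"
  "obj_borel \<H> = MM" "mor_borel \<H> = HM"
  by (simp_all add: action_groupoid_def fun_eq_iff split: prod.splits)

lemma measurable_str_MM: "str \<in> measurable OB MM"
  using str_Models measurable_str by (intro measurable_MM) auto

lemma coding_borel_functor: "borel_functor \<G> \<H> coding"
proof -
  have "is_functor \<G> \<H> coding"
    unfolding is_functor_def
    using str_Models by (auto simp: coding_def bij_perm push_perm perm_one perm_mul composable_def)
  moreover have "(\<lambda>g. (perm g, str (src g))) \<in> measurable MB HM"
    by (intro measurable_Pair measurable_perm_S_inf measurable_compose[OF measurable_src measurable_str_MM])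
  ultimately show ?thesis
    using measurable_str_MM by (simp add: borel_functor_def coding_def)
qed

lemma decoding_borel_functor: "borel_functor \<H> \<G> decoding"
proof -
  have "is_functor \<H> \<G> decoding"
    unfolding is_functor_def
  proof (intro conjI ballI)
    show "on_obj decoding \<in> Obj \<H> \<rightarrow> Obj \<G>"
      using iso(3) by (auto simp: decoding_def)
    show "on_mor decoding \<in> Mor \<H> \<rightarrow> Mor \<G>"
      using decoding_mor(1) by auto
    fix w assume "w \<in> Mor \<H>"
    then obtain \<theta> M where w: "w = (\<theta>, M)" "bij \<theta>" "M \<in> \<M>" by auto
    show "source \<G> (on_mor decoding w) = on_obj decoding (source \<H> w)"
      using decoding_mor(2)[OF w(2,3)] by (simp add: w(1)) (simp add: decoding_def)
    show "target \<G> (on_mor decoding w) = on_obj decoding (target \<H> w)"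
      using decoding_mor(3)[OF w(2,3)] by (simp add: w(1)) (simp add: decoding_def)
  next
    fix M assume "M \<in> Obj \<H>"
    then have M: "M \<in> \<M>" by simp
    have pid: "push bin_lang id M = M" using M by (intro push_id) (simp add: Models_iff)
    have "transported id M = id" using iso(1)[OF M] by (simp add: transported_def pid bij_is_inj)
    moreover have "bij (id :: nat \<Rightarrow> nat)" by simp
    ultimately have "on_mor decoding (id, M) = one (base M)"
      using decoding_mor[of id M] M iso(3)[OF M] pid
      by (intro perm_faithful) (simp_all add: perm_one)
    then show "on_mor decoding (ident \<H> M) = ident \<G> (on_obj decoding M)"
      by simp (simp add: decoding_def)
  next
    fix p assume "p \<in> composable \<H>"
    then obtain g h M where p: "p = ((g, push bin_lang h M), (h, M))" "bij g" "bij h" "M \<in> \<M>"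
      by (auto simp: composable_def)
    let ?N = "push bin_lang h M"
    have N: "?N \<in> \<M>" using push_Models p by blast
    have gh: "bij (g \<circ> h)" using p by (intro bij_comp)
    have "transported (g \<circ> h) M = transported g ?N \<circ> transported h M"
      using iso(1)[OF N] p
      by (auto simp: transported_def push_comp fun_eq_iff bij_is_surj surj_f_inv_f)
    then have "on_mor decoding (g \<circ> h, M) = on_mor decoding (g, ?N) \<cdot> on_mor decoding (h, M)"
      using decoding_mor[OF gh p(4)] decoding_mor[OF p(2) N] decoding_mor[OF p(3,4)] p
      by (intro perm_faithful) (simp_all add: perm_mul push_comp)
    then show "case p of (g, h) \<Rightarrow> on_mor decoding (mult \<H> g h) =
        mult \<G> (on_mor decoding g) (on_mor decoding h)"
      by (simp add: p(1))
  qed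
  moreover have "on_mor decoding \<in> measurable HM MB"
  proof (rule measurable_lift)
    show b: "(\<lambda>w. base (snd w)) \<in> measurable HM OB"
      by (rule measurable_compose[OF measurable_snd measurable_base])
    show "(\<lambda>w. base (push bin_lang (fst w) (snd w))) \<in> measurable HM OB"
      by (rule measurable_compose[OF measurable_push measurable_base])
    show "(\<lambda>w. transported (fst w) (snd w) m) \<in> measurable HM (count_space UNIV)" for m
    proof -
      have 1: "(\<lambda>w. iso (snd w) m) \<in> measurable HM (count_space UNIV)"
        by (rule measurable_compose[OF measurable_snd measurable_iso])
      have 2: "(\<lambda>w. fst w (iso (snd w) m)) \<in> measurable HM (count_space UNIV)"
        by (rule measurable_apply_index[OF measurable_HM_apply 1])
      have 3: "(\<lambda>w. iso (push bin_lang (fst w) (snd w)) m) \<in> measurable HM (count_space UNIV)" for m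
        by (rule measurable_compose[OF measurable_push measurable_iso])
      have 4: "(\<lambda>w. inv (iso (push bin_lang (fst w) (snd w))) m) \<in> measurable HM (count_space UNIV)" for m
        using push_Models iso(1) by (intro measurable_inv_apply[OF _ 3]) (auto simp: space_HM)
      show ?thesis using measurable_apply_index[OF 4 2] by (simp add: transported_def)
    qed
    fix w assume "w \<in> space HM"
    then obtain \<theta> M where w: "w = (\<theta>, M)" "bij \<theta>" "M \<in> \<M>" by (auto simp: space_HM)
    note d = decoding_mor[OF w(2,3)]
    show "on_mor decoding w \<in> Mor G \<and> src (on_mor decoding w) = base (snd w) \<and>
        tgt (on_mor decoding w) = base (push bin_lang (fst w) (snd w))"
      using d by (simp add: w(1))
    show "el (base (push bin_lang (fst w) (snd w))) (transported (fst w) (snd w) m) =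
        act (on_mor decoding w) (el (base (snd w)) m)" for m
      using el_perm[OF d(1), of m] d by (simp add: w(1))
  qed
  ultimately show ?thesis
    using measurable_base by (simp add: borel_functor_def) (simp add: decoding_def)
qed

lemma coding_decoding: "borel_isomorphic \<H> \<H> (comp_functor coding decoding) id_functor"
  unfolding borel_isomorphic_def
proof (intro exI[of _ "\<lambda>M. (iso M, str (base M))"] conjI)
  have obj: "on_obj decoding = base" by (simp add: decoding_def)
  show "is_natural_iso \<H> \<H> (comp_functor coding decoding) id_functor (\<lambda>M. (iso M, str (base M)))"
    unfolding is_natural_iso_def
  proof (intro conjI ballI)
    fix M assume "M \<in> Obj \<H>"
    then have M: "M \<in> \<M>" by simp
    show "(iso M, str (base M)) \<in> Mor \<H>" using iso[OF M] str_Models by simp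
    show "source \<H> (iso M, str (base M)) = on_obj (comp_functor coding decoding) M"
      by (simp add: comp_functor_def coding_def obj)
    show "target \<H> (iso M, str (base M)) = on_obj id_functor M"
      using iso[OF M] by (simp add: id_functor_def)
  next
    fix w assume "w \<in> Mor \<H>"
    then obtain \<theta> M where w: "w = (\<theta>, M)" "bij \<theta>" "M \<in> \<M>" by auto
    show "mult \<H> (iso (target \<H> w), str (base (target \<H> w))) (on_mor (comp_functor coding decoding) w) =
        mult \<H> (on_mor id_functor w) (iso (source \<H> w), str (base (source \<H> w)))"
      using decoding_mor[OF w(2,3)] transported(3)[OF w(2,3)]
      by (simp add: comp_functor_def coding_def id_functor_def w(1))
  qed
  show "(\<lambda>M. (iso M, str (base M))) \<in> measurable (obj_borel \<H>) (mor_borel \<H>)"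
    unfolding action_groupoid_simps
    by (intro measurable_Pair measurable_S_inf measurable_compose[OF measurable_base measurable_str_MM])
      (use iso(1) in auto)
qed

lemma decoding_coding:
  "borel_isomorphic \<G> \<G> (comp_functor decoding coding) id_functor"
proof -
  define \<epsilon> where "\<epsilon> x = lift (base (str x)) x (iso (str x))" for x
  have eps: "\<epsilon> x \<in> Mor G" "src (\<epsilon> x) = base (str x)" "tgt (\<epsilon> x) = x" "perm (\<epsilon> x) = iso (str x)"
    if "x \<in> Obj G" for x
    using lift[OF iso(3)[OF str_Models[OF that]] that iso(1,2)[OF str_Models[OF that]]]
    by (simp_all add: \<epsilon>_def)
  have obj: "on_obj decoding = base" by (simp add: decoding_def)
  have "is_natural_iso \<G> \<G> (comp_functor decoding coding) id_functor \<epsilon>"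
    unfolding is_natural_iso_def
  proof (intro conjI ballI)
    fix x assume "x \<in> Obj \<G>"
    then have x: "x \<in> Obj G" by simp
    show "\<epsilon> x \<in> Mor \<G>"
      "source \<G> (\<epsilon> x) = on_obj (comp_functor decoding coding) x"
      "target \<G> (\<epsilon> x) = on_obj id_functor x"
      using eps[OF x] by (simp_all add: comp_functor_def coding_def obj id_functor_def)
  next
    fix g assume "g \<in> Mor \<G>"
    then have g: "g \<in> Mor G" by simp
    let ?d = "on_mor decoding (perm g, str (src g))"
    have src: "src g \<in> Obj G" and tgt: "tgt g \<in> Obj G" using g by auto
    note e = eps[OF src] eps[OF tgt]
    note d = decoding_mor[OF bij_perm[OF g] str_Models[OF src], unfolded push_perm[OF g]]
    have c: "iso (str (tgt g)) \<circ> transported (perm g) (str (src g)) = perm g \<circ> iso (str (src g))"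
      using transported(3)[OF bij_perm[OF g] str_Models[OF src]] push_perm[OF g] by simp
    have "\<epsilon> (tgt g) \<cdot> ?d = g \<cdot> \<epsilon> (src g)"
      using e d g c by (intro perm_faithful) (simp_all add: perm_mul)
    then show "mult \<G> (\<epsilon> (target \<G> g))
        (on_mor (comp_functor decoding coding) g) =
      mult \<G> (on_mor id_functor g) (\<epsilon> (source \<G> g))"
      by (simp add: comp_functor_def coding_def id_functor_def)
  qed
  moreover have "\<epsilon> \<in> measurable OB MB"
  proof (rule measurable_lift)
    show "(\<lambda>x. base (str x)) \<in> measurable OB OB"
      by (rule measurable_compose[OF measurable_str_MM measurable_base])
    show "(\<lambda>x. x) \<in> measurable OB OB" by simp
    show "(\<lambda>x. iso (str x) m) \<in> measurable OB (count_space UNIV)" for m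
      by (rule measurable_compose[OF measurable_str_MM measurable_iso])
    fix x assume "x \<in> space OB"
    then have x: "x \<in> Obj G" by simp
    note e = eps[OF x]
    show "\<epsilon> x \<in> Mor G \<and> src (\<epsilon> x) = base (str x) \<and> tgt (\<epsilon> x) = x" using e by simp
    show "el x (iso (str x) m) = act (\<epsilon> x) (el (base (str x)) m)" for m
      using el_perm[OF e(1), of m] e by simp
  qed
  ultimately show ?thesis unfolding borel_isomorphic_def borel_groupoid_of_simps by blast
qed

lemma coding_borel_equivalence: "borel_equivalence \<G> \<H> coding"
  unfolding borel_equivalence_def
  using coding_borel_functor decoding_borel_functor coding_decoding decoding_coding by blast

end

theorem theorem5p9:
  fixes G :: "('o, 'm) top_groupoid"
  assumes "open_groupoid G"
    and "non_archimedean G"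
    and "quasi_polish_groupoid G"
  shows "\<exists>(L :: nat language) (\<phi> :: nat fm) F.
    countable (symbols L) \<and> sentence L \<phi> \<and>
    borel_equivalence (borel_groupoid_of G) (action_groupoid L \<phi>) F"
proof -
  obtain W U BO RO BM RM where "based_groupoid G W U BO RO BM RM"
    using based_groupoid_exists[OF assms] by blast
  then interpret based_groupoid G W U BO RO BM RM .
  obtain Q D where f: "forces bin_lang good Q D" using good_forcible by (auto simp: forcible_def)
  obtain \<psi> where \<psi>: "\<And>n. formula bin_lang (\<psi> n)" "\<And>n. free_vars (\<psi> n) \<subseteq> {..<n}"
    "\<And>n M v. sat M (\<psi> n) v \<longleftrightarrow> (\<exists>t. Q M (map v [0..<n] @ t))"
    using definable_extension[OF forcesD(1)[OF f]] by (elim definableE) blast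
  have "sentence bin_lang (\<psi> 0)" using \<psi>(1,2)[of 0] by (auto simp: sentence_def)
  moreover have "sat M (\<psi> 0) v \<longleftrightarrow> (\<exists>s. Q M s)" for M v using \<psi>(3)[of M 0 v] by simp
  ultimately interpret coded_groupoid G W U BO RO BM RM Q D "\<psi> 0"
    using f by unfold_locales
  show ?thesis
    using coding_borel_equivalence sentence by (intro exI[of _ bin_lang] exI[of _ "\<psi> 0"] exI[of _ coding]) simp
qed

end
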